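(* Let $a_1,\ldots,a_N\in\mathbb{R}$ be such that the sets $\Lambda_i=\{a_i-k^2\pi^2 \mid k\in\mathbb{N}\}$, $1\le i\le N$, are pairwise disjoint, and let $c\in L^2(0,1)$. Let $\delta>0$ be arbitrary. For every $1\le i\le N$, let $n_{0,i}\in\mathbb{N}$ be such that $\lambda_{i,n_{0,i}}<-\delta$, and set $n_0=\sum_{i=1}^N n_{0,i}$. Assume that $$\int_0^1 c(x)\cos(k\pi x)\,\mathrm{d}x\neq 0 \quad (0\le k\le n_{0,1}-1),\qquad \int_0^1 c(x)\cosh(r_{i,k}^1(1-x))\,\mathrm{d}x\neq 0\quad (2\le i\le N,\ 0\le k\le n_{0,i}-1).$$ Let $K=\begin{bmatrix}K_x & k_u\end{bmatrix}\in\mathbb{R}^{1\times(n_0+1)}$ and $L\in\mathbb{R}^{n_0}$ be such that $A_{1,a}-B_{1,a}K$ and $A_1-LC_1$ are Hurwitz with spectral abscissa less than $-\delta$. Then, for large enough integers $n_i\ge n_{0,i}$, $1\le i\le N$, there exists $C>0$ such that, for all initial conditions $y_0^j\in L^2(0,1)$ ($1\le j\le N$), $u(0)=u_0\in\mathbb{R}$, $\hat X_1(0)\in\mathbb{R}^{n_0}$, $\hat x_{i,k}(0)\in\mathbb{R}$, the solutions of the closed-loop system consisting of the PDE cascade, the output $z(t)=\int_0^1 c(x)y^1(t,x)\,\mathrm{d}x$ and the controller (all described in the context) satisfy $$\big\Vert (y^j(t,\cdot))_{1\le j\le N}\big\Vert_Y+|u(t)|+\Vert\hat X_1(t)\Vert+\sum_{i=1}^N\sum_{k=n_{0,i}}^{n_i}|\hat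 x_{i,k}(t)|\le C e^{-\delta t}\Big(\big\Vert (y_0^j)_{1\le j\le N}\big\Vert_Y+|u_0|+\Vert\hat X_1(0)\Vert+\sum_{i=1}^N\sum_{k=n_{0,i}}^{n_i}|\hat x_{i,k}(0)|\Big)$$ for every $t\ge 0$, with $Y=\mathcal{H}^0$. If moreover the initial condition is such that $y_0^j\in H^2(0,1)$ for all $1\le j\le N$, with $(y_0^j)'(0)=y_0^{j+1}(1)$ and $(y_0^j)'(1)=0$ for all $1\le j\le N-1$, and $(y_0^N)'(0)=u(0)$ and $(y_0^N)'(1)=0$, then the same conclusion holds with $Y=\mathcal{H}^1$.
   Context: $N$ is a positive integer, $\mathbb{N}=\{0,1,2,\ldots\}$, $\mathcal{H}^0=(L^2(0,1))^N$ and $\mathcal{H}^1=(H^1(0,1))^N$ with their usual inner products $\langle f,g\rangle_{\mathcal{H}^0}=\sum_j\int_0^1 f^jg^j$ and $\langle f,g\rangle_{\mathcal{H}^1}=\sum_j\int_0^1(f^jg^j+(f^j)'(g^j)')$. PDE cascade (state $(y^j)_{1\le j\le N}$, scalar input $u$): $y^j_t=y^j_{xx}+a_jy^j$ on $(0,1)$ for $1\le j\le N$; $y^j_x(t,0)=y^{j+1}(t,1)$, $y^j_x(t,1)=0$ for $1\le j\le N-1$; $y^N_x(t,0)=u(t)$, $y^N_x(t,1)=0$; $y^j(0,x)=y^j_0(x)$. Solutions are understood in the usual semigroup sense. Spectral notation: $\lambda_{i,k}=a_i-k^2\pi^2$; $\mu_0=1$, $\mu_k=\sqrt2$ for $k\ge1$;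 $r_{i,k}^j$ is one of the two (possibly complex) square roots of $\lambda_{i,k}-a_j$ (the expressions below do not depend on the choice). For $1\le i\le N$, $k\in\mathbb{N}$, $\phi_{i,k}=(\phi_{i,k}^j)_{1\le j\le N}$ and $\psi_{i,k}=(\psi_{i,k}^j)_{1\le j\le N}$ are given by $\phi_{i,k}^j(x)=\frac{(-1)^{k+i-j}\mu_k}{\prod_{j'=j}^{i-1}r_{i,k}^{j'}\sinh(r_{i,k}^{j'})}\cosh(r_{i,k}^j(1-x))$ if $1\le j\le i-1$, $\phi_{i,k}^i(x)=\mu_k\cos(k\pi x)$, $\phi_{i,k}^j=0$ if $j\ge i+1$; $\psi_{i,k}^j=0$ if $1\le j\le i-1$, $\psi_{i,k}^i(x)=\mu_k\cos(k\pi x)$, $\psi_{i,k}^j(x)=\frac{(-1)^{j-i}\mu_k}{\prod_{j'=i+1}^{j}r_{i,k}^{j'}\sinh(r_{i,k}^{j'})}\cosh(r_{i,k}^jx)$ if $i+1\le j\le N$. Let $\varphi(x)=-\frac12(1-x)^2$, $\alpha=(0,\ldots,0,\varphi''+a_N\varphi)$, $\beta=(0,\ldots,0,-\varphi)$ in $\mathcal{H}^0$, $\alpha_{i,k}=\langle\alpha,\psi_{i,k}\rangle_{\mathcal{H}^0}$, $\beta_{i,k}=\langle\beta,\psi_{i,k}\rangle_{\mathcal{H}^0}$, and $c_{i,k}=\int_0^1c(x)\phi_{i,k}^1(x)\,\mathrm{d}x$. Matrices: $A_1=\mathrm{diag}(A_{1,1},\ldots,A_{1,N})$ with $A_{1,i}=\mathrm{diag}(\lambda_{i,0},\ldots,\lambda_{i,n_{0,i}-1})$;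 $B_{1,u}$ and $B_{1,v}$ are the column vectors obtained by stacking, for $i=1,\ldots,N$, the columns $(\alpha_{i,0},\ldots,\alpha_{i,n_{0,i}-1})^\top$, respectively $(\beta_{i,0},\ldots,\beta_{i,n_{0,i}-1})^\top$; $C_1$ is the row vector obtained by concatenating, for $i=1,\ldots,N$, the rows $(c_{i,0},\ldots,c_{i,n_{0,i}-1})$; $A_{1,a}=\begin{bmatrix}A_1&B_{1,u}\\0&0\end{bmatrix}$, $B_{1,a}=\begin{bmatrix}B_{1,v}\\1\end{bmatrix}$. Controller (state $u\in\mathbb{R}$, $\hat X_1\in\mathbb{R}^{n_0}$, $\hat x_{i,k}\in\mathbb{R}$ for $1\le i\le N$, $n_{0,i}\le k\le n_i$; input $z$): $\dot u=v$; $\dot{\hat X}_1=A_1\hat X_1+B_{1,u}u+B_{1,v}v-L\big(C_1\hat X_1+\sum_{i=1}^N\sum_{k=n_{0,i}}^{n_i}c_{i,k}\hat x_{i,k}-z\big)$; $\dot{\hat x}_{i,k}=\lambda_{i,k}\hat x_{i,k}+\alpha_{i,k}u+\beta_{i,k}v$ for $1\le i\le N$, $n_{0,i}\le k\le n_i$; $v=-K_x\hat X_1-k_uu$.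
   Formalization: For N=1 the formal theorem additionally assumes that the integral of c times φ over (0,1) is zero; without this the claim fails (e.g. N=1, a_1=1, c=1, δ=1/10, n_0=1, K=(-2.1, 2.35), L=2 gives an unstable closed loop). Nothing is added for N≥2. *)

theory Defs
  imports "HOL-Analysis.Analysis" "Jordan_Normal_Form.Spectral_Radius"
begin

section \<open>The Hilbert space of square-integrable functions on the unit interval\<close>

abbreviation unit_leb :: "real measure" where
  "unit_leb \<equiv> lebesgue_on {0<..<1}"

definition square_integrable :: "(real \<Rightarrow> real) \<Rightarrow> bool" where
  "square_integrable f \<longleftrightarrow>
     f \<in> borel_measurable unit_leb \<and> integrable unit_leb (\<lambda>x. (f x)\<^sup>2)"

lemma square_integrable_mult:
  assumes "square_integrable f" "square_integrable g"
  shows "integrable unit_leb (\<lambda>x. f x * g x)"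
proof (rule Bochner_Integration.integrable_bound)
  show "integrable unit_leb (\<lambda>x. (f x)\<^sup>2 + (g x)\<^sup>2)"
    using assms by (simp add: square_integrable_def)
  show "(\<lambda>x. f x * g x) \<in> borel_measurable unit_leb"
    using assms by (auto simp: square_integrable_def)
  have "\<bar>p * q\<bar> \<le> p\<^sup>2 + q\<^sup>2" for p q :: real
  proof -
    have "2 * \<bar>p\<bar> * \<bar>q\<bar> \<le> p\<^sup>2 + q\<^sup>2" "0 \<le> \<bar>p\<bar> * \<bar>q\<bar>"
      using sum_squares_bound[of "\<bar>p\<bar>" "\<bar>q\<bar>"] by simp_all
    then show ?thesis
      by (simp only: abs_mult)
  qed
  then show "AE x in unit_leb. norm (f x * g x) \<le> norm ((f x)\<^sup>2 + (g x)\<^sup>2)"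
    by simp
qed

lemma square_integrable_0: "square_integrable (\<lambda>x. 0)"
  by (simp add: square_integrable_def)

lemma square_integrable_scale:
  "square_integrable f \<Longrightarrow> square_integrable (\<lambda>x. r * f x)"
  by (auto simp: square_integrable_def power_mult_distrib)

lemma square_integrable_add:
  assumes "square_integrable f" "square_integrable g"
  shows "square_integrable (\<lambda>x. f x + g x)"
proof -
  have "(\<lambda>x. (f x + g x)\<^sup>2) = (\<lambda>x. (f x)\<^sup>2 + (g x)\<^sup>2 + 2 * (f x * g x))"
    by (auto simp: power2_eq_square algebra_simps)
  then show ?thesis
    using assms square_integrable_mult[OF assms]
    unfolding square_integrable_def by (auto intro!: Bochner_Integration.integrable_add)
qed

definition L2_rel :: "(real \<Rightarrow> real) \<Rightarrow> (real \<Rightarrow> real) \<Rightarrow> bool" where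
  "L2_rel f g \<longleftrightarrow>
     square_integrable f \<and> square_integrable g \<and> (AE x in unit_leb. f x = g x)"

lemma part_equivp_L2_rel: "part_equivp L2_rel"
proof (rule part_equivpI)
  show "\<exists>f. L2_rel f f"
    using square_integrable_0 by (auto simp: L2_rel_def)
  show "symp L2_rel"
    by (auto simp: symp_def L2_rel_def elim: eventually_mono)
  show "transp L2_rel"
  proof (rule transpI)
    fix f g h assume fg: "L2_rel f g" and gh: "L2_rel g h"
    then have "AE x in unit_leb. f x = g x" "AE x in unit_leb. g x = h x"
      by (simp_all add: L2_rel_def)
    then have "AE x in unit_leb. f x = h x"
      by eventually_elim simp
    with fg gh show "L2_rel f h"
      by (simp add: L2_rel_def)
  qed
qed

(* L2_of f is the class of f; it carries information only for square-integrable f. *)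
quotient_type L2 = "real \<Rightarrow> real" / partial: L2_rel
  morphisms rep_L2 L2_of
  by (rule part_equivp_L2_rel)

instantiation L2 :: real_inner
begin

lift_definition zero_L2 :: L2 is "\<lambda>x. 0"
  by (simp add: L2_rel_def square_integrable_0)

lift_definition plus_L2 :: "L2 \<Rightarrow> L2 \<Rightarrow> L2" is "\<lambda>f g x. f x + g x"
  unfolding L2_rel_def by (auto intro: square_integrable_add elim: eventually_elim2)

lift_definition scaleR_L2 :: "real \<Rightarrow> L2 \<Rightarrow> L2" is "\<lambda>r f x. r * f x"
  unfolding L2_rel_def by (auto intro: square_integrable_scale elim: eventually_mono)

lift_definition uminus_L2 :: "L2 \<Rightarrow> L2" is "\<lambda>f x. - f x"
  unfolding L2_rel_def using square_integrable_scale[of _ "-1"] by (auto elim: eventually_mono)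

definition minus_L2 :: "L2 \<Rightarrow> L2 \<Rightarrow> L2" where
  "minus_L2 f g = f + - g"

lift_definition inner_L2 :: "L2 \<Rightarrow> L2 \<Rightarrow> real" is "\<lambda>f g. LINT x|unit_leb. f x * g x"
proof -
  fix f f' g g' assume f: "L2_rel f f'" and g: "L2_rel g g'"
  then have "AE x in unit_leb. f x = f' x" "AE x in unit_leb. g x = g' x"
    by (simp_all add: L2_rel_def)
  then have "AE x in unit_leb. f x * g x = f' x * g' x"
    by eventually_elim simp
  moreover have "(\<lambda>x. f x * g x) \<in> borel_measurable unit_leb"
    "(\<lambda>x. f' x * g' x) \<in> borel_measurable unit_leb"
    using f g by (auto simp: L2_rel_def square_integrable_def)
  ultimately show "(LINT x|unit_leb. f x * g x) = (LINT x|unit_leb. f' x * g' x)"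
    by (intro integral_cong_AE)
qed

definition norm_L2 :: "L2 \<Rightarrow> real" where
  "norm_L2 f = sqrt (inner f f)"

definition sgn_L2 :: "L2 \<Rightarrow> L2" where
  "sgn_L2 f = scaleR (inverse (norm f)) f"

definition dist_L2 :: "L2 \<Rightarrow> L2 \<Rightarrow> real" where
  "dist_L2 f g = norm (f - g)"

definition uniformity_L2 :: "(L2 \<times> L2) filter" where
  "uniformity_L2 = (INF e\<in>{0 <..}. principal {(f, g). dist f g < e})"

definition open_L2 :: "L2 set \<Rightarrow> bool" where
  "open_L2 U \<longleftrightarrow> (\<forall>f\<in>U. eventually (\<lambda>(f', g). f' = f \<longrightarrow> g \<in> U) uniformity)"

instance
proof
  fix f g h :: L2 and r s :: real
  show "f + g + h = f + (g + h)"
    by transfer (simp add: L2_rel_def add_ac square_integrable_add)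
  show "f + g = g + f"
    by transfer (simp add: L2_rel_def add_ac square_integrable_add)
  show "0 + f = f"
    by transfer (auto simp: L2_rel_def)
  show "- f + f = 0"
    by transfer (auto simp: L2_rel_def square_integrable_0)
  show "f - g = f + - g"
    by (rule minus_L2_def)
  show "r *\<^sub>R (f + g) = r *\<^sub>R f + r *\<^sub>R g"
    by transfer (simp add: L2_rel_def distrib_left square_integrable_add square_integrable_scale)
  show "(r + s) *\<^sub>R f = r *\<^sub>R f + s *\<^sub>R f"
    by transfer (simp add: L2_rel_def distrib_right square_integrable_add square_integrable_scale)
  show "r *\<^sub>R s *\<^sub>R f = (r * s) *\<^sub>R f"
    by transfer (simp add: L2_rel_def mult.assoc square_integrable_scale)
  show "1 *\<^sub>R f = f"
    by transfer (auto simp: L2_rel_def)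
  show "sgn f = scaleR (inverse (norm f)) f"
    by (rule sgn_L2_def)
  show "dist f g = norm (f - g)"
    by (rule dist_L2_def)
  show "uniformity = (INF e\<in>{0 <..}. principal {(f, g). dist f (g :: L2) < e})"
    by (rule uniformity_L2_def)
  show "open U \<longleftrightarrow> (\<forall>f\<in>U. eventually (\<lambda>(f', g). f' = f \<longrightarrow> g \<in> U) uniformity)"
    for U :: "L2 set"
    by (rule open_L2_def)
  show "inner f g = inner g f"
    by transfer (simp add: mult.commute)
  show "inner (f + g) h = inner f h + inner g h"
    by transfer (simp add: L2_rel_def distrib_right square_integrable_mult)
  show "inner (r *\<^sub>R f) g = r * inner f g"
    by transfer (simp add: mult.assoc)
  show "0 \<le> inner f f"
    by transfer simp
  show "inner f f = 0 \<longleftrightarrow> f = 0"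
  proof (transfer)
    fix f :: "real \<Rightarrow> real" assume "L2_rel f f"
    then have f: "square_integrable f"
      by (simp add: L2_rel_def)
    then have "integrable unit_leb (\<lambda>x. f x * f x)"
      by (intro square_integrable_mult)
    then have "(LINT x|unit_leb. f x * f x) = 0 \<longleftrightarrow> (AE x in unit_leb. f x * f x = 0)"
      by (intro integral_nonneg_eq_0_iff_AE) auto
    then show "(LINT x|unit_leb. f x * f x) = 0 \<longleftrightarrow> L2_rel f (\<lambda>x. 0)"
      using f by (simp add: L2_rel_def square_integrable_0)
  qed
  show "norm f = sqrt (inner f f)"
    by (rule norm_L2_def)
qed

end


section \<open>Sobolev spaces on the unit interval\<close>

(* H^1(0,1) as the space of absolutely continuous functions F with square-integrable derivative G;
   F is determined by f on [0,1], and G almost everywhere. *)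
definition has_weak_deriv :: "L2 \<Rightarrow> L2 \<Rightarrow> bool" where
  "has_weak_deriv f g \<longleftrightarrow>
     (\<exists>F G. f = L2_of F \<and> g = L2_of G \<and> square_integrable G \<and>
        (\<forall>x\<in>{0..1}. (G has_integral (F x - F 0)) {0..x}))"

definition weak_deriv :: "L2 \<Rightarrow> L2" where
  "weak_deriv f = (THE g. has_weak_deriv f g)"

definition H1 :: "L2 set" where
  "H1 = {f. \<exists>g. has_weak_deriv f g}"

definition H2 :: "L2 set" where
  "H2 = {f \<in> H1. weak_deriv f \<in> H1}"

(* Point value, for x in [0,1], of the continuous representative. *)
definition pt :: "L2 \<Rightarrow> real \<Rightarrow> real" where
  "pt f x = (THE v. \<exists>F. continuous_on {0..1} F \<and> f = L2_of F \<and> v = F x)"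

(* Elements of the N-fold products are families indexed by {1..N}; other entries are ignored. *)
definition norm_H0 :: "nat \<Rightarrow> (nat \<Rightarrow> L2) \<Rightarrow> real" where
  "norm_H0 N y = sqrt (\<Sum>j=1..N. (norm (y j))\<^sup>2)"

definition norm_H1 :: "nat \<Rightarrow> (nat \<Rightarrow> L2) \<Rightarrow> real" where
  "norm_H1 N y = sqrt (\<Sum>j=1..N. (norm (y j))\<^sup>2 + (norm (weak_deriv (y j)))\<^sup>2)"


section \<open>Mild solutions of the cascade\<close>

definition cascade_dom :: "nat \<Rightarrow> (nat \<Rightarrow> L2) \<Rightarrow> real \<Rightarrow> bool" where
  "cascade_dom N y u \<longleftrightarrow>
     (\<forall>j\<in>{1..N}. y j \<in> H2) \<and>
     (\<forall>j\<in>{1..<N}. pt (weak_deriv (y j)) 0 = pt (y (Suc j)) 1 \<and> pt (weak_deriv (y j)) 1 = 0) \<and>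
     pt (weak_deriv (y N)) 0 = u \<and> pt (weak_deriv (y N)) 1 = 0"

definition cascade_op :: "(nat \<Rightarrow> real) \<Rightarrow> (nat \<Rightarrow> L2) \<Rightarrow> nat \<Rightarrow> L2" where
  "cascade_op a y j = weak_deriv (weak_deriv (y j)) + a j *\<^sub>R y j"

(* With the controller below, the closed loop is an abstract Cauchy problem X' = A X for the
   state X consisting of y, u and the observer variables; the boundary conditions, including
   y^N_x(0) = u, belong to the domain of A. Mild solutions are meant in the sense of semigroup
   theory: X is continuous, the integral of X over [0,t] lies in the domain of A, and
   X(t) = X(0) + A (integral of X over [0,t]); these are the orbits of the semigroup generated
   by A. The following are the PDE components of this identity. *)
definition cascade_mild_solution ::
    "nat \<Rightarrow> (nat \<Rightarrow> real) \<Rightarrow> (real \<Rightarrow> real) \<Rightarrow> (real \<Rightarrow> nat \<Rightarrow> L2) \<Rightarrow> bool" where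
  "cascade_mild_solution N a u y \<longleftrightarrow>
     continuous_on {0..} u \<and> (\<forall>j\<in>{1..N}. continuous_on {0..} (\<lambda>t. y t j)) \<and>
     (\<forall>t\<ge>0. \<exists>Y. (\<forall>j\<in>{1..N}. ((\<lambda>s. y s j) has_integral Y j) {0..t}) \<and>
        cascade_dom N Y (integral {0..t} u) \<and>
        (\<forall>j\<in>{1..N}. y t j = y 0 j + cascade_op a Y j))"


section \<open>Spectral data\<close>

definition lam :: "(nat \<Rightarrow> real) \<Rightarrow> nat \<Rightarrow> nat \<Rightarrow> real" where
  "lam a i k = a i - (real k)\<^sup>2 * pi\<^sup>2"

definition mu :: "nat \<Rightarrow> real" where
  "mu k = (if k = 0 then 1 else sqrt 2)"

definition rt :: "(nat \<Rightarrow> real) \<Rightarrow> nat \<Rightarrow> nat \<Rightarrow> nat \<Rightarrow> complex" where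
  "rt a i k j = csqrt (complex_of_real (lam a i k - a j))"

(* In phi and psi the complex expressions are real-valued, because each rt is real or purely
   imaginary; Re only changes the type. *)
definition phi :: "(nat \<Rightarrow> real) \<Rightarrow> nat \<Rightarrow> nat \<Rightarrow> nat \<Rightarrow> real \<Rightarrow> real" where
  "phi a i k j x =
     (if j < i then
        Re ((- 1) ^ (k + i - j) * complex_of_real (mu k)
              / (\<Prod>j'\<in>{j..<i}. rt a i k j' * sinh (rt a i k j'))
            * cosh (rt a i k j * complex_of_real (1 - x)))
      else if j = i then mu k * cos (real k * pi * x)
      else 0)"

definition psi :: "(nat \<Rightarrow> real) \<Rightarrow> nat \<Rightarrow> nat \<Rightarrow> nat \<Rightarrow> real \<Rightarrow> real" where
  "psi a i k j x =
     (if j < i then 0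
      else if j = i then mu k * cos (real k * pi * x)
      else
        Re ((- 1) ^ (j - i) * complex_of_real (mu k)
              / (\<Prod>j'\<in>{i+1..j}. rt a i k j' * sinh (rt a i k j'))
            * cosh (rt a i k j * complex_of_real x)))"

(* If y solves the cascade, replacing y^N by w^N = y^N - u * lifting makes all boundary conditions
   homogeneous, with source terms alpha_fun * u + beta_fun * u'. The observer below treats the output
   as the integral of c * w^1. This equals the integral of c * y^1 if N >= 2; if N = 1, they
   differ by u times the integral of c * lifting. *)
definition lifting :: "real \<Rightarrow> real" where
  "lifting x = - (1 - x)\<^sup>2 / 2"

definition alpha_fun :: "nat \<Rightarrow> (nat \<Rightarrow> real) \<Rightarrow> nat \<Rightarrow> real \<Rightarrow> real" where
  "alpha_fun N a j x = (if j = N then deriv (deriv lifting) x + a N * lifting x else 0)"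

definition beta_fun :: "nat \<Rightarrow> nat \<Rightarrow> real \<Rightarrow> real" where
  "beta_fun N j x = (if j = N then - lifting x else 0)"

definition alpha :: "nat \<Rightarrow> (nat \<Rightarrow> real) \<Rightarrow> nat \<Rightarrow> nat \<Rightarrow> real" where
  "alpha N a i k = (\<Sum>j=1..N. LINT x|unit_leb. alpha_fun N a j x * psi a i k j x)"

definition beta :: "nat \<Rightarrow> (nat \<Rightarrow> real) \<Rightarrow> nat \<Rightarrow> nat \<Rightarrow> real" where
  "beta N a i k = (\<Sum>j=1..N. LINT x|unit_leb. beta_fun N j x * psi a i k j x)"

definition c_coeff :: "(nat \<Rightarrow> real) \<Rightarrow> (real \<Rightarrow> real) \<Rightarrow> nat \<Rightarrow> nat \<Rightarrow> real" where
  "c_coeff a c i k = (LINT x|unit_leb. c x * phi a i k 1 x)"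


section \<open>Finite-dimensional matrices\<close>

definition dim0 :: "nat \<Rightarrow> (nat \<Rightarrow> nat) \<Rightarrow> nat" where
  "dim0 N n0 = (\<Sum>i=1..N. n0 i)"

definition stack :: "nat \<Rightarrow> (nat \<Rightarrow> nat) \<Rightarrow> (nat \<Rightarrow> nat \<Rightarrow> real) \<Rightarrow> real vec" where
  "stack N n0 f = vec_of_list (concat (map (\<lambda>i. map (f i) [0..<n0 i]) [1..<Suc N]))"

definition A1 :: "nat \<Rightarrow> (nat \<Rightarrow> real) \<Rightarrow> (nat \<Rightarrow> nat) \<Rightarrow> real mat" where
  "A1 N a n0 = diag_block_mat (map (\<lambda>i. mat_diag (n0 i) (lam a i)) [1..<Suc N])"

definition B1u :: "nat \<Rightarrow> (nat \<Rightarrow> real) \<Rightarrow> (nat \<Rightarrow> nat) \<Rightarrow> real vec" where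
  "B1u N a n0 = stack N n0 (alpha N a)"

definition B1v :: "nat \<Rightarrow> (nat \<Rightarrow> real) \<Rightarrow> (nat \<Rightarrow> nat) \<Rightarrow> real vec" where
  "B1v N a n0 = stack N n0 (beta N a)"

definition C1 :: "nat \<Rightarrow> (nat \<Rightarrow> real) \<Rightarrow> (real \<Rightarrow> real) \<Rightarrow> (nat \<Rightarrow> nat) \<Rightarrow> real vec" where
  "C1 N a c n0 = stack N n0 (c_coeff a c)"

definition mat_of_col :: "real vec \<Rightarrow> real mat" where
  "mat_of_col v = mat_of_cols (dim_vec v) [v]"

definition A1a :: "nat \<Rightarrow> (nat \<Rightarrow> real) \<Rightarrow> (nat \<Rightarrow> nat) \<Rightarrow> real mat" where
  "A1a N a n0 = four_block_mat
     (A1 N a n0)             (mat_of_col (B1u N a n0))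
     (0\<^sub>m 1 (dim0 N n0))       (0\<^sub>m 1 1)"

definition B1a :: "nat \<Rightarrow> (nat \<Rightarrow> real) \<Rightarrow> (nat \<Rightarrow> nat) \<Rightarrow> real mat" where
  "B1a N a n0 = mat_of_col (B1v N a n0 @\<^sub>v vec_of_list [1])"

definition gain_row :: "real vec \<Rightarrow> real \<Rightarrow> real mat" where
  "gain_row Kx ku = mat_of_row (Kx @\<^sub>v vec_of_list [ku])"

(* Extended-real valued, so that the empty matrix has spectral abscissa minus infinity. *)
definition spectral_abscissa :: "real mat \<Rightarrow> ereal" where
  "spectral_abscissa M = (SUP s\<in>spectrum (map_mat complex_of_real M). ereal (Re s))"


section \<open>The closed loop\<close>

definition obs_tail ::
    "nat \<Rightarrow> (nat \<Rightarrow> nat) \<Rightarrow> (nat \<Rightarrow> nat) \<Rightarrow> (nat \<Rightarrow> nat \<Rightarrow> real) \<Rightarrow> real" where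
  "obs_tail N n0 n f = (\<Sum>i=1..N. \<Sum>k=n0 i..n i. f i k)"

definition closed_loop_solution ::
    "nat \<Rightarrow> (nat \<Rightarrow> real) \<Rightarrow> (real \<Rightarrow> real) \<Rightarrow> (nat \<Rightarrow> nat) \<Rightarrow> (nat \<Rightarrow> nat) \<Rightarrow>
     real vec \<Rightarrow> real \<Rightarrow> real vec \<Rightarrow>
     (real \<Rightarrow> nat \<Rightarrow> L2) \<Rightarrow> (real \<Rightarrow> real) \<Rightarrow> (real \<Rightarrow> real vec) \<Rightarrow> (real \<Rightarrow> nat \<Rightarrow> nat \<Rightarrow> real) \<Rightarrow> bool"
  where
  "closed_loop_solution N a c n0 n Kx ku L y u Xh xh \<longleftrightarrow>
     (let v = (\<lambda>t. - (Kx \<bullet> Xh t) - ku * u t);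
          z = (\<lambda>t. inner (L2_of c) (y t 1));
          innov = (\<lambda>t. C1 N a c n0 \<bullet> Xh t
                      + obs_tail N n0 n (\<lambda>i k. c_coeff a c i k * xh t i k) - z t)
      in cascade_mild_solution N a u y \<and>
         (\<forall>t\<ge>0. Xh t \<in> carrier_vec (dim0 N n0)) \<and>
         (\<forall>t\<ge>0. (u has_real_derivative v t) (at t within {0..})) \<and>
         (\<forall>t\<ge>0. \<forall>p<dim0 N n0.
            ((\<lambda>s. vec_index (Xh s) p) has_real_derivative
               vec_index (A1 N a n0 *\<^sub>v Xh t + u t \<cdot>\<^sub>v B1u N a n0 + v t \<cdot>\<^sub>v B1v N a n0
                 - innov t \<cdot>\<^sub>v L) p) (at t within {0..})) \<and>
         (\<forall>t\<ge>0. \<forall>i\<in>{1..N}. \<forall>k\<in>{n0 i..n i}.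
            ((\<lambda>s. xh s i k) has_real_derivative
               lam a i k * xh t i k + alpha N a i k * u t + beta N a i k * v t)
              (at t within {0..})))"

definition controller_norm ::
    "nat \<Rightarrow> (nat \<Rightarrow> nat) \<Rightarrow> (nat \<Rightarrow> nat) \<Rightarrow> real \<Rightarrow> real vec \<Rightarrow> (nat \<Rightarrow> nat \<Rightarrow> real) \<Rightarrow> real" where
  "controller_norm N n0 n u X x =
     \<bar>u\<bar> + sqrt (X \<bullet> X) + obs_tail N n0 n (\<lambda>i k. \<bar>x i k\<bar>)"

end

theory Submission
  imports Defs
begin

text \<open>
  Subtracting \<open>u\<close> times the lifting from the last component makes the boundary conditions
  homogeneous. The coefficients \<open>w i k\<close> of the result along the eigenfunctions \<open>psi\<close> of the adjoint
  then solve scalar equations \<open>w' = lam w + alpha u + beta v\<close> (\<open>modal_ode\<close>). The proof works with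
  these scalar equations only, and closes a small-gain loop.

  Call head modes those that the observer corrects by \<open>L\<close>, tail modes those that it only simulates,
  and neglected modes the rest. The tail errors solve \<open>e' = lam e\<close> and decay by themselves. The
  head error is driven through \<open>A1 - L C1\<close> by the tail errors and by the contribution \<open>\<zeta>\<close> of the
  neglected modes to the output; the pair (observer state, \<open>u\<close>) is driven through \<open>A1a - B1a K\<close> by
  the innovation. Both matrices have their spectrum strictly to the left of \<open>- \<delta>\<close>, so a bound
  \<open>\<bar>\<zeta>\<bar> \<le> Z exp (- \<delta> t)\<close> gives a bound \<open>m exp (- \<delta> t)\<close> for the controller state, where \<open>m\<close> is affine
  in \<open>Z\<close> with a slope independent of the orders \<open>n i\<close> (\<open>linear_system_decay\<close>). Conversely, in the
  neglected modes variation of constants divides the forcing by \<open>- \<delta> - lam\<close>, so such a bound on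
  the controller returns a bound on \<open>\<zeta>\<close> whose slope in \<open>m\<close> tends to \<open>0\<close> as the \<open>n i\<close> grow. For large
  orders the product of the two slopes is at most \<open>1 / 2\<close> and \<open>m\<close> is bounded by the initial data
  (\<open>controller_decay\<close>). Here \<open>m\<close> is a maximum over a compact time interval, so that all quantities
  are finite and no infinite series has to be differentiated in time.

  Passing between the state and its coefficients requires that the family \<open>psi\<close> be a Riesz basis, in
  the form of two inequalities. Since \<open>psi a i k j\<close> vanishes for \<open>j < i\<close> and is the cosine basis for
  \<open>j = i\<close>, the map from \<open>f\<close> to its coefficients is block triangular with isometric diagonal blocks.
  Its other blocks are bounded because \<open>psi a i k j\<close> is, up to an error of order \<open>1 / k\<close>, a bounded
  multiple of \<open>cos (k pi x)\<close>; disjointness of the spectra keeps the denominators in \<open>psi\<close> away from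
  zero. Hence the coefficients are square summable (\<open>coef_bessel\<close>), and recursion from the last
  component down to the first bounds the state by them (\<open>riesz_lower\<close>). The same triangular
  argument with the weight \<open>k\<close> gives the estimates in \<open>H1\<close> (\<open>coef_bessel_H1\<close>, \<open>riesz_lower_H1\<close>),
  because a function belongs to \<open>H1\<close> exactly when its cosine coefficients times \<open>k\<close> are square
  summable, whatever its boundary values. With these, the decay of the controller carries over to
  all modes, and then to the state in either norm (\<open>closed_loop_decay\<close>).
\<close>

section \<open>Exponential decay of forced linear systems\<close>

text \<open>Variation of constants: \<open>exp (- \<mu> s) * z s\<close> has the derivative \<open>exp (- \<mu> s) * h s\<close>, whose norm is at
  most the derivative of an explicit exponential.\<close>

lemma scalar_decay:
  fixes z h :: "real \<Rightarrow> complex" and \<mu> :: complex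
  assumes T: "t \<in> {0..T}"
    and z: "\<And>s. s \<in> {0..T} \<Longrightarrow> (z has_vector_derivative \<mu> * z s + h s) (at s within {0..T})"
    and h: "\<And>s. s \<in> {0..T} \<Longrightarrow> norm (h s) \<le> H * exp (- \<delta> * s)"
    and \<mu>: "Re \<mu> < - \<delta>"
  shows "norm (z t) \<le> exp (- \<delta> * t) * (norm (z 0) + H / (- \<delta> - Re \<mu>))"
proof -
  define \<rho> where "\<rho> = - \<delta> - Re \<mu>"
  have \<rho>: "\<rho> > 0" using \<mu> by (simp add: \<rho>_def)
  have H: "0 \<le> H"
    using h[of 0] T norm_ge_zero[of "h 0"] order_trans[of 0 "norm (h 0)" H] by auto
  show ?thesis
  proof (cases "t = 0")
    case True
    then show ?thesis using H \<rho> by (simp add: \<rho>_def)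
  next
    case False
    then have t: "0 < t" "t \<le> T" using T by auto
    define q where "q = (\<lambda>s. exp (of_real s * (- \<mu>)) * z s)"
    define q' where "q' = (\<lambda>s. exp (of_real s * (- \<mu>)) * h s)"
    define \<phi> where "\<phi> = (\<lambda>s. H / \<rho> * exp (\<rho> * s))"
    have q: "(q has_vector_derivative q' s) (at s within {0..T})" if "s \<in> {0..T}" for s
    proof -
      have "((\<lambda>s. exp (of_real s * (- \<mu>))) has_vector_derivative
              of_real 1 * (- \<mu>) * exp (of_real s * (- \<mu>))) (at s within {0..T})"
        by (auto intro!: derivative_eq_intros has_vector_derivative_real_field)
      from has_vector_derivative_mult[OF this z[OF that]]
      show ?thesis
        unfolding q_def q'_def by (rule has_vector_derivative_eq_rhs) (simp add: algebra_simps)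
    qed
    have "norm (q t - q 0) \<le> \<phi> t - \<phi> 0"
    proof (rule differentiable_bound_general[OF t(1)])
      show "continuous_on {0..t} q"
        using continuous_on_vector_derivative[of "{0..T}", OF q] t
        by (meson atLeastatMost_subset_iff continuous_on_subset order_refl)
      show "continuous_on {0..t} \<phi>"
        unfolding \<phi>_def by (intro continuous_intros)
      fix s assume s: "0 < s" "s < t"
      show "(q has_vector_derivative q' s) (at s)"
        using q[of s] s t at_within_interior[of s "{0..T}"] by (simp add: interior_atLeastAtMost_real)
      show "(\<phi> has_vector_derivative H * exp (\<rho> * s)) (at s)"
        unfolding \<phi>_def using \<rho>
        by (auto intro!: derivative_eq_intros simp: has_real_derivative_iff_has_vector_derivative[symmetric])
      have "norm (q' s) = exp (- Re \<mu> * s) * norm (h s)"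
        by (simp add: q'_def norm_mult norm_exp_eq_Re mult.commute)
      also have "\<dots> \<le> exp (- Re \<mu> * s) * (H * exp (- \<delta> * s))"
        using h[of s] s t by (intro mult_left_mono) auto
      also have "\<dots> = H * exp (\<rho> * s)"
        by (simp add: \<rho>_def exp_add[symmetric] algebra_simps)
      finally show "norm (q' s) \<le> H * exp (\<rho> * s)" .
    qed
    also have "\<dots> \<le> H / \<rho> * exp (\<rho> * t)"
      using H \<rho> by (simp add: \<phi>_def)
    finally have "norm (q t) \<le> norm (q 0) + H / \<rho> * exp (\<rho> * t)"
      using norm_triangle_sub[of "q t" "q 0"] by linarith
    then have "norm (q t) * exp (Re \<mu> * t) \<le> (norm (z 0) + H / \<rho> * exp (\<rho> * t)) * exp (Re \<mu> * t)"
      by (intro mult_right_mono) (auto simp: q_def)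
    also have "norm (q t) * exp (Re \<mu> * t) = norm (z t)"
    proof -
      have "norm (q t) = exp (- Re \<mu> * t) * norm (z t)"
        by (simp add: q_def norm_mult norm_exp_eq_Re mult.commute)
      then show ?thesis by (simp add: exp_minus field_simps)
    qed
    also have "(norm (z 0) + H / \<rho> * exp (\<rho> * t)) * exp (Re \<mu> * t)
        = norm (z 0) * exp (Re \<mu> * t) + H / \<rho> * exp (- \<delta> * t)"
      by (simp add: \<rho>_def algebra_simps exp_add[symmetric])
    also have "norm (z 0) * exp (Re \<mu> * t) \<le> norm (z 0) * exp (- \<delta> * t)"
      using mult_right_mono[of "Re \<mu>" "- \<delta>" t] \<mu> t by (intro mult_left_mono) auto
    finally show ?thesis
      by (simp add: \<rho>_def[symmetric] algebra_simps)
  qed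
qed

lemma scalar_decay_real:
  fixes z h :: "real \<Rightarrow> real"
  assumes T: "t \<in> {0..T}"
    and z: "\<And>s. s \<in> {0..T} \<Longrightarrow> (z has_real_derivative \<mu> * z s + h s) (at s within {0..T})"
    and h: "\<And>s. s \<in> {0..T} \<Longrightarrow> \<bar>h s\<bar> \<le> H * exp (- \<delta> * s)"
    and \<mu>: "\<mu> < - \<delta>"
  shows "\<bar>z t\<bar> \<le> exp (- \<delta> * t) * (\<bar>z 0\<bar> + H / (- \<delta> - \<mu>))"
proof -
  have "norm (complex_of_real (z t))
      \<le> exp (- \<delta> * t) * (norm (complex_of_real (z 0)) + H / (- \<delta> - Re (of_real \<mu>)))"
  proof (rule scalar_decay[OF T, of _ _ "\<lambda>s. of_real (h s)"])
    fix s assume s: "s \<in> {0..T}"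
    show "((\<lambda>s. complex_of_real (z s)) has_vector_derivative
        of_real \<mu> * of_real (z s) + of_real (h s)) (at s within {0..T})"
      using has_vector_derivative_of_real[OF z[OF s]] by simp
  qed (use h \<mu> in auto)
  then show ?thesis by simp
qed

text \<open>Back substitution: every component is forced by the given data and by the later components only.
  The diagonal entries lie strictly to the left of \<open>- \<delta>\<close>, so no step loses part of the rate.\<close>

lemma upper_triangular_decay:
  fixes B :: "complex mat"
  assumes B: "B \<in> carrier_mat n n" "upper_triangular B"
    and eig: "\<And>p. p < n \<Longrightarrow> Re (B $$ (p, p)) < - \<delta>"
  shows "p < n \<Longrightarrow> \<exists>\<kappa>\<ge>0. \<forall>T z g R t. 0 \<le> R \<longrightarrow> t \<in> {0..T} \<longrightarrow>
      (\<forall>s\<in>{0..T}. \<forall>p<n. ((\<lambda>s. z s p) has_vector_derivative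
          (\<Sum>q<n. B $$ (p, q) * z s q) + g s p) (at s within {0..T})) \<longrightarrow>
      (\<forall>s\<in>{0..T}. \<forall>p<n. norm (g s p) \<le> R * exp (- \<delta> * s)) \<longrightarrow>
      (\<forall>p<n. norm (z 0 p) \<le> R) \<longrightarrow>
      norm (z t p) \<le> \<kappa> * exp (- \<delta> * t) * R" (is "_ \<Longrightarrow> \<exists>\<kappa>\<ge>0. ?P \<kappa> p")
proof (induction "n - p" arbitrary: p rule: less_induct)
  case less
  define Q0 where "Q0 \<kappa> p \<longleftrightarrow> ?P \<kappa> p" for \<kappa> p
  have "\<exists>\<kappa>\<ge>0. Q0 \<kappa> q" if "q \<in> {p<..<n}" for q
    unfolding Q0_def using that less(2) by (intro less(1)) auto
  then obtain \<kappa> where \<kappa>0: "\<And>q. q \<in> {p<..<n} \<Longrightarrow> 0 \<le> \<kappa> q"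
    and Q0: "\<And>q. q \<in> {p<..<n} \<Longrightarrow> Q0 (\<kappa> q) q"
    by metis
  note \<kappa> = Q0[unfolded Q0_def, rule_format]
  define H where "H = (\<Sum>q\<in>{p<..<n}. norm (B $$ (p, q)) * \<kappa> q) + 1"
  have H: "0 \<le> H"
    unfolding H_def using \<kappa>0 by (intro add_nonneg_nonneg sum_nonneg) auto
  define \<rho> where "\<rho> = - \<delta> - Re (B $$ (p, p))"
  have \<rho>: "\<rho> > 0" using eig[OF less(2)] by (simp add: \<rho>_def)
  show ?case
  proof (intro exI[of _ "1 + H / \<rho>"] conjI allI impI)
    show "0 \<le> 1 + H / \<rho>" using H \<rho> by simp
    fix T :: real and z g :: "real \<Rightarrow> nat \<Rightarrow> complex" and R t :: real
    assume R: "0 \<le> R" and t: "t \<in> {0..T}"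
      and z: "\<forall>s\<in>{0..T}. \<forall>p<n. ((\<lambda>s. z s p) has_vector_derivative
          (\<Sum>q<n. B $$ (p, q) * z s q) + g s p) (at s within {0..T})"
      and g: "\<forall>s\<in>{0..T}. \<forall>p<n. norm (g s p) \<le> R * exp (- \<delta> * s)"
      and z0: "\<forall>p<n. norm (z 0 p) \<le> R"
    define h where "h = (\<lambda>s. (\<Sum>q\<in>{p<..<n}. B $$ (p, q) * z s q) + g s p)"
    have split: "(\<Sum>q<n. B $$ (p, q) * z s q) = B $$ (p, p) * z s p + (\<Sum>q\<in>{p<..<n}. B $$ (p, q) * z s q)" for s
    proof -
      have "(\<Sum>q<n. B $$ (p, q) * z s q) = (\<Sum>q\<in>insert p {p<..<n}. B $$ (p, q) * z s q)"
        using less(2) upper_triangularD[OF B(2)] B(1)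
        by (intro sum.mono_neutral_right) (auto simp: not_less_iff_gr_or_eq)
      then show ?thesis by simp
    qed
    have "norm (z t p) \<le> exp (- \<delta> * t) * (norm (z 0 p) + (H * R) / (- \<delta> - Re (B $$ (p, p))))"
    proof (rule scalar_decay[OF t, of _ _ h])
      fix s assume s: "s \<in> {0..T}"
      show "((\<lambda>s. z s p) has_vector_derivative B $$ (p, p) * z s p + h s) (at s within {0..T})"
        using z[rule_format, OF s less(2)] unfolding h_def split add.assoc .
      have "norm (h s) \<le> (\<Sum>q\<in>{p<..<n}. norm (B $$ (p, q)) * (\<kappa> q * exp (- \<delta> * s) * R)) + R * exp (- \<delta> * s)"
        unfolding h_def
      proof (intro norm_triangle_le add_mono order_trans[OF norm_sum] sum_mono)
        show "norm (g s p) \<le> R * exp (- \<delta> * s)" using g s less(2) by auto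
        fix q assume q: "q \<in> {p<..<n}"
        have "norm (z s q) \<le> \<kappa> q * exp (- \<delta> * s) * R"
          by (rule \<kappa>[OF q R s]) (use z g z0 in auto)
        then show "norm (B $$ (p, q) * z s q) \<le> norm (B $$ (p, q)) * (\<kappa> q * exp (- \<delta> * s) * R)"
          by (auto simp: norm_mult intro: mult_left_mono)
      qed
      also have "\<dots> = (H * R) * exp (- \<delta> * s)"
        by (simp add: H_def algebra_simps sum_distrib_left sum_distrib_right)
      finally show "norm (h s) \<le> (H * R) * exp (- \<delta> * s)" .
    qed (use eig less(2) in auto)
    also have "\<dots> \<le> exp (- \<delta> * t) * (R + (H * R) / (- \<delta> - Re (B $$ (p, p))))"
      using z0 less(2) by (intro mult_left_mono add_right_mono) auto
    finally show "norm (z t p) \<le> (1 + H / \<rho>) * exp (- \<delta> * t) * R"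
      by (simp add: \<rho>_def[symmetric] algebra_simps)
  qed
qed

text \<open>The constant \<open>\<kappa>\<close> serves all intervals \<open>{0..T}\<close> at once, because the forcing will only be controlled up
  to a time \<open>T\<close> before the final bound is known.\<close>

definition forced_decay :: "real \<Rightarrow> nat \<Rightarrow> real mat \<Rightarrow> real \<Rightarrow> bool" where
  "forced_decay \<delta> n M \<kappa> \<longleftrightarrow> (\<forall>T x g R t. 0 \<le> R \<longrightarrow> t \<in> {0..T} \<longrightarrow>
      (\<forall>s\<in>{0..T}. \<forall>p<n. ((\<lambda>s. x s p) has_real_derivative
          (\<Sum>q<n. M $$ (p, q) * x s q) + g s p) (at s within {0..T})) \<longrightarrow>
      (\<forall>s\<in>{0..T}. \<forall>p<n. \<bar>g s p\<bar> \<le> R * exp (- \<delta> * s)) \<longrightarrow>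
      (\<forall>p<n. \<bar>x 0 p\<bar> \<le> R) \<longrightarrow>
      (\<forall>p<n. \<bar>x t p\<bar> \<le> \<kappa> * exp (- \<delta> * t) * R))"

text \<open>A Schur basis over the complex numbers makes the system upper triangular, with the eigenvalues on
  the diagonal.\<close>

theorem linear_system_decay:
  fixes M :: "real mat"
  assumes M: "M \<in> carrier_mat n n" and abscissa: "spectral_abscissa M < ereal (- \<delta>)"
  obtains \<kappa> where "0 \<le> \<kappa>" "forced_decay \<delta> n M \<kappa>"
proof -
  define A where "A = map_mat complex_of_real M"
  have A: "A \<in> carrier_mat n n" using M by (simp add: A_def)
  obtain es where es: "char_poly A = (\<Prod>e\<leftarrow>es. [:- e, 1:])"
    using char_poly_factorized[OF A] by auto
  obtain B where B: "B \<in> carrier_mat n n" "upper_triangular B" "similar_mat A B"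
    using schur_decomposition_exists[OF A es] by auto
  obtain P Q where PQ: "similar_mat_wit A B P Q"
    using B(3) by (auto simp: similar_mat_def)
  then have P: "P \<in> carrier_mat n n" and Q: "Q \<in> carrier_mat n n"
    and PQ1: "P * Q = 1\<^sub>m n" and QP1: "Q * P = 1\<^sub>m n" and APQ: "A = P * B * Q"
    using A by (auto simp: similar_mat_wit_def Let_def)
  \<comment> \<open>\<open>Q\<close> maps solutions of the given system to solutions of the triangular one.\<close>
  have QA: "Q * A = B * Q"
  proof -
    have "Q * A = Q * (P * (B * Q))"
      using APQ P Q B by simp
    also have "\<dots> = (Q * P) * (B * Q)"
      using P Q B by (intro assoc_mult_mat[symmetric]) auto
    finally show ?thesis using QP1 Q B by simp
  qed
  have eig: "Re (B $$ (p, p)) < - \<delta>" if p: "p < n" for p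
  proof -
    have "char_poly A = char_poly B" using char_poly_similar[OF B(3)] .
    then have "poly (char_poly A) (B $$ (p, p)) = 0"
      using char_poly_upper_triangular[OF B(1,2)] p B(1)
      by (auto simp: poly_prod_list prod_list_zero_iff diag_mat_def)
    then have "B $$ (p, p) \<in> spectrum A"
      using A by (simp add: spectrum_def eigenvalue_root_char_poly)
    then have "ereal (Re (B $$ (p, p))) \<le> spectral_abscissa M"
      unfolding spectral_abscissa_def A_def by (intro SUP_upper)
    with abscissa show ?thesis by (meson ereal_less(2) less_ereal.simps(1) order_le_less_trans)
  qed
  define Q0 where "Q0 \<kappa> p \<longleftrightarrow> (\<forall>T z g R t. 0 \<le> R \<longrightarrow> t \<in> {0..T} \<longrightarrow>
      (\<forall>s\<in>{0..T}. \<forall>p<n. ((\<lambda>s. z s p) has_vector_derivative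
          (\<Sum>q<n. B $$ (p, q) * z s q) + g s p) (at s within {0..T})) \<longrightarrow>
      (\<forall>s\<in>{0..T}. \<forall>p<n. norm (g s p) \<le> R * exp (- \<delta> * s)) \<longrightarrow>
      (\<forall>p<n. norm (z 0 p) \<le> R) \<longrightarrow>
      norm (z t p) \<le> \<kappa> * exp (- \<delta> * t) * R)" for \<kappa> p
  have "\<forall>p\<in>{..<n}. \<exists>\<kappa>\<ge>0. Q0 \<kappa> p"
    unfolding Q0_def using upper_triangular_decay[OF B(1,2) eig] by simp
  then obtain \<kappa> where \<kappa>0: "\<And>p. p < n \<Longrightarrow> 0 \<le> \<kappa> p" and Q0: "\<And>p. p < n \<Longrightarrow> Q0 (\<kappa> p) p"
    by (metis lessThan_iff)
  note \<kappa> = Q0[unfolded Q0_def, rule_format]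
  define q where "q = (\<Sum>p<n. \<Sum>r<n. norm (Q $$ (p, r)))"
  have q0: "0 \<le> q" unfolding q_def by (intro sum_nonneg) auto
  have qp: "(\<Sum>r<n. norm (Q $$ (p, r))) \<le> q" if "p < n" for p
    unfolding q_def using that
    by (intro member_le_sum[of p "{..<n}" "\<lambda>p. \<Sum>r<n. norm (Q $$ (p, r))"]) (auto intro: sum_nonneg)
  define \<kappa>' where "\<kappa>' = (\<Sum>p<n. \<Sum>r<n. norm (P $$ (p, r)) * \<kappa> r) * q"
  have inner_nn: "0 \<le> (\<Sum>r<n. norm (P $$ (p, r)) * \<kappa> r)" for p
    using \<kappa>0 by (intro sum_nonneg) auto
  have \<kappa>'0: "0 \<le> \<kappa>'"
    unfolding \<kappa>'_def using inner_nn q0 by (intro mult_nonneg_nonneg sum_nonneg[OF inner_nn])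
  have "forced_decay \<delta> n M \<kappa>'"
    unfolding forced_decay_def
  proof (intro allI impI)
    fix T :: real and x g :: "real \<Rightarrow> nat \<Rightarrow> real" and R t :: real and p
    assume R: "0 \<le> R" and t: "t \<in> {0..T}" and p: "p < n"
      and x: "\<forall>s\<in>{0..T}. \<forall>p<n. ((\<lambda>s. x s p) has_real_derivative
          (\<Sum>q<n. M $$ (p, q) * x s q) + g s p) (at s within {0..T})"
      and g: "\<forall>s\<in>{0..T}. \<forall>p<n. \<bar>g s p\<bar> \<le> R * exp (- \<delta> * s)"
      and x0: "\<forall>p<n. \<bar>x 0 p\<bar> \<le> R"
    define z where "z = (\<lambda>s p. \<Sum>r<n. Q $$ (p, r) * complex_of_real (x s r))"
    define g' where "g' = (\<lambda>s p. \<Sum>r<n. Q $$ (p, r) * complex_of_real (g s r))"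
    have QAe: "(\<Sum>r<n. Q $$ (p, r) * of_real (M $$ (r, k))) = (\<Sum>r<n. B $$ (p, r) * Q $$ (r, k))"
      if "p < n" "k < n" for p k
    proof -
      have "(Q * A) $$ (p, k) = (B * Q) $$ (p, k)" using QA by simp
      then show ?thesis
        using that Q A B(1) M by (simp add: scalar_prod_def A_def atLeast0LessThan)
    qed
    have dz: "((\<lambda>s. z s p) has_vector_derivative (\<Sum>r<n. B $$ (p, r) * z s r) + g' s p) (at s within {0..T})"
      if s: "s \<in> {0..T}" and p: "p < n" for s p
    proof -
      have "((\<lambda>s. z s p) has_vector_derivative
          (\<Sum>r<n. Q $$ (p, r) * of_real ((\<Sum>k<n. M $$ (r, k) * x s k) + g s r))) (at s within {0..T})"
        unfolding z_def
        by (intro has_vector_derivative_sum has_vector_derivative_mult_right has_vector_derivative_of_real)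
           (use x s in auto)
      moreover have "(\<Sum>r<n. Q $$ (p, r) * of_real ((\<Sum>k<n. M $$ (r, k) * x s k) + g s r))
          = (\<Sum>k<n. (\<Sum>r<n. Q $$ (p, r) * of_real (M $$ (r, k))) * of_real (x s k)) + g' s p"
      proof -
        have "(\<Sum>r<n. Q $$ (p, r) * of_real ((\<Sum>k<n. M $$ (r, k) * x s k) + g s r))
            = (\<Sum>r<n. \<Sum>k<n. Q $$ (p, r) * of_real (M $$ (r, k)) * of_real (x s k)) + g' s p"
          by (simp add: g'_def sum_distrib_left sum.distrib algebra_simps)
        then show ?thesis
          by (subst (asm) sum.swap) (simp add: sum_distrib_right)
      qed
      moreover have "(\<Sum>k<n. (\<Sum>r<n. Q $$ (p, r) * of_real (M $$ (r, k))) * of_real (x s k))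
          = (\<Sum>k<n. (\<Sum>r<n. B $$ (p, r) * Q $$ (r, k)) * of_real (x s k))"
        using QAe p by simp
      moreover have "\<dots> = (\<Sum>r<n. B $$ (p, r) * z s r)"
        unfolding z_def sum_distrib_right sum_distrib_left
        by (subst sum.swap) (simp add: mult.assoc)
      ultimately show ?thesis by simp
    qed
    have bnd: "norm (\<Sum>r<n. Q $$ (p, r) * complex_of_real (y r)) \<le> q * S"
      if "\<And>r. r < n \<Longrightarrow> \<bar>y r\<bar> \<le> S" "p < n" "0 \<le> S" for y S p
    proof -
      have "norm (\<Sum>r<n. Q $$ (p, r) * complex_of_real (y r)) \<le> (\<Sum>r<n. norm (Q $$ (p, r)) * S)"
        by (intro order_trans[OF norm_sum] sum_mono) (use that in \<open>auto simp: norm_mult intro!: mult_left_mono\<close>)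
      also have "\<dots> \<le> q * S"
        unfolding sum_distrib_right[symmetric] using qp[OF that(2)] that(3) by (rule mult_right_mono)
      finally show ?thesis .
    qed
    have zt: "norm (z t r) \<le> \<kappa> r * exp (- \<delta> * t) * (q * R)" if "r < n" for r
    proof (rule \<kappa>[OF that _ t])
      show "0 \<le> q * R" using q0 R by simp
      show "((\<lambda>s. z s p) has_vector_derivative
          (\<Sum>r<n. B $$ (p, r) * z s r) + g' s p) (at s within {0..T})" if "s \<in> {0..T}" "p < n" for s p
        using dz that by blast
      show "norm (g' s p) \<le> q * R * exp (- \<delta> * s)" if "s \<in> {0..T}" "p < n" for s p
        unfolding g'_def mult.assoc using g R that by (intro bnd) auto
      show "norm (z 0 p) \<le> q * R" if "p < n" for p
        unfolding z_def using x0 R that by (intro bnd) auto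
    qed
    have "complex_of_real (x t p) = (\<Sum>r<n. P $$ (p, r) * z t r)"
    proof -
      have PQe: "(\<Sum>r<n. P $$ (p, r) * Q $$ (r, k)) = (if p = k then 1 else 0)" if "k < n" for k
      proof -
        have "(P * Q) $$ (p, k) = (if p = k then 1 else 0)" using PQ1 p that by simp
        then show ?thesis using p that P Q by (simp add: scalar_prod_def atLeast0LessThan)
      qed
      have "(\<Sum>r<n. P $$ (p, r) * z t r) = (\<Sum>k<n. (\<Sum>r<n. P $$ (p, r) * Q $$ (r, k)) * of_real (x t k))"
        unfolding z_def sum_distrib_right sum_distrib_left
        by (subst sum.swap) (simp add: mult.assoc)
      also have "\<dots> = (\<Sum>k<n. if p = k then of_real (x t k) else 0)"
        using PQe by (intro sum.cong) auto
      finally show ?thesis using p by simp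
    qed
    then have "\<bar>x t p\<bar> = norm (\<Sum>r<n. P $$ (p, r) * z t r)"
      by (metis norm_of_real)
    also have "\<dots> \<le> (\<Sum>r<n. norm (P $$ (p, r)) * (\<kappa> r * exp (- \<delta> * t) * (q * R)))"
      by (intro order_trans[OF norm_sum] sum_mono) (use zt in \<open>auto simp: norm_mult intro!: mult_left_mono\<close>)
    also have "\<dots> = (\<Sum>r<n. norm (P $$ (p, r)) * \<kappa> r) * (exp (- \<delta> * t) * (q * R))"
      unfolding sum_distrib_right by (intro sum.cong refl) (simp add: mult_ac)
    also have "\<dots> \<le> (\<Sum>p<n. \<Sum>r<n. norm (P $$ (p, r)) * \<kappa> r) * (exp (- \<delta> * t) * (q * R))"
      using q0 R p inner_nn
      by (intro mult_right_mono member_le_sum[of p "{..<n}" "\<lambda>p. \<Sum>r<n. norm (P $$ (p, r)) * \<kappa> r"]) auto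
    finally show "\<bar>x t p\<bar> \<le> \<kappa>' * exp (- \<delta> * t) * R"
      by (simp add: \<kappa>'_def mult_ac)
  qed
  with \<kappa>'0 show thesis by (rule that)
qed

section \<open>The Hilbert space of square-integrable functions\<close>

interpretation unit_leb: finite_measure unit_leb
  by (rule finite_measure_lebesgue_on) auto

lemma measure_unit_leb [simp]: "measure unit_leb {0<..<1} = 1"
  by (simp add: measure_restrict_space)

lemma L2_rel_refl [simp]: "L2_rel f f \<longleftrightarrow> square_integrable f"
  by (simp add: L2_rel_def)

lemma L2_cases:
  obtains F where "square_integrable F" "f = L2_of F"
  using L2.abs_induct[of "\<lambda>f. \<exists>F. square_integrable F \<and> f = L2_of F" f] by auto

lemma L2_of_eq_iff:
  assumes "square_integrable f" "square_integrable g"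
  shows "L2_of f = L2_of g \<longleftrightarrow> (AE x in unit_leb. f x = g x)"
proof -
  have "L2_of f = L2_of g \<longleftrightarrow> L2_rel f g"
    using assms Quotient3_rel[OF Quotient3_L2, of f g] by auto
  then show ?thesis using assms by (simp add: L2_rel_def)
qed

lemma square_integrable_uminus: "square_integrable f \<Longrightarrow> square_integrable (\<lambda>x. - f x)"
  using square_integrable_scale[of f "-1"] by simp

lemma square_integrable_diff:
  "square_integrable f \<Longrightarrow> square_integrable g \<Longrightarrow> square_integrable (\<lambda>x. f x - g x)"
  using square_integrable_add[of f "\<lambda>x. - g x"] square_integrable_uminus by simp

lemma L2_of_0: "L2_of (\<lambda>x. 0) = 0"
  by (simp add: zero_L2_def)

lemma L2_of_add:
  "square_integrable f \<Longrightarrow> square_integrable g \<Longrightarrow> L2_of (\<lambda>x. f x + g x) = L2_of f + L2_of g"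
  by (simp add: plus_L2.abs_eq)

lemma L2_of_scale: "square_integrable f \<Longrightarrow> L2_of (\<lambda>x. r * f x) = r *\<^sub>R L2_of f"
  by (simp add: scaleR_L2.abs_eq)

lemma L2_of_uminus: "square_integrable f \<Longrightarrow> L2_of (\<lambda>x. - f x) = - L2_of f"
  by (simp add: uminus_L2.abs_eq)

lemma L2_of_diff:
  "square_integrable f \<Longrightarrow> square_integrable g \<Longrightarrow> L2_of (\<lambda>x. f x - g x) = L2_of f - L2_of g"
  using L2_of_add[of f "\<lambda>x. - g x"] by (simp add: L2_of_uminus square_integrable_uminus)

lemma inner_L2_of:
  "square_integrable f \<Longrightarrow> square_integrable g \<Longrightarrow>
    inner (L2_of f) (L2_of g) = (LINT x|unit_leb. f x * g x)"
  by (simp add: inner_L2.abs_eq)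

lemma norm_L2_of:
  "square_integrable f \<Longrightarrow> (norm (L2_of f))\<^sup>2 = (LINT x|unit_leb. (f x)\<^sup>2)"
  by (simp add: power2_norm_eq_inner inner_L2_of) (simp add: power2_eq_square)

lemma square_integrable_imp_integrable:
  assumes "square_integrable f"
  shows "integrable unit_leb f"
  using square_integrable_mult[OF assms, of "\<lambda>x. 1"] by (simp add: square_integrable_def)

lemma square_integrable_bounded:
  assumes "f \<in> borel_measurable unit_leb" "AE x in unit_leb. \<bar>f x\<bar> \<le> B"
  shows "square_integrable f"
  unfolding square_integrable_def
proof
  show "integrable unit_leb (\<lambda>x. (f x)\<^sup>2)"
  proof (rule unit_leb.integrable_const_bound[of _ "B\<^sup>2"])
    show "AE x in unit_leb. norm ((f x)\<^sup>2) \<le> B\<^sup>2"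
      using assms(2) by eventually_elim (metis abs_ge_zero norm_power power_mono real_norm_def)
  qed (use assms in measurable)
qed fact

lemma norm_L2_of_le:
  assumes "f \<in> borel_measurable unit_leb" "AE x in unit_leb. \<bar>f x\<bar> \<le> B" "0 \<le> B"
  shows "norm (L2_of f) \<le> B"
proof -
  have sq: "square_integrable f" using square_integrable_bounded assms by blast
  have "(norm (L2_of f))\<^sup>2 \<le> (LINT x|unit_leb. B\<^sup>2)"
    unfolding norm_L2_of[OF sq]
  proof (rule integral_mono_AE)
    show "AE x in unit_leb. (f x)\<^sup>2 \<le> B\<^sup>2"
      using assms(2) by eventually_elim (metis abs_ge_zero power2_abs power_mono)
  qed (use sq in \<open>auto simp: square_integrable_def\<close>)
  then have "(norm (L2_of f))\<^sup>2 \<le> B\<^sup>2" by simp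
  then show ?thesis
    using assms(3) by (rule power2_le_imp_le)
qed

lemma continuous_square_integrable:
  assumes "continuous_on {0..1} f"
  shows "square_integrable f"
proof -
  have "compact (f ` {0..1})" using assms by (intro compact_continuous_image) auto
  then obtain B where B: "\<And>x. x \<in> {0..1} \<Longrightarrow> \<bar>f x\<bar> \<le> B"
    using compact_imp_bounded bounded_iff by (metis imageI real_norm_def)
  show ?thesis
  proof (rule square_integrable_bounded)
    show "f \<in> borel_measurable unit_leb"
      by (rule continuous_imp_measurable_on_sets_lebesgue)
         (auto intro!: continuous_on_subset[OF assms])
    show "AE x in unit_leb. \<bar>f x\<bar> \<le> B"
      by (rule AE_I2) (use B in auto)
  qed
qed

lemma norm_L2_of_le_cont:
  assumes "continuous_on {0..1} f" "\<And>x. x \<in> {0..1} \<Longrightarrow> \<bar>f x\<bar> \<le> B"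
  shows "norm (L2_of f) \<le> B"
proof (rule norm_L2_of_le)
  show "f \<in> borel_measurable unit_leb"
    using continuous_square_integrable[OF assms(1)] by (simp add: square_integrable_def)
  show "AE x in unit_leb. \<bar>f x\<bar> \<le> B"
    by (rule AE_I2) (use assms(2) in auto)
  show "0 \<le> B" using assms(2)[of 0] by auto
qed

lemma has_integral_unit_leb:
  fixes f :: "real \<Rightarrow> real"
  assumes "integrable unit_leb f"
  shows "(f has_integral (LINT x|unit_leb. f x)) {0..1}"
  using has_integral_integral_lebesgue_on[OF assms]
  by (simp add: has_integral_Icc_iff_Ioo)

lemma LINT_unit_leb_FTC:
  assumes "\<And>x. x \<in> {0..1} \<Longrightarrow> (F has_real_derivative f x) (at x within {0..1})"
    and "continuous_on {0..1} f"
  shows "(LINT x|unit_leb. f x) = F 1 - F 0"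
proof -
  have "(f has_integral (F 1 - F 0)) {0..1}"
    using assms(1) by (intro fundamental_theorem_of_calculus)
      (auto simp: has_real_derivative_iff_has_vector_derivative[symmetric])
  then show ?thesis
    using has_integral_unit_leb[OF square_integrable_imp_integrable[OF continuous_square_integrable[OF assms(2)]]]
      has_integral_unique by blast
qed

lemma LINT_le_norm_L2_of:
  assumes "square_integrable f"
  shows "(LINT x|unit_leb. \<bar>f x\<bar>) \<le> norm (L2_of f)"
proof -
  have abs: "square_integrable (\<lambda>x. \<bar>f x\<bar>)" using assms by (auto simp: square_integrable_def)
  have one: "square_integrable (\<lambda>x. 1)" by (simp add: square_integrable_def)
  have "(LINT x|unit_leb. \<bar>f x\<bar>) = inner (L2_of (\<lambda>x. \<bar>f x\<bar>)) (L2_of (\<lambda>x. 1))"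
    using abs one by (simp add: inner_L2_of)
  also have "\<dots> \<le> norm (L2_of (\<lambda>x. \<bar>f x\<bar>)) * norm (L2_of (\<lambda>x. 1))"
    by (rule norm_cauchy_schwarz)
  also have "norm (L2_of (\<lambda>x. \<bar>f x\<bar>)) = norm (L2_of f)"
    using norm_L2_of[OF abs] norm_L2_of[OF assms]
      power2_eq_imp_eq[of "norm (L2_of (\<lambda>x. \<bar>f x\<bar>))" "norm (L2_of f)"] by simp
  also have "norm (L2_of f) * norm (L2_of (\<lambda>x. 1)) \<le> norm (L2_of f) * 1"
    by (intro mult_left_mono norm_L2_of_le) auto
  finally show ?thesis by simp
qed

text \<open>Along a subsequence with increments of norm at most \<open>2 ^ (- k)\<close> the representatives converge almost
  everywhere, because the sum of the absolute increments is integrable. Fatou's lemma turns this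
  into convergence in norm.\<close>

lemma L2_Cauchy_convergent:
  fixes X :: "nat \<Rightarrow> L2"
  assumes "Cauchy X"
  shows "convergent X"
proof -
  have "\<forall>k. \<exists>N. \<forall>m\<ge>N. \<forall>n\<ge>N. norm (X m - X n) < (1/2) ^ k"
    using assms unfolding Cauchy_iff by simp
  then obtain N0 where N0: "\<And>k m n. m \<ge> N0 k \<Longrightarrow> n \<ge> N0 k \<Longrightarrow> norm (X m - X n) < (1/2) ^ k"
    by metis
  define r where "r = rec_nat (N0 0) (\<lambda>k m. max (Suc m) (N0 (Suc k)))"
  have r: "r 0 = N0 0" "r (Suc k) = max (Suc (r k)) (N0 (Suc k))" for k
    by (simp_all add: r_def)
  have r_mono: "strict_mono r" by (simp add: strict_mono_Suc_iff r less_max_iff_disj)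
  have r_ge: "N0 k \<le> r k" for k by (cases k) (auto simp: r)
  have step: "norm (X (r m) - X (r k)) \<le> (1/2) ^ k" if "k \<le> m" for k m
    using N0[of k "r m" "r k"] r_ge[of k] strict_mono_mono[OF r_mono] that
    by (meson less_imp_le monoD order_trans)
  have "\<forall>n. \<exists>F. square_integrable F \<and> X n = L2_of F"
    by (metis L2_cases)
  then obtain F where F: "\<And>n. square_integrable (F n)" and XF: "\<And>n. X n = L2_of (F n)"
    by metis
  have meas [measurable]: "F n \<in> borel_measurable unit_leb" for n
    using F by (simp add: square_integrable_def)
  define D where "D k x = F (r (Suc k)) x - F (r k) x" for k x
  have D: "square_integrable (D k)" for k
    unfolding D_def by (intro square_integrable_diff F)
  have [measurable]: "D k \<in> borel_measurable unit_leb" for k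
    using D by (simp add: square_integrable_def)
  have D_int: "(LINT x|unit_leb. \<bar>D k x\<bar>) \<le> (1/2) ^ k" for k
  proof -
    have "L2_of (D k) = X (r (Suc k)) - X (r k)"
      unfolding D_def XF by (intro L2_of_diff F)
    then show ?thesis
      using LINT_le_norm_L2_of[OF D, of k] step[of k "Suc k"] by simp
  qed
  have "(\<integral>\<^sup>+x. (\<Sum>k. ennreal \<bar>D k x\<bar>) \<partial>unit_leb) = (\<Sum>k. \<integral>\<^sup>+x. ennreal \<bar>D k x\<bar> \<partial>unit_leb)"
    by (intro nn_integral_suminf) auto
  also have "\<dots> = (\<Sum>k. ennreal (LINT x|unit_leb. \<bar>D k x\<bar>))"
    by (intro suminf_cong nn_integral_eq_integral integrable_abs square_integrable_imp_integrable D) auto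
  also have "\<dots> \<le> (\<Sum>k. ennreal ((1/2) ^ k))"
    by (intro suminf_le ennreal_leI D_int) auto
  also have "\<dots> = ennreal (\<Sum>k. (1/2) ^ k)"
    by (intro suminf_ennreal2) auto
  finally have "(\<integral>\<^sup>+x. (\<Sum>k. ennreal \<bar>D k x\<bar>) \<partial>unit_leb) \<noteq> \<infinity>"
    by (auto simp: top_unique)
  then have "AE x in unit_leb. (\<Sum>k. ennreal \<bar>D k x\<bar>) \<noteq> \<infinity>"
    by (intro nn_integral_PInf_AE) auto
  then have conv: "AE x in unit_leb. convergent (\<lambda>k. F (r k) x)"
  proof eventually_elim
    case (elim x)
    then have "summable (\<lambda>k. \<bar>D k x\<bar>)"
      by (intro summable_suminf_not_top) auto
    then have "summable (\<lambda>k. D k x)" by (rule summable_rabs_cancel)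
    then have "convergent (\<lambda>n. F (r 0) x + (\<Sum>k<n. D k x))"
      unfolding summable_iff_convergent by (intro convergent_add convergent_const)
    moreover have "F (r 0) x + (\<Sum>k<n. D k x) = F (r n) x" for n
      unfolding D_def by (subst sum_lessThan_telescope) simp
    ultimately show ?case by simp
  qed
  define G where "G x = lim (\<lambda>k. F (r k) x)" for x
  have [measurable]: "G \<in> borel_measurable unit_leb"
    unfolding G_def by measurable
  have diff: "square_integrable (\<lambda>x. G x - F (r k) x)"
    "norm (L2_of (\<lambda>x. G x - F (r k) x)) \<le> (1/2) ^ k" for k
  proof -
    have lim: "AE x in unit_leb. (\<lambda>m. (F (r m) x - F (r k) x)\<^sup>2) \<longlonglongrightarrow> (G x - F (r k) x)\<^sup>2"
      using conv
    proof eventually_elim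
      case (elim x)
      then have "(\<lambda>m. F (r m) x) \<longlonglongrightarrow> G x" by (simp add: G_def convergent_LIMSEQ_iff)
      then show ?case by (intro tendsto_intros)
    qed
    have bnd: "(\<integral>\<^sup>+x. ennreal ((F (r m) x - F (r k) x)\<^sup>2) \<partial>unit_leb) \<le> ennreal (((1/2) ^ k)\<^sup>2)" if "k \<le> m" for m
    proof -
      have sq: "square_integrable (\<lambda>x. F (r m) x - F (r k) x)" by (intro square_integrable_diff F)
      have "(\<integral>\<^sup>+x. ennreal ((F (r m) x - F (r k) x)\<^sup>2) \<partial>unit_leb)
          = ennreal (LINT x|unit_leb. (F (r m) x - F (r k) x)\<^sup>2)"
        using sq by (intro nn_integral_eq_integral) (auto simp: square_integrable_def)
      also have "(LINT x|unit_leb. (F (r m) x - F (r k) x)\<^sup>2) = (norm (X (r m) - X (r k)))\<^sup>2"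
        using norm_L2_of[OF sq] F by (simp add: XF L2_of_diff)
      also have "\<dots> \<le> ((1/2) ^ k)\<^sup>2"
        using step[OF that] by (intro power_mono) auto
      finally show ?thesis by (simp add: ennreal_leI)
    qed
    have "(\<integral>\<^sup>+x. ennreal ((G x - F (r k) x)\<^sup>2) \<partial>unit_leb)
        = (\<integral>\<^sup>+x. liminf (\<lambda>m. ennreal ((F (r m) x - F (r k) x)\<^sup>2)) \<partial>unit_leb)"
    proof (rule nn_integral_cong_AE)
      show "AE x in unit_leb. ennreal ((G x - F (r k) x)\<^sup>2) = liminf (\<lambda>m. ennreal ((F (r m) x - F (r k) x)\<^sup>2))"
        using lim by eventually_elim
          (metis lim_imp_Liminf sequentially_bot tendsto_ennrealI)
    qed
    also have "\<dots> \<le> liminf (\<lambda>m. \<integral>\<^sup>+x. ennreal ((F (r m) x - F (r k) x)\<^sup>2) \<partial>unit_leb)"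
      by (intro nn_integral_liminf) auto
    also have "\<dots> \<le> limsup (\<lambda>m. \<integral>\<^sup>+x. ennreal ((F (r m) x - F (r k) x)\<^sup>2) \<partial>unit_leb)"
      by (intro Liminf_le_Limsup) auto
    also have "\<dots> \<le> ennreal (((1/2) ^ k)\<^sup>2)"
      by (intro Limsup_bounded eventually_sequentiallyI[of k] bnd)
    finally have le: "(\<integral>\<^sup>+x. ennreal ((G x - F (r k) x)\<^sup>2) \<partial>unit_leb) \<le> ennreal (((1/2) ^ k)\<^sup>2)" .
    then have "(\<integral>\<^sup>+x. ennreal ((G x - F (r k) x)\<^sup>2) \<partial>unit_leb) < \<infinity>"
      using le_less_trans by fastforce
    then have int: "integrable unit_leb (\<lambda>x. (G x - F (r k) x)\<^sup>2)"
      by (intro integrableI_bounded) (auto simp: abs_power2)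
    then show sq: "square_integrable (\<lambda>x. G x - F (r k) x)"
      by (simp add: square_integrable_def)
    have "ennreal ((norm (L2_of (\<lambda>x. G x - F (r k) x)))\<^sup>2) \<le> ennreal (((1/2) ^ k)\<^sup>2)"
      using le nn_integral_eq_integral[OF int] by (simp add: norm_L2_of[OF sq])
    then show "norm (L2_of (\<lambda>x. G x - F (r k) x)) \<le> (1/2) ^ k"
      by (subst (asm) ennreal_le_iff) (auto intro: power2_le_imp_le)
  qed
  have G: "square_integrable G"
    using square_integrable_add[OF diff(1)[of 0] F[of "r 0"]] by simp
  have "norm (X (r k) - L2_of G) \<le> (1/2) ^ k" for k
    using diff(2)[of k] L2_of_diff[OF G F, of "r k"] by (simp add: XF norm_minus_commute)
  moreover have "(\<lambda>k. (1/2::real) ^ k) \<longlonglongrightarrow> 0"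
    by (intro LIMSEQ_power_zero) auto
  ultimately have "(\<lambda>k. X (r k) - L2_of G) \<longlonglongrightarrow> 0"
    using Lim_null_comparison[of "\<lambda>k. X (r k) - L2_of G" "\<lambda>k. (1/2) ^ k" sequentially] by auto
  then have "(X \<circ> r) \<longlonglongrightarrow> L2_of G"
    by (simp add: LIM_zero_iff o_def)
  then show ?thesis
    using Cauchy_converges_subseq[OF assms r_mono] by (auto simp: convergent_def o_def)
qed

text \<open>This gives both the completeness of the cosines and integration by parts for a derivative that is
  merely square integrable.\<close>

lemma L2_continuous_dense:
  assumes "0 < e"
  shows "\<exists>g. continuous_on UNIV g \<and> norm (f - L2_of g) < e"
proof -
  obtain F where F: "square_integrable F" and f: "f = L2_of F" by (rule L2_cases)
  have [measurable]: "F \<in> borel_measurable unit_leb" using F by (simp add: square_integrable_def)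
  define clip :: "nat \<Rightarrow> real \<Rightarrow> real" where "clip m y = max (- real m) (min (real m) y)" for m y
  have clip_le: "\<bar>clip m y\<bar> \<le> real m" for m y by (auto simp: clip_def)
  have clip_sq: "square_integrable (\<lambda>x. clip m (h x))" if [measurable]: "h \<in> borel_measurable unit_leb" for m h
  proof (rule square_integrable_bounded)
    show "(\<lambda>x. clip m (h x)) \<in> borel_measurable unit_leb" unfolding clip_def by measurable
  qed (use clip_le in auto)
  \<comment> \<open>Truncation makes \<open>F\<close> bounded, so that almost everywhere convergence of the continuous
    approximants becomes convergence in the mean.\<close>
  have "(\<lambda>m. LINT x|unit_leb. (F x - clip m (F x))\<^sup>2) \<longlonglongrightarrow> (LINT x|unit_leb. 0)"
  proof (rule integral_dominated_convergence[where w = "\<lambda>x. (F x)\<^sup>2"])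
    show "AE x in unit_leb. (\<lambda>m. (F x - clip m (F x))\<^sup>2) \<longlonglongrightarrow> 0"
    proof (rule AE_I2)
      fix x
      obtain M :: nat where "\<bar>F x\<bar> \<le> real M" using real_arch_simple by blast
      then have "eventually (\<lambda>m. (F x - clip m (F x))\<^sup>2 = 0) sequentially"
        by (intro eventually_sequentiallyI[of M]) (auto simp: clip_def)
      then show "(\<lambda>m. (F x - clip m (F x))\<^sup>2) \<longlonglongrightarrow> 0" by (rule tendsto_eventually)
    qed
    show "AE x in unit_leb. norm ((F x - clip m (F x))\<^sup>2) \<le> (F x)\<^sup>2" for m
    proof (rule AE_I2)
      fix x
      have "\<bar>F x - clip m (F x)\<bar> \<le> \<bar>F x\<bar>" by (auto simp: clip_def)
      then show "norm ((F x - clip m (F x))\<^sup>2) \<le> (F x)\<^sup>2" by (simp add: abs_le_square_iff)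
    qed
    show "(\<lambda>x. (F x - clip m (F x))\<^sup>2) \<in> borel_measurable unit_leb" for m
      unfolding clip_def by measurable
  qed (use F in \<open>auto simp: square_integrable_def\<close>)
  then obtain m where m: "(LINT x|unit_leb. (F x - clip m (F x))\<^sup>2) < (e / 2)\<^sup>2"
    using order_tendstoD(2)[of _ "0::real" sequentially "(e/2)\<^sup>2"] assms
    by (auto simp: eventually_sequentially)
  have Fm: "square_integrable (\<lambda>x. clip m (F x))" by (rule clip_sq) measurable
  have 1: "norm (f - L2_of (\<lambda>x. clip m (F x))) < e / 2"
  proof -
    have "(norm (f - L2_of (\<lambda>x. clip m (F x))))\<^sup>2 < (e / 2)\<^sup>2"
      using m norm_L2_of[OF square_integrable_diff[OF F Fm]] L2_of_diff[OF F Fm] f by simp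
    then show ?thesis using assms by (auto dest: power2_less_imp_less)
  qed
  have "F measurable_on {0<..<1}"
    by (subst measurable_on_iff_borel_measurable) auto
  then obtain N g where N: "negligible N" and g: "\<And>n. continuous_on UNIV (g n)"
    and lim: "\<And>x. x \<notin> N \<Longrightarrow> (\<lambda>n. g n x) \<longlonglongrightarrow> (if x \<in> {0<..<1} then F x else 0)"
    unfolding measurable_on_def by blast
  have gm: "continuous_on UNIV (\<lambda>x. clip m (g n x))" for n
    unfolding clip_def by (intro continuous_intros g)
  have gsq: "square_integrable (\<lambda>x. clip m (g n x))" for n
    using gm continuous_on_subset by (intro continuous_square_integrable) blast
  have "(\<lambda>n. LINT x|unit_leb. (clip m (F x) - clip m (g n x))\<^sup>2) \<longlonglongrightarrow> (LINT x|unit_leb. 0)"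
  proof (rule integral_dominated_convergence[where w = "\<lambda>x. (2 * real m)\<^sup>2"])
    have "AE x in lebesgue. x \<notin> N"
      using N by (simp add: AE_not_in negligible_iff_null_sets)
    then have "AE x in unit_leb. x \<notin> N"
      by (auto simp: AE_restrict_space_iff elim: eventually_mono)
    moreover have "AE x in unit_leb. x \<in> {0<..<1}" by (rule AE_I2) auto
    ultimately show "AE x in unit_leb. (\<lambda>n. (clip m (F x) - clip m (g n x))\<^sup>2) \<longlonglongrightarrow> 0"
    proof eventually_elim
      case (elim x)
      then have "(\<lambda>n. g n x) \<longlonglongrightarrow> F x" using lim[of x] by simp
      then have "(\<lambda>n. (clip m (F x) - clip m (g n x))\<^sup>2) \<longlonglongrightarrow> (clip m (F x) - clip m (F x))\<^sup>2"
        unfolding clip_def by (intro tendsto_intros)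
      then show ?case by simp
    qed
    show "AE x in unit_leb. norm ((clip m (F x) - clip m (g n x))\<^sup>2) \<le> (2 * real m)\<^sup>2" for n
    proof (rule AE_I2)
      fix x
      have "\<bar>clip m (F x) - clip m (g n x)\<bar> \<le> 2 * real m"
        using clip_le[of m "F x"] clip_le[of m "g n x"] by linarith
      then show "norm ((clip m (F x) - clip m (g n x))\<^sup>2) \<le> (2 * real m)\<^sup>2"
        by (metis abs_ge_zero norm_power power_mono real_norm_def)
    qed
    show "(\<lambda>x. (clip m (F x) - clip m (g n x))\<^sup>2) \<in> borel_measurable unit_leb" for n
      using square_integrable_diff[OF Fm gsq[of n]] by (auto simp: square_integrable_def)
  qed auto
  then obtain n where n: "(LINT x|unit_leb. (clip m (F x) - clip m (g n x))\<^sup>2) < (e / 2)\<^sup>2"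
    using order_tendstoD(2)[of _ "0::real" sequentially "(e/2)\<^sup>2"] assms
    by (auto simp: eventually_sequentially)
  have 2: "norm (L2_of (\<lambda>x. clip m (F x)) - L2_of (\<lambda>x. clip m (g n x))) < e / 2"
  proof -
    have "(norm (L2_of (\<lambda>x. clip m (F x)) - L2_of (\<lambda>x. clip m (g n x))))\<^sup>2 < (e / 2)\<^sup>2"
      using n norm_L2_of[OF square_integrable_diff[OF Fm gsq]] L2_of_diff[OF Fm gsq] by simp
    then show ?thesis using assms by (auto dest: power2_less_imp_less)
  qed
  from 1 2 have "norm (f - L2_of (\<lambda>x. clip m (g n x))) < e"
    by (metis norm_diff_triangle_less field_sum_of_halves)
  with gm show ?thesis by blast
qed

section \<open>Cosine and sine series\<close>

text \<open>Bounding every initial segment says that the \<open>l2\<close> norm is at most \<open>R\<close>, without a separate summability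
  condition, and makes the triangle inequality of \<open>L2_set\<close> directly applicable.\<close>

definition l2b :: "(nat \<Rightarrow> real) \<Rightarrow> real \<Rightarrow> bool" where
  "l2b x R \<longleftrightarrow> (\<forall>n. L2_set x {..<n} \<le> R)"

lemma l2b_nonneg: "l2b x R \<Longrightarrow> 0 \<le> R"
  unfolding l2b_def using L2_set_nonneg order_trans by blast

lemma l2b_mono:
  assumes "l2b y R" "\<And>k. \<bar>x k\<bar> \<le> \<bar>y k\<bar>" "R \<le> S"
  shows "l2b x S"
  unfolding l2b_def
proof
  fix n
  have "L2_set x {..<n} \<le> L2_set y {..<n}"
    unfolding L2_set_def
    by (intro real_sqrt_le_mono sum_mono) (use assms(2) in \<open>auto simp: abs_le_square_iff\<close>)
  also have "\<dots> \<le> S" using assms(1,3) by (auto simp: l2b_def intro: order_trans)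
  finally show "L2_set x {..<n} \<le> S" .
qed

lemma l2b_add:
  assumes "l2b x R" "l2b y S"
  shows "l2b (\<lambda>k. x k + y k) (R + S)"
  using assms L2_set_triangle_ineq unfolding l2b_def by (metis add_mono order_trans)

lemma l2b_scale: "l2b x R \<Longrightarrow> l2b (\<lambda>k. r * x k) (\<bar>r\<bar> * R)"
  unfolding l2b_def
proof
  fix n assume "\<forall>n. L2_set x {..<n} \<le> R"
  then have "\<bar>r\<bar> * L2_set x {..<n} \<le> \<bar>r\<bar> * R" by (intro mult_left_mono) auto
  moreover have "\<bar>r\<bar> * L2_set x {..<n} = L2_set (\<lambda>k. r * x k) {..<n}"
    unfolding L2_set_def by (simp add: power_mult_distrib sum_distrib_left[symmetric] real_sqrt_mult)
  ultimately show "L2_set (\<lambda>k. r * x k) {..<n} \<le> \<bar>r\<bar> * R" by simp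
qed

lemma l2b_zero: "l2b (\<lambda>k. 0) 0"
  by (simp add: l2b_def L2_set_def)

lemma l2b_sum:
  assumes "finite A" "\<And>j. j \<in> A \<Longrightarrow> l2b (x j) (R j)"
  shows "l2b (\<lambda>k. \<Sum>j\<in>A. x j k) (\<Sum>j\<in>A. R j)"
  using assms by (induction rule: finite_induct) (auto simp: l2b_zero l2b_add)

lemma l2b_member: "l2b x R \<Longrightarrow> \<bar>x k\<bar> \<le> R"
proof -
  assume "l2b x R"
  then have "l2b (\<lambda>k. \<bar>x k\<bar>) R" by (rule l2b_mono) auto
  then have "L2_set (\<lambda>k. \<bar>x k\<bar>) {..<Suc k} \<le> R" by (simp add: l2b_def)
  moreover have "\<bar>x k\<bar> \<le> L2_set (\<lambda>k. \<bar>x k\<bar>) {..<Suc k}"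
    by (rule member_le_L2_set) auto
  ultimately show ?thesis by simp
qed

lemma l2b_finite_support:
  assumes "\<And>k. k \<ge> n \<Longrightarrow> x k = 0"
  shows "l2b x (\<Sum>k<n. \<bar>x k\<bar>)"
  unfolding l2b_def
proof
  fix m
  have "L2_set x {..<m} \<le> (\<Sum>k<m. \<bar>x k\<bar>)" by (rule L2_set_le_sum_abs)
  also have "(\<Sum>k<m. \<bar>x k\<bar>) = (\<Sum>k\<in>{..<m} \<inter> {..<n}. \<bar>x k\<bar>)"
    by (rule sum.mono_neutral_right) (auto, metis assms not_less)
  also have "\<dots> \<le> (\<Sum>k<n. \<bar>x k\<bar>)"
    by (rule sum_mono2) auto
  finally show "L2_set x {..<m} \<le> (\<Sum>k<n. \<bar>x k\<bar>)" .
qed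

lemma l2b_harmonic: "l2b (\<lambda>k. 1 / (real k + 1)) 2"
  unfolding l2b_def
proof
  fix n
  have "(\<Sum>k<n. (1 / (real k + 1))\<^sup>2) \<le> 2 - 2 / (real n + 1)"
  proof (induction n)
    case (Suc n)
    have "(1 / (real n + 1))\<^sup>2 \<le> 2 * (1 / (real n + 1) - 1 / (real n + 2))"
      by (simp add: divide_simps power2_eq_square)
    with Suc show ?case by (simp add: add.commute)
  qed simp
  also have "\<dots> \<le> 4" by (simp add: field_simps)
  finally show "L2_set (\<lambda>k. 1 / (real k + 1)) {..<n} \<le> 2"
    unfolding L2_set_def by (intro real_le_lsqrt) auto
qed

lemma bessel:
  fixes e :: "nat \<Rightarrow> 'a::real_inner"
  assumes orth: "\<And>k l. k \<noteq> l \<Longrightarrow> inner (e k) (e l) = 0" and norm: "\<And>k. norm (e k) \<le> 1"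
  shows "l2b (\<lambda>k. inner f (e k)) (norm f)"
  unfolding l2b_def
proof
  fix n
  define p where "p = (\<Sum>k<n. inner f (e k) *\<^sub>R e k)"
  have fp: "inner f p = (\<Sum>k<n. (inner f (e k))\<^sup>2)"
    by (simp add: p_def inner_sum_right power2_eq_square)
  have "inner p p = (\<Sum>k<n. inner f (e k) * inner (e k) p)"
    by (subst (1) p_def) (simp add: inner_sum_left)
  also have "\<dots> = (\<Sum>k<n. (inner f (e k))\<^sup>2 * (norm (e k))\<^sup>2)"
  proof (intro sum.cong refl)
    fix k assume "k \<in> {..<n}"
    have "inner (e k) p = (\<Sum>l<n. inner f (e l) * inner (e k) (e l))"
      by (simp add: p_def inner_sum_right)
    also have "\<dots> = (\<Sum>l<n. if l = k then inner f (e k) * (norm (e k))\<^sup>2 else 0)"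
      by (intro sum.cong) (auto simp: orth power2_norm_eq_inner)
    finally show "inner f (e k) * inner (e k) p = (inner f (e k))\<^sup>2 * (norm (e k))\<^sup>2"
      using \<open>k \<in> {..<n}\<close> by (simp add: power2_eq_square)
  qed
  also have "\<dots> \<le> (\<Sum>k<n. (inner f (e k))\<^sup>2 * 1)"
    by (intro sum_mono mult_left_mono power_le_one norm) auto
  finally have pp: "inner p p \<le> inner f p" by (simp add: fp)
  have "0 \<le> inner (f - p) (f - p)" by simp
  also have "\<dots> = (norm f)\<^sup>2 - 2 * inner f p + inner p p"
    by (simp add: inner_diff inner_commute power2_norm_eq_inner)
  finally have "inner f p \<le> (norm f)\<^sup>2" using pp by simp
  then show "L2_set (\<lambda>k. inner f (e k)) {..<n} \<le> norm f"
    unfolding L2_set_def fp by (intro real_le_lsqrt) auto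
qed

text \<open>The Cauchy--Schwarz inequality for coefficients, for a finite combination \<open>s\<close> of the \<open>e k\<close>.\<close>

lemma orthonormal_inner_sum_le:
  fixes e :: "nat \<Rightarrow> 'a::real_inner"
  assumes e: "\<And>k l. inner (e k) (e l) = (if k = l then 1 else 0)"
    and f: "l2b (\<lambda>k. inner f (e k)) R" and s: "s \<in> span (range e)"
  shows "inner f s \<le> R * norm s"
proof -
  obtain t r where t: "finite t" "t \<subseteq> range e" "s = (\<Sum>a\<in>t. r a *\<^sub>R a)"
    using s by (auto simp: span_explicit)
  obtain K where K: "finite K" "t = e ` K"
    using finite_subset_image[OF t(1,2)] by auto
  have inj: "inj e"
    by (rule injI) (metis e zero_neq_one)
  define n where "n = Suc (Max (insert 0 K))"
  have n: "K \<subseteq> {..<n}" using K(1) by (auto simp: n_def less_Suc_eq_le)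
  define b where "b k = (if k \<in> K then r (e k) else 0)" for k
  have s_eq: "s = (\<Sum>k<n. b k *\<^sub>R e k)"
  proof -
    have "s = (\<Sum>k\<in>K. b k *\<^sub>R e k)"
      unfolding t(3) K(2) using inj by (subst sum.reindex) (auto simp: b_def inj_on_def)
    also have "\<dots> = (\<Sum>k<n. b k *\<^sub>R e k)"
      by (rule sum.mono_neutral_left) (use n in \<open>auto simp: b_def\<close>)
    finally show ?thesis .
  qed
  have "(norm s)\<^sup>2 = (\<Sum>k<n. (b k)\<^sup>2)"
    unfolding power2_norm_eq_inner s_eq
    by (simp add: inner_sum_left inner_sum_right e power2_eq_square if_distrib cong: if_cong)
  then have ns: "norm s = L2_set b {..<n}"
    by (simp add: L2_set_def real_sqrt_unique)
  have "inner f s = (\<Sum>k<n. inner f (e k) * b k)"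
    by (simp add: s_eq inner_sum_right mult.commute)
  also have "\<dots> \<le> (\<Sum>k<n. \<bar>inner f (e k)\<bar> * \<bar>b k\<bar>)"
    by (intro sum_mono) (simp add: abs_mult[symmetric])
  also have "\<dots> \<le> L2_set (\<lambda>k. inner f (e k)) {..<n} * L2_set b {..<n}"
    by (rule L2_set_mult_ineq)
  also have "\<dots> \<le> R * norm s"
    unfolding ns using f by (intro mult_right_mono) (auto simp: l2b_def)
  finally show ?thesis .
qed

definition cosf :: "nat \<Rightarrow> real \<Rightarrow> real" where "cosf k x = mu k * cos (real k * pi * x)"
definition sinf :: "nat \<Rightarrow> real \<Rightarrow> real" where "sinf k x = sqrt 2 * sin (real k * pi * x)"

lemma cosf_cont [continuous_intros]: "continuous_on S (cosf k)"
  unfolding cosf_def by (intro continuous_intros)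

lemma sinf_cont [continuous_intros]: "continuous_on S (sinf k)"
  unfolding sinf_def by (intro continuous_intros)

lemma cosf_sq [simp]: "square_integrable (cosf k)" and sinf_sq [simp]: "square_integrable (sinf k)"
  by (auto intro!: continuous_square_integrable continuous_intros)

lemma LINT_cos_int: "(LINT x|unit_leb. cos (of_int m * pi * x)) = (if m = 0 then 1 else 0)"
proof (cases "m = 0")
  case False
  have "(LINT x|unit_leb. cos (of_int m * pi * x))
      = sin (of_int m * pi * 1) / (of_int m * pi) - sin (of_int m * pi * 0) / (of_int m * pi)"
    using False
    by (intro LINT_unit_leb_FTC continuous_intros) (auto intro!: derivative_eq_intros)
  then show ?thesis using False by (simp add: mult.commute sin_zero_iff_int2)
qed simp

lemma integrable_cos_int: "integrable unit_leb (\<lambda>x. cos (of_int m * pi * x))"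
  by (intro square_integrable_imp_integrable continuous_square_integrable continuous_intros)

lemma cosf_orthonormal: "inner (L2_of (cosf k)) (L2_of (cosf l)) = (if k = l then 1 else 0)"
proof -
  have "cosf k x * cosf l x = mu k * mu l / 2 *
      (cos (of_int (int k - int l) * pi * x) + cos (of_int (int k + int l) * pi * x))" for x
    by (simp add: cosf_def cos_times_cos algebra_simps)
  then have "inner (L2_of (cosf k)) (L2_of (cosf l)) = mu k * mu l / 2 *
      ((if int k - int l = 0 then 1 else 0) + (if int k + int l = 0 then 1 else 0))"
    by (simp only: inner_L2_of cosf_sq integral_mult_right_zero
        Bochner_Integration.integral_add[OF integrable_cos_int integrable_cos_int] LINT_cos_int)
  then show ?thesis by (cases "k = 0") (auto simp: mu_def)
qed

lemma sinf_orthogonal: "inner (L2_of (sinf k)) (L2_of (sinf l)) = (if k = l \<and> k \<noteq> 0 then 1 else 0)"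
proof -
  have "sinf k x * sinf l x =
      (cos (of_int (int k - int l) * pi * x) - cos (of_int (int k + int l) * pi * x))" for x
  proof -
    have "sinf k x * sinf l x = sqrt 2 * sqrt 2 * (sin (real k * pi * x) * sin (real l * pi * x))"
      by (simp only: sinf_def mult_ac)
    then show ?thesis by (simp add: sin_times_sin algebra_simps)
  qed
  then have "inner (L2_of (sinf k)) (L2_of (sinf l)) =
      ((if int k - int l = 0 then 1 else 0) - (if int k + int l = 0 then 1 else 0))"
    by (simp only: inner_L2_of sinf_sq
        Bochner_Integration.integral_diff[OF integrable_cos_int integrable_cos_int] LINT_cos_int)
  then show ?thesis by auto
qed

lemma bessel_cosf: "l2b (\<lambda>k. inner f (L2_of (cosf k))) (norm f)"
  by (rule bessel) (auto simp: cosf_orthonormal norm_eq_sqrt_inner)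

lemma bessel_sinf: "l2b (\<lambda>k. inner f (L2_of (sinf k))) (norm f)"
  by (rule bessel) (auto simp: sinf_orthogonal norm_eq_sqrt_inner)

lemma cos_polynomial_in_span:
  assumes "real_polynomial_function p"
  shows "L2_of (\<lambda>x. p (cos (pi * x))) \<in> span (range (\<lambda>k. L2_of (cosf k)))" (is "_ \<in> span ?E")
proof -
  have cos_in: "L2_of (\<lambda>x. cos (real k * pi * x)) \<in> span ?E" for k
  proof -
    have "L2_of (\<lambda>x. cos (real k * pi * x)) = (1 / mu k) *\<^sub>R L2_of (cosf k)"
      by (subst L2_of_scale[symmetric]) (auto simp: cosf_def mu_def)
    then show ?thesis by (auto intro: span_mul span_base)
  qed
  have sq: "square_integrable (\<lambda>x. cos (pi * x) ^ i * cos (real k * pi * x))" for i k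
    by (intro continuous_square_integrable continuous_intros)
  have pow_in: "L2_of (\<lambda>x. cos (pi * x) ^ i * cos (real k * pi * x)) \<in> span ?E" for i k
  proof (induction i arbitrary: k)
    case 0
    show ?case using cos_in by simp
  next
    case (Suc i)
    show ?case
    proof (cases k)
      case 0
      show ?thesis using Suc[of 1] by (simp add: 0 mult.commute)
    next
      case (Suc l)
      have "cos (pi * x) ^ Suc i * cos (real k * pi * x)
          = (1/2) * (cos (pi * x) ^ i * cos (real l * pi * x) + cos (pi * x) ^ i * cos (real (l + 2) * pi * x))" for x
      proof -
        have "cos (pi * x) * cos (real k * pi * x) = (cos (real l * pi * x) + cos (real (l + 2) * pi * x)) / 2"
          unfolding Suc by (subst mult.commute, subst cos_times_cos) (simp add: algebra_simps)
        then have "cos (pi * x) ^ i * (cos (pi * x) * cos (real k * pi * x))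
            = cos (pi * x) ^ i * ((cos (real l * pi * x) + cos (real (l + 2) * pi * x)) / 2)"
          by (rule arg_cong)
        then show ?thesis by (simp add: distrib_left mult_ac)
      qed
      then have "L2_of (\<lambda>x. cos (pi * x) ^ Suc i * cos (real k * pi * x))
          = (1/2) *\<^sub>R (L2_of (\<lambda>x. cos (pi * x) ^ i * cos (real l * pi * x))
              + L2_of (\<lambda>x. cos (pi * x) ^ i * cos (real (l + 2) * pi * x)))"
        by (simp only: L2_of_scale L2_of_add sq square_integrable_add)
      then show ?thesis using Suc.IH by (simp only: span_mul span_add)
    qed
  qed
  obtain b n where p: "p = (\<lambda>x. \<Sum>i\<le>n. b i * x ^ i)"
    using assms real_polynomial_function_iff_sum by blast
  have "L2_of (\<lambda>x. \<Sum>i\<in>I. b i * cos (pi * x) ^ i) \<in> span ?E" if "finite I" for I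
    using that
  proof (induction rule: finite_induct)
    case empty
    show ?case by (simp add: L2_of_0 span_zero)
  next
    case (insert i I)
    have "L2_of (\<lambda>x. \<Sum>i\<in>insert i I. b i * cos (pi * x) ^ i)
        = b i *\<^sub>R L2_of (\<lambda>x. cos (pi * x) ^ i) + L2_of (\<lambda>x. \<Sum>i\<in>I. b i * cos (pi * x) ^ i)"
      using insert(1,2)
      by (subst L2_of_scale[symmetric], goal_cases)
         (auto intro!: L2_of_add continuous_square_integrable continuous_intros)
    then show ?case using insert.IH pow_in[of i 0] by (simp add: span_add span_mul)
  qed
  then show ?thesis by (simp add: p)
qed

text \<open>Polynomials in \<open>cos (pi x)\<close> separate the points of \<open>{0..1}\<close>, so that the Stone--Weierstrass theorem
  applies to them.\<close>

lemma cosf_span_dense: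
  assumes "0 < e"
  shows "\<exists>s \<in> span (range (\<lambda>k. L2_of (cosf k))). norm (f - s) < e"
proof -
  obtain g where g: "continuous_on UNIV g" and fg: "norm (f - L2_of g) < e / 2"
    using L2_continuous_dense[of "e / 2" f] assms by auto
  define P where "P h \<longleftrightarrow> (\<exists>p. real_polynomial_function p \<and> h = (\<lambda>x. p (cos (pi * x))))" for h :: "real \<Rightarrow> real"
  have cont: "continuous_on S h" if Ph: "P h" for h S
  proof -
    obtain p where p: "real_polynomial_function p" "h = (\<lambda>x. p (cos (pi * x)))"
      using Ph by (auto simp: P_def)
    obtain b n where "p = (\<lambda>x. \<Sum>i\<le>n. b i * x ^ i)"
      using p(1) real_polynomial_function_iff_sum by blast
    then show ?thesis unfolding p(2) by (auto intro!: continuous_intros)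
  qed
  have "\<exists>h. P h \<and> (\<forall>x\<in>{0..1}. \<bar>g x - h x\<bar> < e / 2)"
  proof (rule Stone_Weierstrass_HOL)
    show "P (\<lambda>x. c)" for c
      unfolding P_def by (intro exI[of _ "\<lambda>x. c"]) (auto intro: real_polynomial_function.intros)
    show "P (\<lambda>x. h x + k x)" if Phk: "P h \<and> P k" for h k
    proof -
      obtain p q where "real_polynomial_function p" "h = (\<lambda>x. p (cos (pi * x)))"
        "real_polynomial_function q" "k = (\<lambda>x. q (cos (pi * x)))"
        using Phk by (auto simp: P_def)
      then show ?thesis
        unfolding P_def by (intro exI[of _ "\<lambda>x. p x + q x"]) (auto intro: real_polynomial_function.intros)
    qed
    show "P (\<lambda>x. h x * k x)" if Phk: "P h \<and> P k" for h k
    proof -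
      obtain p q where "real_polynomial_function p" "h = (\<lambda>x. p (cos (pi * x)))"
        "real_polynomial_function q" "k = (\<lambda>x. q (cos (pi * x)))"
        using Phk by (auto simp: P_def)
      then show ?thesis
        unfolding P_def by (intro exI[of _ "\<lambda>x. p x * q x"]) (auto intro: real_polynomial_function.intros)
    qed
    show "\<exists>h. P h \<and> h x \<noteq> h y" if "x \<in> {0..1} \<and> y \<in> {0..1} \<and> x \<noteq> y" for x y :: real
    proof (intro exI conjI)
      show "P (\<lambda>x. cos (pi * x))"
        unfolding P_def by (intro exI[of _ "\<lambda>x. x"]) (auto intro: real_polynomial_function.intros)
      show "cos (pi * x) \<noteq> cos (pi * y)"
        using that cos_inj_pi[of "pi * x" "pi * y"] by (auto simp: mult_left_le)
    qed
  qed (use assms cont continuous_on_subset[OF g subset_UNIV] in auto)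
  then obtain h where h: "P h" "\<And>x. x \<in> {0..1} \<Longrightarrow> \<bar>g x - h x\<bar> < e / 2" by blast
  have g': "continuous_on {0..1} g" using g continuous_on_subset by blast
  have "norm (L2_of (\<lambda>x. g x - h x)) \<le> e / 2"
    using h(2) g' cont[OF h(1)] by (intro norm_L2_of_le_cont continuous_intros) (auto intro: less_imp_le)
  then have "norm (L2_of g - L2_of h) \<le> e / 2"
    using g' cont[OF h(1)] by (simp add: L2_of_diff continuous_square_integrable)
  then have "norm (f - L2_of h) < e"
    using fg norm_triangle_ineq[of "f - L2_of g" "L2_of g - L2_of h"] by simp
  moreover have "L2_of h \<in> span (range (\<lambda>k. L2_of (cosf k)))"
    using h(1) cos_polynomial_in_span by (auto simp: P_def)
  ultimately show ?thesis by blast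
qed

text \<open>Completeness in quantitative form. A combination \<open>s\<close> of cosines close to \<open>f\<close> gives
  \<open>norm f ^ 2 \<le> R * norm s + norm f * norm (f - s)\<close>, and both terms on the right are known when \<open>f - s\<close>
  is small.\<close>

lemma cosf_parseval_le:
  assumes "l2b (\<lambda>k. inner f (L2_of (cosf k))) R"
  shows "norm f \<le> R"
proof (rule ccontr)
  assume "\<not> norm f \<le> R"
  then have Rf: "R < norm f" by simp
  have R: "0 \<le> R" by (rule l2b_nonneg[OF assms])
  \<comment> \<open>Chosen so that \<open>(R + norm f) * e\<close> is half of \<open>(norm f - R) * norm f\<close>.\<close>
  define e where "e = (norm f - R) * norm f / (2 * (R + norm f))"
  have e: "0 < e" unfolding e_def using Rf R by (intro divide_pos_pos mult_pos_pos) auto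
  obtain s where s: "s \<in> span (range (\<lambda>k. L2_of (cosf k)))" "norm (f - s) < e"
    using cosf_span_dense[OF e] by blast
  have "(norm f)\<^sup>2 = inner f s + inner f (f - s)"
    by (simp add: power2_norm_eq_inner inner_diff_right)
  also have "\<dots> \<le> R * norm s + norm f * norm (f - s)"
    by (intro add_mono norm_cauchy_schwarz orthonormal_inner_sum_le[OF cosf_orthonormal assms s(1)])
  also have "\<dots> \<le> R * (norm f + e) + norm f * e"
  proof -
    have "norm s \<le> norm f + e" using s(2) norm_triangle_ineq4[of f "f - s"] by simp
    then show ?thesis using R s(2) by (intro add_mono mult_left_mono) auto
  qed
  also have "\<dots> = R * norm f + (R + norm f) * e" by (simp add: algebra_simps)
  also have "(R + norm f) * e = (norm f - R) * norm f / 2"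
    using R Rf by (simp add: e_def field_simps)
  finally have "(norm f - R) * norm f \<le> (norm f - R) * norm f / 2"
    unfolding power2_eq_square left_diff_distrib by linarith
  moreover have "0 < (norm f - R) * norm f" using Rf R by (intro mult_pos_pos) linarith+
  ultimately show False by linarith
qed

lemma cosf_complete:
  assumes "\<And>k. inner f (L2_of (cosf k)) = inner g (L2_of (cosf k))"
  shows "f = g"
  using cosf_parseval_le[of "f - g" 0] assms by (simp add: inner_diff_left l2b_zero)

text \<open>The function \<open>sinf 0\<close> is zero, so the coefficient of index \<open>0\<close> has to vanish.\<close>

lemma sinf_riesz_fischer:
  assumes b: "l2b b R" "b 0 = 0"
  obtains g where "norm g \<le> R" "\<And>k. inner g (L2_of (sinf k)) = b k"
proof -
  define S where "S n = (\<Sum>k<n. b k *\<^sub>R L2_of (sinf k))" for n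
  have S_inner: "inner (S n) (L2_of (sinf k)) = (if k < n then b k else 0)" for n k
  proof -
    have "inner (S n) (L2_of (sinf k)) = (\<Sum>l<n. if l = k then b k else 0)"
      unfolding S_def inner_sum_left
      by (intro sum.cong) (auto simp: sinf_orthogonal b(2))
    then show ?thesis by simp
  qed
  have S_diff: "(norm (S m - S n))\<^sup>2 = (\<Sum>k=n..<m. (b k)\<^sup>2)" if "n \<le> m" for m n
  proof -
    have "S m - S n = (\<Sum>k=n..<m. b k *\<^sub>R L2_of (sinf k))"
      unfolding S_def using that by (simp add: lessThan_atLeast0 sum_diff_nat_ivl)
    then have "(norm (S m - S n))\<^sup>2 = (\<Sum>k=n..<m. b k * inner (S m - S n) (L2_of (sinf k)))"
      by (simp add: power2_norm_eq_inner inner_sum_right)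
    also have "\<dots> = (\<Sum>k=n..<m. (b k)\<^sup>2)"
      by (intro sum.cong) (auto simp: inner_diff_left S_inner power2_eq_square)
    finally show ?thesis .
  qed
  have "(\<Sum>k<n. (b k)\<^sup>2) \<le> R\<^sup>2" for n
    using b(1) l2b_nonneg[OF b(1)] by (simp add: l2b_def L2_set_def sqrt_le_D)
  then have sum: "summable (\<lambda>k. (b k)\<^sup>2)"
    by (intro summableI_nonneg_bounded[of _ "R\<^sup>2"]) auto
  have "Cauchy S"
  proof (rule CauchyI')
    fix e :: real assume "0 < e"
    then obtain N where N: "\<And>m n. m \<ge> N \<Longrightarrow> norm (\<Sum>k=m..<n. (b k)\<^sup>2) < e\<^sup>2"
      using sum unfolding summable_Cauchy by (meson zero_less_power)
    show "\<exists>M. \<forall>m\<ge>M. \<forall>n>m. dist (S m) (S n) < e"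
    proof (intro exI[of _ N] allI impI)
      fix m n assume "N \<le> m" "m < n"
      then have "(norm (S n - S m))\<^sup>2 < e\<^sup>2"
        using S_diff[of m n] N[of m n] by (simp add: sum_nonneg)
      then show "dist (S m) (S n) < e"
        using \<open>0 < e\<close> by (auto simp: dist_norm norm_minus_commute dest: power2_less_imp_less)
    qed
  qed
  then obtain g where g: "S \<longlonglongrightarrow> g" using L2_Cauchy_convergent convergent_def by blast
  show ?thesis
  proof (rule that)
    show "norm g \<le> R"
    proof (rule LIMSEQ_le_const2[OF tendsto_norm[OF g]], intro exI allI impI)
      fix n
      have "norm (S n) = L2_set b {..<n}"
        using S_diff[of 0 n] by (simp add: S_def L2_set_def real_sqrt_unique atLeast0LessThan)
      then show "norm (S n) \<le> R" using b(1) by (simp add: l2b_def)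
    qed
    fix k
    have "(\<lambda>n. inner (S n) (L2_of (sinf k))) \<longlonglongrightarrow> inner g (L2_of (sinf k))"
      by (intro tendsto_intros g)
    moreover have "(\<lambda>n. inner (S n) (L2_of (sinf k))) \<longlonglongrightarrow> b k"
    proof (rule tendsto_eventually)
      show "eventually (\<lambda>n. inner (S n) (L2_of (sinf k)) = b k) sequentially"
        using eventually_gt_at_top[of k] by eventually_elim (simp add: S_inner)
    qed
    ultimately show "inner g (L2_of (sinf k)) = b k" by (rule LIMSEQ_unique)
  qed
qed

section \<open>Weak derivatives and the Sobolev space\<close>

text \<open>The relation between representatives that underlies \<open>has_weak_deriv\<close>.\<close>

definition primitive :: "(real \<Rightarrow> real) \<Rightarrow> (real \<Rightarrow> real) \<Rightarrow> bool" where
  "primitive F G \<longleftrightarrow> square_integrable G \<and> (\<forall>x\<in>{0..1}. (G has_integral (F x - F 0)) {0..x})"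

lemma has_weak_deriv_iff:
  "has_weak_deriv f g \<longleftrightarrow> (\<exists>F G. f = L2_of F \<and> g = L2_of G \<and> primitive F G)"
  by (auto simp: has_weak_deriv_def primitive_def)

lemma primitive_continuous:
  assumes "primitive F G"
  shows "continuous_on {0..1} F"
proof -
  have "G integrable_on {0..1}"
    using assms unfolding primitive_def by (metis atLeastAtMost_iff has_integral_integrable order_refl zero_le_one)
  then have "continuous_on {0..1} (\<lambda>x. F 0 + integral {0..x} G)"
    by (intro continuous_intros indefinite_integral_continuous_1)
  moreover have "F 0 + integral {0..x} G = F x" if "x \<in> {0..1}" for x
    using assms that by (force simp: primitive_def dest!: bspec integral_unique)
  ultimately show ?thesis by (simp cong: continuous_on_cong_simp)
qed

lemma primitive_diff_le:
  assumes "primitive F G" "x \<in> {0..1}" "y \<in> {0..1}" "x \<le> y"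
  shows "\<bar>F y - F x\<bar> \<le> norm (L2_of G)"
proof -
  have G: "square_integrable G" and int: "(G has_integral (F x - F 0)) {0..x}" "(G has_integral (F y - F 0)) {0..y}"
    using assms by (auto simp: primitive_def)
  have abs: "((\<lambda>x. \<bar>G x\<bar>) has_integral (LINT x|unit_leb. \<bar>G x\<bar>)) {0..1}"
    by (intro has_integral_unit_leb integrable_abs square_integrable_imp_integrable G)
  have Gxy: "G integrable_on {x..y}" "(\<lambda>x. \<bar>G x\<bar>) integrable_on {x..y}"
    using integrable_on_subinterval[OF has_integral_integrable[OF int(2)], of x y]
      integrable_on_subinterval[OF has_integral_integrable[OF abs], of x y] assms by auto
  have "F y - F x = integral {x..y} G"
    using integral_unique[OF int(1)] integral_unique[OF int(2)] assms
      Henstock_Kurzweil_Integration.integral_combine[OF _ \<open>x \<le> y\<close> has_integral_integrable[OF int(2)]] by auto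
  also have "\<bar>\<dots>\<bar> \<le> integral {x..y} (\<lambda>x. \<bar>G x\<bar>)"
    using integral_norm_bound_integral[OF Gxy] by simp
  also have "\<dots> \<le> integral {0..1} (\<lambda>x. \<bar>G x\<bar>)"
    using assms Gxy abs by (intro integral_subset_le) auto
  also have "\<dots> = (LINT x|unit_leb. \<bar>G x\<bar>)" using abs by (rule integral_unique)
  also have "\<dots> \<le> norm (L2_of G)" by (rule LINT_le_norm_L2_of[OF G])
  finally show ?thesis .
qed

lemma primitive_sq: "primitive F G \<Longrightarrow> square_integrable F" "primitive F G \<Longrightarrow> square_integrable G"
  using continuous_square_integrable primitive_continuous by (auto simp: primitive_def)

lemma primitive_exists:
  assumes "square_integrable G"
  shows "primitive (\<lambda>x. c + integral {0..x} G) G"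
  unfolding primitive_def
proof (intro conjI ballI assms)
  fix x :: real assume x: "x \<in> {0..1}"
  have "G integrable_on {0..1}"
    using has_integral_unit_leb[OF square_integrable_imp_integrable[OF assms]] by blast
  then have "G integrable_on {0..x}"
    by (rule integrable_on_subinterval) (use x in auto)
  then show "(G has_integral (c + integral {0..x} G - (c + integral {0..0} G))) {0..x}"
    by (simp add: integrable_integral)
qed

lemma primitive_add:
  assumes "primitive F G" "primitive F' G'"
  shows "primitive (\<lambda>x. F x + F' x) (\<lambda>x. G x + G' x)"
  unfolding primitive_def
proof (intro conjI ballI)
  fix x :: real assume "x \<in> {0..1}"
  then have "((\<lambda>x. G x + G' x) has_integral (F x - F 0) + (F' x - F' 0)) {0..x}"
    using assms unfolding primitive_def by (intro has_integral_add) auto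
  then show "((\<lambda>x. G x + G' x) has_integral F x + F' x - (F 0 + F' 0)) {0..x}"
    by (simp add: algebra_simps)
qed (use assms primitive_sq square_integrable_add in blast)

lemma primitive_scale:
  assumes "primitive F G"
  shows "primitive (\<lambda>x. r * F x) (\<lambda>x. r * G x)"
  unfolding primitive_def
proof (intro conjI ballI)
  fix x :: real assume "x \<in> {0..1}"
  then have "((\<lambda>x. r * G x) has_integral r * (F x - F 0)) {0..x}"
    using assms unfolding primitive_def by (intro has_integral_mult_right) auto
  then show "((\<lambda>x. r * G x) has_integral r * F x - r * F 0) {0..x}"
    by (simp add: algebra_simps)
qed (use assms primitive_sq square_integrable_scale in blast)

lemma primitive_C1:
  assumes "\<And>x. x \<in> {0..1} \<Longrightarrow> (F has_real_derivative F' x) (at x within {0..1})" "continuous_on {0..1} F'"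
  shows "primitive F F'"
  unfolding primitive_def
proof (intro conjI ballI)
  show "square_integrable F'" by (rule continuous_square_integrable[OF assms(2)])
  fix x :: real assume x: "x \<in> {0..1}"
  show "(F' has_integral F x - F 0) {0..x}"
  proof (rule fundamental_theorem_of_calculus)
    fix y assume "y \<in> {0..x}"
    then show "(F has_vector_derivative F' y) (at y within {0..x})"
      using x assms(1)[of y] by (auto simp: has_real_derivative_iff_has_vector_derivative[symmetric]
        intro: DERIV_subset)
  qed (use x in auto)
qed

text \<open>For continuous \<open>G\<close> this is the fundamental theorem of calculus. Both sides depend continuously on \<open>G\<close> in
  the norm of \<open>L2\<close>, and the continuous functions are dense.\<close>

lemma primitive_by_parts:
  assumes FG: "primitive F G"
    and \<psi>: "\<And>x. x \<in> {0..1} \<Longrightarrow> (\<psi> has_real_derivative \<psi>' x) (at x within {0..1})"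
    and \<psi>': "continuous_on {0..1} \<psi>'"
  shows "inner (L2_of G) (L2_of \<psi>) = F 1 * \<psi> 1 - F 0 * \<psi> 0 - inner (L2_of F) (L2_of \<psi>')"
    (is "?l = ?r")
proof -
  have \<psi>c: "continuous_on {0..1} \<psi>" using \<psi> by (rule DERIV_continuous_on)
  note Fc = primitive_continuous[OF FG]
  define K where "K = norm (L2_of \<psi>) + \<bar>\<psi> 1\<bar> + norm (L2_of \<psi>')"
  have "\<bar>?l - ?r\<bar> \<le> e * K" if e: "0 < e" for e
  proof -
    obtain g where g: "continuous_on UNIV g" "norm (L2_of G - L2_of g) < e"
      using L2_continuous_dense[OF e] by blast
    have gc: "continuous_on {0..1} g" using g(1) continuous_on_subset by blast
    define H where "H x = F 0 + integral {0..x} g" for x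
    have H: "primitive H g"
      unfolding H_def by (intro primitive_exists continuous_square_integrable gc)
    have H': "(H has_real_derivative g x) (at x within {0..1})" if "x \<in> {0..1}" for x
      unfolding H_def using integral_has_real_derivative[OF gc that] by (auto intro!: derivative_eq_intros)
    note Hc = primitive_continuous[OF H]
    have H0: "H 0 = F 0" by (simp add: H_def)
    have "primitive (\<lambda>x. F x + (-1) * H x) (\<lambda>x. G x + (-1) * g x)"
      by (intro primitive_add primitive_scale FG H)
    then have FH: "\<bar>F x - H x\<bar> \<le> e" if "x \<in> {0..1}" for x
      using primitive_diff_le[of "\<lambda>x. F x + (-1) * H x" "\<lambda>x. G x + (-1) * g x" 0 x] that H0 g(2)
        L2_of_diff[OF primitive_sq(2)[OF FG] primitive_sq(2)[OF H]] by auto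
    have smooth: "inner (L2_of g) (L2_of \<psi>) = H 1 * \<psi> 1 - H 0 * \<psi> 0 - inner (L2_of H) (L2_of \<psi>')"
    proof -
      have "(LINT x|unit_leb. g x * \<psi> x + H x * \<psi>' x) = H 1 * \<psi> 1 - H 0 * \<psi> 0"
        by (rule LINT_unit_leb_FTC)
           (auto intro!: derivative_eq_intros H' \<psi> continuous_intros gc \<psi>c Hc \<psi>')
      moreover have "(LINT x|unit_leb. g x * \<psi> x + H x * \<psi>' x)
          = (LINT x|unit_leb. g x * \<psi> x) + (LINT x|unit_leb. H x * \<psi>' x)"
        by (intro Bochner_Integration.integral_add square_integrable_mult continuous_square_integrable gc \<psi>c Hc \<psi>')
      ultimately show ?thesis
        by (simp add: inner_L2_of continuous_square_integrable gc \<psi>c Hc \<psi>')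
    qed
    have "?l - ?r = inner (L2_of G - L2_of g) (L2_of \<psi>) - (F 1 - H 1) * \<psi> 1
        + inner (L2_of F - L2_of H) (L2_of \<psi>')"
      using smooth H0 by (simp add: inner_diff_left algebra_simps)
    also have "\<bar>\<dots>\<bar> \<le> e * norm (L2_of \<psi>) + e * \<bar>\<psi> 1\<bar> + e * norm (L2_of \<psi>')"
    proof -
      have "\<bar>inner (L2_of G - L2_of g) (L2_of \<psi>)\<bar> \<le> norm (L2_of G - L2_of g) * norm (L2_of \<psi>)"
        by (rule Cauchy_Schwarz_ineq2)
      also have "\<dots> \<le> e * norm (L2_of \<psi>)" using g(2) by (intro mult_right_mono) auto
      finally have 1: "\<bar>inner (L2_of G - L2_of g) (L2_of \<psi>)\<bar> \<le> e * norm (L2_of \<psi>)" .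
      have 2: "\<bar>(F 1 - H 1) * \<psi> 1\<bar> \<le> e * \<bar>\<psi> 1\<bar>"
        unfolding abs_mult using FH[of 1] by (intro mult_right_mono) auto
      have "norm (L2_of F - L2_of H) \<le> e"
        using FH norm_L2_of_le_cont[of "\<lambda>x. F x - H x" e] Fc Hc
        by (simp add: L2_of_diff primitive_sq[OF FG] primitive_sq[OF H] continuous_intros)
      then have 3: "\<bar>inner (L2_of F - L2_of H) (L2_of \<psi>')\<bar> \<le> e * norm (L2_of \<psi>')"
        using Cauchy_Schwarz_ineq2[of "L2_of F - L2_of H" "L2_of \<psi>'"] mult_right_mono[of _ e "norm (L2_of \<psi>')"]
        by (meson norm_ge_zero order_trans)
      from 1 2 3 show ?thesis by linarith
    qed
    finally show ?thesis by (simp add: K_def distrib_left)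
  qed
  moreover have "0 \<le> K" by (simp add: K_def)
  ultimately have "\<bar>?l - ?r\<bar> \<le> e" if "0 < e" for e
  proof -
    have "\<bar>?l - ?r\<bar> \<le> e / (K + 1) * K" using that \<open>0 \<le> K\<close> \<open>\<And>e. 0 < e \<Longrightarrow> \<bar>?l - ?r\<bar> \<le> e * K\<close>[of "e / (K + 1)"] by simp
    also have "\<dots> \<le> e" using that \<open>0 \<le> K\<close> by (simp add: field_simps)
    finally show ?thesis .
  qed
  then have "\<bar>?l - ?r\<bar> \<le> 0" by (rule field_le_epsilon) simp
  then show ?thesis by simp
qed

lemma continuous_L2_of_eq:
  assumes "continuous_on {0..1} F" "continuous_on {0..1} F'" "L2_of F = L2_of F'" "x \<in> {0..1}"
  shows "F x = F' x"
proof -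
  define h where "h x = (F x - F' x)\<^sup>2" for x
  have hc: "continuous_on {0..1} h" unfolding h_def by (intro continuous_intros assms)
  have sq: "square_integrable F" "square_integrable F'"
    using assms continuous_square_integrable by blast+
  have "AE x in unit_leb. F x = F' x" using assms(3) sq by (simp add: L2_of_eq_iff)
  then have "(LINT x|unit_leb. h x) = 0"
    by (intro integral_eq_zero_AE) (auto simp: h_def elim: eventually_mono)
  then have "(h has_integral 0) (cbox 0 1)"
    using has_integral_unit_leb[OF square_integrable_imp_integrable[OF continuous_square_integrable[OF hc]]] by simp
  then have "h x = 0"
    using assms(4) hc by (intro has_integral_0_cbox_imp_0[of 0 1 h x]) (auto simp: h_def)
  then show ?thesis by (simp add: h_def)
qed

lemma pt_L2_of:
  assumes "continuous_on {0..1} F" "x \<in> {0..1}"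
  shows "pt (L2_of F) x = F x"
  unfolding pt_def
proof (rule the_equality)
  show "\<exists>F'. continuous_on {0..1} F' \<and> L2_of F = L2_of F' \<and> F x = F' x"
    using assms(1) by (intro exI[of _ F]) simp
  fix v assume "\<exists>F'. continuous_on {0..1} F' \<and> L2_of F = L2_of F' \<and> v = F' x"
  then obtain F' where "continuous_on {0..1} F'" "L2_of F = L2_of F'" "v = F' x" by (elim exE conjE)
  then show "v = F x" using continuous_L2_of_eq[OF assms(1) _ _ assms(2)] by simp
qed

text \<open>Two weak derivatives of one function have the same cosine coefficients, by integration by parts.\<close>

lemma weak_deriv_eq:
  assumes "primitive F G"
  shows "weak_deriv (L2_of F) = L2_of G"
  unfolding weak_deriv_def
proof (rule the_equality)
  show "has_weak_deriv (L2_of F) (L2_of G)" using assms by (auto simp: has_weak_deriv_iff)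
  fix g assume "has_weak_deriv (L2_of F) g"
  then obtain F' G' where F': "L2_of F = L2_of F'" "g = L2_of G'" "primitive F' G'"
    by (auto simp: has_weak_deriv_iff)
  have eq: "F x = F' x" if "x \<in> {0..1}" for x
    using continuous_L2_of_eq[OF _ _ F'(1) that] assms F' primitive_continuous by blast
  show "g = L2_of G"
  proof (rule cosf_complete)
    fix k
    define c where "c x = - mu k * (real k * pi) * sin (real k * pi * x)" for x
    have c: "(cosf k has_real_derivative c x) (at x within {0..1})" for x
      unfolding cosf_def c_def by (auto intro!: derivative_eq_intros)
    have cc: "continuous_on {0..1} c" unfolding c_def by (intro continuous_intros)
    show "inner g (L2_of (cosf k)) = inner (L2_of G) (L2_of (cosf k))"
      using primitive_by_parts[OF assms c cc] primitive_by_parts[OF F'(3) c cc] F'(1,2) eq by simp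
  qed
qed

lemma H1_primitive: "primitive F G \<Longrightarrow> L2_of F \<in> H1"
  by (auto simp: H1_def has_weak_deriv_iff)

lemma H1_cases:
  assumes "f \<in> H1"
  obtains F G where "primitive F G" "f = L2_of F" "weak_deriv f = L2_of G"
    "\<And>x. x \<in> {0..1} \<Longrightarrow> pt f x = F x"
  using assms weak_deriv_eq pt_L2_of[OF primitive_continuous] by (auto simp: H1_def has_weak_deriv_iff)

lemma H1_add: "f \<in> H1 \<Longrightarrow> g \<in> H1 \<Longrightarrow> f + g \<in> H1"
  and weak_deriv_add: "f \<in> H1 \<Longrightarrow> g \<in> H1 \<Longrightarrow> weak_deriv (f + g) = weak_deriv f + weak_deriv g"
proof -
  assume f: "f \<in> H1" and g: "g \<in> H1"
  obtain F F' where F: "primitive F F'" "f = L2_of F" "weak_deriv f = L2_of F'" by (rule H1_cases[OF f])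
  obtain G G' where G: "primitive G G'" "g = L2_of G" "weak_deriv g = L2_of G'" by (rule H1_cases[OF g])
  have fg: "f + g = L2_of (\<lambda>x. F x + G x)"
    using F G primitive_sq by (simp add: L2_of_add)
  show "f + g \<in> H1" unfolding fg using H1_primitive primitive_add F G by blast
  show "weak_deriv (f + g) = weak_deriv f + weak_deriv g"
    unfolding fg weak_deriv_eq[OF primitive_add[OF F(1) G(1)]] F(3) G(3)
    using F G primitive_sq by (simp add: L2_of_add)
qed

lemma H1_scale: "f \<in> H1 \<Longrightarrow> r *\<^sub>R f \<in> H1"
  and weak_deriv_scale: "f \<in> H1 \<Longrightarrow> weak_deriv (r *\<^sub>R f) = r *\<^sub>R weak_deriv f"
proof -
  assume f: "f \<in> H1"
  obtain F F' where F: "primitive F F'" "f = L2_of F" "weak_deriv f = L2_of F'" by (rule H1_cases[OF f])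
  have rf: "r *\<^sub>R f = L2_of (\<lambda>x. r * F x)"
    using F primitive_sq by (simp add: L2_of_scale)
  show "r *\<^sub>R f \<in> H1" unfolding rf using H1_primitive primitive_scale F by blast
  show "weak_deriv (r *\<^sub>R f) = r *\<^sub>R weak_deriv f"
    unfolding rf weak_deriv_eq[OF primitive_scale[OF F(1)]] F(3)
    using F primitive_sq by (simp add: L2_of_scale)
qed

lemma H1_by_parts:
  assumes "f \<in> H1"
    and "\<And>x. x \<in> {0..1} \<Longrightarrow> (\<psi> has_real_derivative \<psi>' x) (at x within {0..1})"
    and "continuous_on {0..1} \<psi>'"
  shows "inner (weak_deriv f) (L2_of \<psi>) = pt f 1 * \<psi> 1 - pt f 0 * \<psi> 0 - inner f (L2_of \<psi>')"
  by (rule H1_cases[OF assms(1)]) (use primitive_by_parts[OF _ assms(2,3)] in auto)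

text \<open>The value at \<open>1\<close> differs from the values elsewhere by at most the norm of the derivative.\<close>

lemma H1_pt_le:
  assumes "f \<in> H1"
  shows "\<bar>pt f 1\<bar> \<le> norm f + norm (weak_deriv f)"
proof -
  obtain F G where F: "primitive F G" "f = L2_of F" "weak_deriv f = L2_of G" "pt f 1 = F 1"
    by (rule H1_cases[OF assms]) auto
  have sq: "square_integrable (\<lambda>x. F 1)" "square_integrable F" using primitive_sq[OF F(1)] by (auto simp: square_integrable_def)
  have "norm (L2_of (\<lambda>x. F 1 - F x)) \<le> norm (L2_of G)"
    using primitive_diff_le[OF F(1), of _ 1] primitive_continuous[OF F(1)]
    by (intro norm_L2_of_le_cont continuous_intros) auto
  moreover have "norm f = norm (L2_of F)" by (rule arg_cong[OF F(2)])
  moreover have "norm (weak_deriv f) = norm (L2_of G)" by (rule arg_cong[OF F(3)])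
  ultimately have "norm (L2_of (\<lambda>x. F 1)) \<le> norm f + norm (weak_deriv f)"
    using norm_triangle_sub[of "L2_of (\<lambda>x. F 1)" "L2_of F"] by (simp add: L2_of_diff sq)
  moreover have "norm (L2_of (\<lambda>x. F 1)) = \<bar>F 1\<bar>"
    using norm_L2_of[OF sq(1)] by (simp add: real_sqrt_unique power2_eq_iff_nonneg abs_le_square_iff norm_eq_sqrt_inner inner_L2_of sq power2_eq_square[symmetric])
  ultimately show ?thesis by (simp add: F(4))
qed

text \<open>Sines vanish at both ends, so there is no boundary term and no boundary condition on \<open>f\<close>.\<close>

lemma inner_weak_deriv_sinf:
  assumes "f \<in> H1"
  shows "inner (weak_deriv f) (L2_of (sinf k)) = - (real k * pi) * inner f (L2_of (cosf k))"
proof -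
  have "inner (weak_deriv f) (L2_of (sinf k)) = pt f 1 * sinf k 1 - pt f 0 * sinf k 0
      - inner f (L2_of (\<lambda>x. (real k * pi) * cosf k x))"
  proof (rule H1_by_parts[OF assms])
    show "(sinf k has_real_derivative (real k * pi) * cosf k x) (at x within {0..1})" for x
      unfolding sinf_def cosf_def mu_def by (auto intro!: derivative_eq_intros)
  qed (intro continuous_intros)
  then show ?thesis by (simp add: L2_of_scale sinf_def sin_npi)
qed

text \<open>The derivative is constructed from its sine coefficients. The primitive of the resulting function,
  with a suitable constant, has the cosine coefficients of \<open>f\<close>.\<close>

lemma H1_if_cosf_weighted:
  assumes "l2b (\<lambda>k. real k * inner f (L2_of (cosf k))) R"
  shows "f \<in> H1" "norm (weak_deriv f) \<le> pi * R"
proof -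
  have "l2b (\<lambda>k. - (real k * pi) * inner f (L2_of (cosf k))) (pi * R)"
    using l2b_scale[OF assms, of "- pi"] by (simp add: mult_ac)
  then obtain g where g: "norm g \<le> pi * R"
    "\<And>k. inner g (L2_of (sinf k)) = - (real k * pi) * inner f (L2_of (cosf k))"
    by (rule sinf_riesz_fischer) auto
  obtain G where G: "square_integrable G" "g = L2_of G" by (rule L2_cases)
  define c where "c = inner f (L2_of (cosf 0)) - inner (L2_of (\<lambda>x. 0 + integral {0..x} G)) (L2_of (cosf 0))"
  define F where "F = (\<lambda>x. c + integral {0..x} G)"
  have F: "primitive F G" unfolding F_def by (rule primitive_exists[OF G(1)])
  have F0: "primitive (\<lambda>x. 0 + integral {0..x} G) G" by (rule primitive_exists[OF G(1)])
  have "L2_of F = f"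
  proof (rule cosf_complete)
    fix k
    show "inner (L2_of F) (L2_of (cosf k)) = inner f (L2_of (cosf k))"
    proof (cases "k = 0")
      case True
      have "L2_of F = c *\<^sub>R L2_of (cosf 0) + L2_of (\<lambda>x. 0 + integral {0..x} G)"
        using primitive_sq(1)[OF F0] cosf_sq[of 0] unfolding F_def
        by (subst L2_of_scale[symmetric], simp, subst L2_of_add[symmetric]) (auto simp: cosf_def mu_def square_integrable_def)
      then show ?thesis
        using True by (simp add: inner_add_left cosf_orthonormal c_def)
    next
      case False
      have "- (real k * pi) * inner (L2_of F) (L2_of (cosf k)) = - (real k * pi) * inner f (L2_of (cosf k))"
        using inner_weak_deriv_sinf[OF H1_primitive[OF F], of k] g(2)[of k] weak_deriv_eq[OF F] G(2) by simp
      then show ?thesis using False by simp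
    qed
  qed
  then show "f \<in> H1" "norm (weak_deriv f) \<le> pi * R"
    using H1_primitive[OF F] weak_deriv_eq[OF F] g(1) G(2) by auto
qed

section \<open>Eigenfunctions of the cascade\<close>

text \<open>The even function \<open>cosh (r x)\<close> of a square root \<open>r\<close> of \<open>d\<close>, written with real functions; \<open>snhs d\<close> is its
  derivative, so that \<open>snhs d 1\<close> is the quantity \<open>r sinh r\<close> in the denominators of \<open>phi\<close> and \<open>psi\<close>.\<close>

definition chs :: "real \<Rightarrow> real \<Rightarrow> real" where
  "chs d x = (if d \<ge> 0 then cosh (sqrt d * x) else cos (sqrt (- d) * x))"

definition snhs :: "real \<Rightarrow> real \<Rightarrow> real" where
  "snhs d x = (if d \<ge> 0 then sqrt d * sinh (sqrt d * x) else - sqrt (- d) * sin (sqrt (- d) * x))"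

lemma chs_deriv [derivative_intros]: "(chs d has_real_derivative snhs d x) (at x within S)"
  unfolding chs_def snhs_def by (cases "d \<ge> 0") (auto intro!: derivative_eq_intros)

lemma snhs_deriv [derivative_intros]: "(snhs d has_real_derivative d * chs d x) (at x within S)"
proof (cases "d \<ge> 0")
  case True
  then have "((\<lambda>x. sqrt d * sinh (sqrt d * x)) has_real_derivative sqrt d * sqrt d * cosh (sqrt d * x)) (at x within S)"
    by (auto intro!: derivative_eq_intros)
  then show ?thesis using True by (simp add: chs_def snhs_def[abs_def])
next
  case False
  then have "((\<lambda>x. - sqrt (- d) * sin (sqrt (- d) * x)) has_real_derivative
      d * cos (sqrt (- d) * x)) (at x within S)"
    by (auto intro!: derivative_eq_intros simp: mult.assoc)
  then show ?thesis using False by (simp add: chs_def snhs_def[abs_def])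
qed

lemma chs_cont: "continuous_on S (chs d)" and snhs_cont: "continuous_on S (snhs d)"
  using DERIV_continuous_on[OF chs_deriv] DERIV_continuous_on[OF snhs_deriv] by blast+

lemma chs_snhs_0 [simp]: "chs d 0 = 1" "snhs d 0 = 0"
  by (auto simp: chs_def snhs_def)

lemma chs_neg_square: "chs (- (r\<^sup>2)) x = cos (r * x)"
  by (cases "r = 0") (auto simp: chs_def abs_if)

lemma snhs_neg_square: "snhs (- (r\<^sup>2)) x = - r * sin (r * x)"
  by (cases "r = 0") (auto simp: snhs_def abs_if)

lemma csqrt_chs: "cosh (csqrt (of_real d) * of_real x) = of_real (chs d x)"
proof (cases "d \<ge> 0")
  case True
  then show ?thesis by (simp add: chs_def cosh_def scaleR_conv_of_real field_simps flip: exp_of_real)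
next
  case False
  have cosh_i: "cosh (\<i> * complex_of_real t) = of_real (cos t)" for t
    by (simp add: cosh_conv_cos flip: mult.assoc cos_of_real)
  have "csqrt (of_real d) * of_real x = \<i> * of_real (sqrt (- d) * x)"
    using False by (simp add: csqrt_of_real_nonpos)
  then show ?thesis using False
    by (simp only: chs_def cosh_i if_False)
qed

lemma csqrt_snhs: "csqrt (of_real d) * sinh (csqrt (of_real d)) = of_real (snhs d 1)"
proof (cases "d \<ge> 0")
  case True
  then show ?thesis by (simp add: snhs_def sinh_def scaleR_conv_of_real field_simps flip: exp_of_real)
next
  case False
  have sinh_i: "sinh (\<i> * complex_of_real t) = \<i> * of_real (sin t)" for t
    by (simp add: sinh_conv_sin flip: mult.assoc sin_of_real)
  have "csqrt (of_real d) = \<i> * of_real (sqrt (- d))"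
    using False by (simp add: csqrt_of_real_nonpos)
  then have "csqrt (of_real d) * sinh (csqrt (of_real d)) = (\<i> * \<i>) * of_real (sqrt (- d) * sin (sqrt (- d)))"
    by (simp only: sinh_i of_real_mult mult_ac)
  then show ?thesis using False by (simp add: snhs_def)
qed

text \<open>For negative \<open>d\<close> a zero of \<open>snhs d\<close> at \<open>1\<close> is a zero of the sine at \<open>sqrt (- d)\<close>.\<close>

lemma snhs_nonzero:
  assumes "\<And>m::nat. d \<noteq> - ((real m * pi)\<^sup>2)"
  shows "snhs d 1 \<noteq> 0"
proof (cases "d \<ge> 0")
  case True
  then show ?thesis using assms[of 0] by (simp add: snhs_def)
next
  case False
  show ?thesis
  proof
    assume "snhs d 1 = 0"
    then have "sin (sqrt (- d)) = 0" using False by (simp add: snhs_def)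
    then obtain i :: int where i: "sqrt (- d) = of_int i * pi" by (auto simp: sin_zero_iff_int2)
    have "(sqrt (- d))\<^sup>2 = - d" using False by simp
    then have "d = - ((real (nat \<bar>i\<bar>) * pi)\<^sup>2)" by (simp add: i power_mult_distrib)
    with assms show False by blast
  qed
qed

lemma lam_self: "lam a i k - a i = - ((real k * pi)\<^sup>2)"
  by (simp add: lam_def power_mult_distrib)

definition psi_coeff :: "(nat \<Rightarrow> real) \<Rightarrow> nat \<Rightarrow> nat \<Rightarrow> nat \<Rightarrow> real" where
  "psi_coeff a i k j = (- 1) ^ (j - i) * mu k / (\<Prod>j'\<in>{i+1..j}. snhs (lam a i k - a j') 1)"

definition phi_coeff :: "(nat \<Rightarrow> real) \<Rightarrow> nat \<Rightarrow> nat \<Rightarrow> nat \<Rightarrow> real" where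
  "phi_coeff a i k j = (- 1) ^ (k + i - j) * mu k / (\<Prod>j'\<in>{j..<i}. snhs (lam a i k - a j') 1)"

lemma psi_eq:
  assumes "i \<le> j"
  shows "psi a i k j x = psi_coeff a i k j * chs (lam a i k - a j) x"
proof (cases "j = i")
  case True
  then show ?thesis by (simp add: psi_def psi_coeff_def lam_self chs_neg_square)
next
  case False
  have "((- 1) ^ (j - i) * complex_of_real (mu k) / (\<Prod>j'\<in>{i+1..j}. rt a i k j' * sinh (rt a i k j'))
      * cosh (rt a i k j * complex_of_real x)) = complex_of_real (psi_coeff a i k j * chs (lam a i k - a j) x)"
    unfolding rt_def csqrt_chs csqrt_snhs psi_coeff_def by simp
  then show ?thesis using False assms by (simp add: psi_def)
qed

lemma phi_eq:
  assumes "j \<le> i"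
  shows "phi a i k j x = phi_coeff a i k j * chs (lam a i k - a j) (1 - x)"
proof (cases "j = i")
  case True
  have "cos (real k * pi * (1 - x)) = (- 1) ^ k * cos (real k * pi * x)"
    by (simp add: right_diff_distrib cos_diff cos_npi sin_npi)
  then show ?thesis using True
    by (simp add: phi_def phi_coeff_def lam_self chs_neg_square power_add[symmetric] mult_2[symmetric]
        flip: mult.assoc)
next
  case False
  have "((- 1) ^ (k + i - j) * complex_of_real (mu k) / (\<Prod>j'\<in>{j..<i}. rt a i k j' * sinh (rt a i k j'))
      * cosh (rt a i k j * complex_of_real (1 - x)))
      = complex_of_real (phi_coeff a i k j * chs (lam a i k - a j) (1 - x))"
    unfolding rt_def csqrt_chs csqrt_snhs phi_coeff_def by simp
  then show ?thesis using False assms by (simp add: phi_def)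
qed

lemma phi_self: "phi a i k i = cosf k" and psi_self: "psi a i k i = cosf k"
  by (simp_all add: fun_eq_iff phi_def psi_def cosf_def)

lemma phi_cont: "continuous_on S (phi a i k j)"
proof (cases "j \<le> i")
  case True
  have "continuous_on S (\<lambda>x. chs (lam a i k - a j) (1 - x))"
    by (rule continuous_on_compose2[OF chs_cont[of UNIV]]) (auto intro!: continuous_intros)
  then show ?thesis by (simp add: phi_eq[OF True, abs_def] fun_eq_iff continuous_intros cong: continuous_on_cong)
next
  case False
  then show ?thesis by (simp add: phi_def)
qed

lemma psi_cont: "continuous_on S (psi a i k j)"
proof (cases "i \<le> j")
  case True
  have "continuous_on S (\<lambda>x. psi_coeff a i k j * chs (lam a i k - a j) x)"
    by (intro continuous_intros chs_cont)
  then show ?thesis by (simp add: psi_eq[OF True] cong: continuous_on_cong)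
next
  case False
  then show ?thesis by (simp add: psi_def)
qed

lemma psi_sq [simp]: "square_integrable (psi a i k j)" and phi_sq [simp]: "square_integrable (phi a i k j)"
  by (intro continuous_square_integrable psi_cont phi_cont)+

definition coef :: "nat \<Rightarrow> (nat \<Rightarrow> real) \<Rightarrow> nat \<Rightarrow> nat \<Rightarrow> (nat \<Rightarrow> L2) \<Rightarrow> real" where
  "coef N a i k f = (\<Sum>j=1..N. inner (f j) (L2_of (psi a i k j)))"

lemma coef_add: "coef N a i k (\<lambda>j. f j + g j) = coef N a i k f + coef N a i k g"
  and coef_diff: "coef N a i k (\<lambda>j. f j - g j) = coef N a i k f - coef N a i k g"
  and coef_scale: "coef N a i k (\<lambda>j. r *\<^sub>R f j) = r * coef N a i k f"
  by (simp_all add: coef_def inner_add_left inner_diff_left sum.distrib sum_subtractf sum_distrib_left)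

lemma coef_sum: "finite K \<Longrightarrow> coef N a i k (\<lambda>j. \<Sum>l\<in>K. f l j) = (\<Sum>l\<in>K. coef N a i k (f l))"
  by (induction rule: finite_induct) (simp_all add: coef_add, simp add: coef_def)

lemma L2_psi_0: "j < i \<Longrightarrow> L2_of (psi a i k j) = 0"
  using L2_of_0 by (simp add: psi_def[abs_def])

lemma coef_triangular:
  assumes "i \<in> {1..N}"
  shows "coef N a i k f = (\<Sum>j\<in>{i..N}. inner (f j) (L2_of (psi a i k j)))"
  unfolding coef_def using assms by (intro sum.mono_neutral_right) (auto simp: L2_psi_0)

lemma coef_head:
  assumes "i \<in> {1..N}"
  shows "coef N a i k f = inner (f i) (L2_of (cosf k)) + (\<Sum>j\<in>{i<..N}. inner (f j) (L2_of (psi a i k j)))"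
proof -
  have "{i..N} = insert i {i<..N}" using assms by auto
  then show ?thesis unfolding coef_triangular[OF assms] by (simp add: psi_self)
qed

lemma H2_smooth:
  assumes "primitive F F'" "primitive F' F''"
  shows "L2_of F \<in> H2" "weak_deriv (L2_of F) = L2_of F'" "weak_deriv (weak_deriv (L2_of F)) = L2_of F''"
    "x \<in> {0..1} \<Longrightarrow> pt (L2_of F) x = F x" "x \<in> {0..1} \<Longrightarrow> pt (weak_deriv (L2_of F)) x = F' x"
  using assms weak_deriv_eq[OF assms(1)] weak_deriv_eq[OF assms(2)] H1_primitive
    pt_L2_of[OF primitive_continuous] by (auto simp: H2_def)

lemma primitive_zero: "primitive (\<lambda>x. 0) (\<lambda>x. 0)"
  by (intro primitive_C1) auto

lemma H2_zero: "0 \<in> H2" "weak_deriv 0 = 0" "x \<in> {0..1} \<Longrightarrow> pt 0 x = 0"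
  using H2_smooth[OF primitive_zero primitive_zero] L2_of_0 by simp_all

locale cascade =
  fixes N :: nat and a :: "nat \<Rightarrow> real"
  assumes N: "1 \<le> N"
    and lam_neq: "\<And>i j k m. i \<in> {1..N} \<Longrightarrow> j \<in> {1..N} \<Longrightarrow> i \<noteq> j \<Longrightarrow> lam a i k \<noteq> lam a j m"
begin

lemma snhs_lam_nonzero:
  assumes "i \<in> {1..N}" "j \<in> {1..N}" "i \<noteq> j"
  shows "snhs (lam a i k - a j) 1 \<noteq> 0"
proof (rule snhs_nonzero)
  fix m :: nat
  show "lam a i k - a j \<noteq> - ((real m * pi)\<^sup>2)"
    using lam_neq[OF assms, of k m] lam_self[of a j m] by simp
qed

text \<open>In terms of \<open>psi\<close>: the derivative of component \<open>j + 1\<close> at \<open>1\<close> is minus the value of component \<open>j\<close> at \<open>0\<close>,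
  which is the boundary coupling of the adjoint cascade.\<close>

lemma psi_coeff_Suc:
  assumes "i \<in> {1..N}" "i \<le> j" "Suc j \<in> {1..N}"
  shows "psi_coeff a i k (Suc j) * snhs (lam a i k - a (Suc j)) 1 = - psi_coeff a i k j"
proof -
  have "{i+1..Suc j} = insert (Suc j) {i+1..j}" using assms by auto
  then show ?thesis
    using snhs_lam_nonzero[of i "Suc j" k] assms by (simp add: psi_coeff_def Suc_diff_le)
qed

text \<open>In terms of \<open>phi\<close>: the derivative of component \<open>j\<close> at \<open>0\<close> is the value of component \<open>j + 1\<close> at \<open>1\<close>.\<close>

lemma phi_coeff_Suc:
  assumes "i \<in> {1..N}" "j < i" "j \<in> {1..N}"
  shows "phi_coeff a i k j * snhs (lam a i k - a j) 1 = - phi_coeff a i k (Suc j)"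
proof -
  have "{j..<i} = insert j {Suc j..<i}" using assms by auto
  moreover have "k + i - j = Suc (k + i - Suc j)" using assms by simp
  ultimately show ?thesis
    using snhs_lam_nonzero[of i j k] assms by (simp add: phi_coeff_def)
qed

lemma green_component:
  assumes f: "f \<in> H2" "pt (weak_deriv f) 1 = 0" and ij: "i \<le> j"
  shows "inner (weak_deriv (weak_deriv f) + a j *\<^sub>R f) (L2_of (psi a i k j))
    = lam a i k * inner f (L2_of (psi a i k j)) - pt (weak_deriv f) 0 * psi_coeff a i k j
      - pt f 1 * (psi_coeff a i k j * snhs (lam a i k - a j) 1)"
proof -
  define q where "q = psi_coeff a i k j"
  define d where "d = lam a i k - a j"
  have f': "f \<in> H1" "weak_deriv f \<in> H1" using f(1) by (auto simp: H2_def)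
  have psi: "psi a i k j = (\<lambda>x. q * chs d x)" by (simp add: fun_eq_iff psi_eq[OF ij] q_def d_def)
  have d1: "((\<lambda>x. q * chs d x) has_real_derivative q * snhs d x) (at x within {0..1})" for x
    by (rule DERIV_cmult[OF chs_deriv])
  have d2: "((\<lambda>x. q * snhs d x) has_real_derivative q * (d * chs d x)) (at x within {0..1})" for x
    by (rule DERIV_cmult[OF snhs_deriv])
  have c: "continuous_on {0..1} (\<lambda>x. q * snhs d x)" "continuous_on {0..1} (\<lambda>x. q * (d * chs d x))"
    "continuous_on {0..1} (\<lambda>x. q * chs d x)"
    by (intro continuous_intros snhs_cont chs_cont)+
  have "(\<lambda>x. q * (d * chs d x)) = (\<lambda>x. d * (q * chs d x))" by auto
  then have "inner f (L2_of (\<lambda>x. q * (d * chs d x))) = d * inner f (L2_of (\<lambda>x. q * chs d x))"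
    by (simp only: L2_of_scale[OF continuous_square_integrable[OF c(3)]] inner_scaleR_right)
  then have "inner (weak_deriv (weak_deriv f)) (L2_of (psi a i k j))
    = d * inner f (L2_of (psi a i k j)) - pt (weak_deriv f) 0 * q - pt f 1 * (q * snhs d 1)"
    unfolding psi using H1_by_parts[OF f'(2) d1 c(1)] H1_by_parts[OF f'(1) d2 c(2)] f(2) by simp
  then show ?thesis
    by (simp add: inner_add_left q_def d_def algebra_simps)
qed

text \<open>The boundary terms of consecutive components cancel: the coupling \<open>f j'(0) = f (j+1) (1)\<close> of the state
  meets the dual coupling of \<open>psi\<close>. Only the input at the end of the chain remains.\<close>

theorem green:
  assumes f: "cascade_dom N f u" and i: "i \<in> {1..N}"
  shows "coef N a i k (cascade_op a f) = lam a i k * coef N a i k f - u * psi_coeff a i k N"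
proof -
  define b where "b j = (if j \<le> N then pt (f j) 1 else u)" for j
  define P where "P = psi_coeff a i k"
  define Q where "Q j = P j * snhs (lam a i k - a j) 1" for j
  have comp: "inner (cascade_op a f j) (L2_of (psi a i k j))
      = lam a i k * inner (f j) (L2_of (psi a i k j)) - (b (Suc j) * P j + b j * Q j)"
    if j: "j \<in> {i..N}" for j
  proof -
    have "pt (weak_deriv (f j)) 1 = 0" "pt (weak_deriv (f j)) 0 = b (Suc j)" "f j \<in> H2"
      using f j i by (cases "j = N"; auto simp: cascade_dom_def b_def)+
    then show ?thesis
      using green_component[of "f j" i j k] j by (simp add: cascade_op_def P_def Q_def b_def algebra_simps)
  qed
  have "(\<Sum>j\<in>{i..n}. b (Suc j) * P j + b j * Q j) = b (Suc n) * P n" if "i \<le> n" "n \<le> N" for n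
    using that
  proof (induction n rule: nat_induct_at_least)
    case base
    have "Q i = 0" by (simp add: Q_def lam_self snhs_neg_square sin_npi)
    then show ?case by simp
  next
    case (Suc n)
    have "{i..Suc n} = insert (Suc n) {i..n}" using Suc by auto
    then show ?case
      using Suc psi_coeff_Suc[OF i, of n k] by (simp add: Q_def P_def)
  qed
  from this[of N] i have "(\<Sum>j\<in>{i..N}. b (Suc j) * P j + b j * Q j) = u * P N"
    by (simp add: b_def)
  then show ?thesis
    unfolding coef_triangular[OF i] using comp
    by (simp add: sum_subtractf sum_distrib_left P_def)
qed

definition Phi :: "nat \<Rightarrow> nat \<Rightarrow> nat \<Rightarrow> L2" where "Phi i k j = L2_of (phi a i k j)"

lemma Phi_eigen:
  assumes i: "i \<in> {1..N}"
  shows "cascade_dom N (Phi i k) 0" "cascade_op a (Phi i k) = (\<lambda>j. lam a i k *\<^sub>R Phi i k j)"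
proof -
  define d where "d j = lam a i k - a j" for j
  define q where "q = phi_coeff a i k"
  have le: "Phi i k j \<in> H2 \<and> pt (weak_deriv (Phi i k j)) 1 = 0 \<and> pt (weak_deriv (Phi i k j)) 0 = - q j * snhs (d j) 1
      \<and> pt (Phi i k j) 1 = q j \<and> weak_deriv (weak_deriv (Phi i k j)) = d j *\<^sub>R Phi i k j"
    if j: "j \<le> i" for j
  proof -
    have phi: "phi a i k j = (\<lambda>x. q j * chs (d j) (1 - x))"
      by (simp add: fun_eq_iff phi_eq[OF j] q_def d_def)
    have ch: "continuous_on {0..1} (\<lambda>x. chs e (1 - x))" "continuous_on {0..1} (\<lambda>x. snhs e (1 - x))" for e
      by (rule continuous_on_compose2[OF chs_cont[of UNIV]] continuous_on_compose2[OF snhs_cont[of UNIV]];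
          auto intro!: continuous_intros)+
    have p1: "primitive (\<lambda>x. q j * chs (d j) (1 - x)) (\<lambda>x. - q j * snhs (d j) (1 - x))"
    proof (rule primitive_C1)
      show "((\<lambda>x. q j * chs (d j) (1 - x)) has_real_derivative - q j * snhs (d j) (1 - x)) (at x within {0..1})" for x
        by (auto intro!: derivative_eq_intros DERIV_chain2[OF chs_deriv])
    qed (intro continuous_intros ch)
    have p2: "primitive (\<lambda>x. - q j * snhs (d j) (1 - x)) (\<lambda>x. d j * (q j * chs (d j) (1 - x)))"
    proof (rule primitive_C1)
      show "((\<lambda>x. - q j * snhs (d j) (1 - x)) has_real_derivative d j * (q j * chs (d j) (1 - x))) (at x within {0..1})" for x
        by (auto intro!: derivative_eq_intros DERIV_chain2[OF snhs_deriv])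
    qed (intro continuous_intros ch)
    note H2_smooth[OF p1 p2]
    moreover have "L2_of (\<lambda>x. d j * (q j * chs (d j) (1 - x))) = d j *\<^sub>R L2_of (\<lambda>x. q j * chs (d j) (1 - x))"
      by (intro L2_of_scale continuous_square_integrable continuous_intros ch)
    ultimately show ?thesis by (simp add: Phi_def phi)
  qed
  have gt: "Phi i k j = 0" if "i < j" for j
    using that L2_of_0 by (simp add: Phi_def phi_def[abs_def])
  have in_H2: "Phi i k j \<in> H2 \<and> pt (weak_deriv (Phi i k j)) 1 = 0" for j
    using le[of j] gt[of j] H2_zero by (cases "j \<le> i") auto
  have bc: "pt (weak_deriv (Phi i k j)) 0 = (if j < i then q (Suc j) else 0)" if "j \<in> {1..N}" for j
  proof (cases j i rule: linorder_cases)
    case less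
    then show ?thesis using le[of j] phi_coeff_Suc[OF i, of j k] that by (simp add: q_def d_def)
  next
    case equal
    then show ?thesis using le[of j] by (simp add: d_def lam_self snhs_neg_square sin_npi)
  next
    case greater
    then show ?thesis using gt H2_zero by simp
  qed
  have p1: "pt (Phi i k (Suc j)) 1 = (if j < i then q (Suc j) else 0)" for j
    using le[of "Suc j"] gt[of "Suc j"] H2_zero by (cases "j < i") auto
  show "cascade_dom N (Phi i k) 0"
    unfolding cascade_dom_def using in_H2 bc p1 N i by auto
  show "cascade_op a (Phi i k) = (\<lambda>j. lam a i k *\<^sub>R Phi i k j)"
  proof
    fix j
    show "cascade_op a (Phi i k) j = lam a i k *\<^sub>R Phi i k j"
    proof (cases "j \<le> i")
      case True
      then show ?thesis using le[of j] by (simp add: cascade_op_def d_def scaleR_diff_left)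
    next
      case False
      then show ?thesis using gt H2_zero by (simp add: cascade_op_def)
    qed
  qed
qed

lemma lam_inj:
  assumes "i \<in> {1..N}" "j \<in> {1..N}" "(i, k) \<noteq> (j, m)"
  shows "lam a i k \<noteq> lam a j m"
proof (cases "i = j")
  case True
  then have "k \<noteq> m" using assms(3) by simp
  then show ?thesis using True by (simp add: lam_def power2_eq_iff)
qed (use lam_neq assms in auto)

text \<open>Eigenfunctions of the cascade and of its adjoint for different eigenvalues are orthogonal by Green's
  identity. For equal indices, component \<open>i\<close> is the only one in which neither factor vanishes, and both
  factors are the same normalized cosine there.\<close>

theorem biorthogonal:
  assumes "i \<in> {1..N}" "j \<in> {1..N}"
  shows "coef N a i k (Phi j m) = (if i = j \<and> k = m then 1 else 0)"
proof (cases "i = j \<and> k = m")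
  case True
  have "Phi i k l = 0" if "i < l" for l
    using that L2_of_0 by (simp add: Phi_def phi_def[abs_def])
  then have "coef N a i k (Phi i k) = inner (Phi i k i) (L2_of (cosf k))"
    unfolding coef_head[OF assms(1)] by simp
  then show ?thesis using True by (simp add: Phi_def phi_self cosf_orthonormal)
next
  case False
  have "lam a j m * coef N a i k (Phi j m) = lam a i k * coef N a i k (Phi j m)"
    using green[OF Phi_eigen(1)[OF assms(2), of m] assms(1), of k]
    by (simp add: Phi_eigen(2)[OF assms(2)] coef_scale)
  then show ?thesis using lam_inj[OF assms, of k m] False by auto
qed

definition Lift :: "nat \<Rightarrow> L2" where "Lift j = (if j = N then L2_of lifting else 0)"

abbreviation lifted :: "(nat \<Rightarrow> L2) \<Rightarrow> real \<Rightarrow> nat \<Rightarrow> L2" where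
  "lifted y u \<equiv> \<lambda>j. y j - u *\<^sub>R Lift j"

lemma lifting_deriv: "(lifting has_real_derivative 1 - x) (at x within S)"
  unfolding lifting_def by (auto intro!: derivative_eq_intros simp: field_simps)

lemma deriv_lifting: "deriv lifting = (\<lambda>x. 1 - x)" "deriv (deriv lifting) = (\<lambda>x. - 1)"
proof -
  show 1: "deriv lifting = (\<lambda>x. 1 - x)"
    by (rule ext) (rule DERIV_imp_deriv[OF lifting_deriv])
  show "deriv (deriv lifting) = (\<lambda>x. - 1)"
    unfolding 1 by (rule ext, rule DERIV_imp_deriv) (auto intro!: derivative_eq_intros)
qed

lemma primitive_lifting: "primitive lifting (\<lambda>x. 1 - x)" "primitive (\<lambda>x. 1 - x) (\<lambda>x. - 1)"
  by (auto intro!: primitive_C1 lifting_deriv derivative_eq_intros continuous_intros)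

text \<open>The lifting is itself an element of the domain, with input \<open>1\<close>; Green's identity therefore also
  computes the coefficients \<open>alpha\<close>.\<close>

lemma Lift_dom: "cascade_dom N Lift 1"
  using H2_smooth[OF primitive_lifting] H2_zero N
  by (auto simp: cascade_dom_def Lift_def lifting_def)

lemma lifting_sq: "square_integrable lifting"
  by (rule primitive_sq(1)[OF primitive_lifting(1)])

lemma alpha_sq: "square_integrable (alpha_fun N a j)" and beta_sq: "square_integrable (beta_fun N j)"
  by (cases "j = N"; auto simp: alpha_fun_def[abs_def] beta_fun_def[abs_def] deriv_lifting lifting_def
      intro!: continuous_square_integrable continuous_intros)+

lemma Lift_op: "cascade_op a Lift j = L2_of (alpha_fun N a j)"
proof (cases "j = N")
  case True
  have "L2_of (\<lambda>x. - 1 + a N * lifting x) = L2_of (\<lambda>x. - 1) + a N *\<^sub>R L2_of lifting"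
    unfolding L2_of_scale[OF lifting_sq, symmetric]
    by (intro L2_of_add square_integrable_scale lifting_sq continuous_square_integrable continuous_intros)
  then show ?thesis using True H2_smooth[OF primitive_lifting]
    by (simp add: cascade_op_def Lift_def alpha_fun_def[abs_def] deriv_lifting)
next
  case False
  then show ?thesis using H2_zero L2_of_0 by (simp add: cascade_op_def Lift_def alpha_fun_def[abs_def])
qed

lemma alpha_coef: "alpha N a i k = coef N a i k (\<lambda>j. L2_of (alpha_fun N a j))"
  by (simp add: alpha_def coef_def inner_L2_of alpha_sq)

lemma beta_coef: "beta N a i k = - coef N a i k Lift"
proof -
  have "L2_of (beta_fun N j) = - Lift j" for j
    using L2_of_uminus[OF lifting_sq] L2_of_0 by (simp add: beta_fun_def[abs_def] Lift_def)
  then have "inner (L2_of (beta_fun N j)) p = - inner (Lift j) p" for j p by simp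
  then show ?thesis
    by (simp add: beta_def coef_def inner_L2_of[symmetric] beta_sq sum_negf)
qed

lemma alpha_beta:
  assumes "i \<in> {1..N}"
  shows "alpha N a i k = - lam a i k * beta N a i k - psi_coeff a i k N"
  using green[OF Lift_dom assms, of k] by (simp add: alpha_coef beta_coef Lift_op[abs_def] Lift_op)

end

section \<open>Asymptotics of the eigenfunctions\<close>

text \<open>Asymptotic estimates in \<open>k\<close> become uniform ones, at the price of a larger constant.\<close>

lemma uniform_bound_from_tail:
  fixes f :: "nat \<Rightarrow> 'a \<Rightarrow> real"
  assumes each: "\<And>k. \<exists>C. \<forall>x\<in>S. f k x \<le> C" and tail: "\<And>k x. k \<ge> K \<Longrightarrow> x \<in> S \<Longrightarrow> f k x \<le> C"
  shows "\<exists>C\<ge>0. \<forall>k. \<forall>x\<in>S. f k x \<le> C"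
proof -
  obtain c where c: "\<And>k x. x \<in> S \<Longrightarrow> f k x \<le> c k" using each by metis
  have "f k x \<le> (\<Sum>k<K. \<bar>c k\<bar>) + \<bar>C\<bar>" if "x \<in> S" for k x
  proof (cases "k < K")
    case True
    then have "\<bar>c k\<bar> \<le> (\<Sum>k<K. \<bar>c k\<bar>)" by (intro member_le_sum) auto
    then show ?thesis using c[OF that, of k] by linarith
  next
    case False
    have "0 \<le> (\<Sum>k<K. \<bar>c k\<bar>)" by (intro sum_nonneg) auto
    then show ?thesis using False tail[OF _ that, of k] by linarith
  qed
  then show ?thesis by (intro exI[of _ "(\<Sum>k<K. \<bar>c k\<bar>) + \<bar>C\<bar>"]) (auto intro!: add_nonneg_nonneg sum_nonneg)
qed

lemma continuous_bounded_Icc: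
  fixes f :: "real \<Rightarrow> real"
  assumes "continuous_on {0..1} f"
  shows "\<exists>C. \<forall>x\<in>{0..1}. f x \<le> C"
proof -
  obtain z where "z \<in> {0..1}" "\<forall>x\<in>{0..1}. f x \<le> f z"
    using continuous_attains_sup[of "{0..1::real}" f] assms by auto
  then show ?thesis by blast
qed

lemma abs_cos_diff_le: "\<bar>cos x - cos y\<bar> \<le> \<bar>x - y\<bar>" for x y :: real
proof -
  have "\<bar>cos x - cos y\<bar> = 2 * (\<bar>sin ((x + y) / 2)\<bar> * \<bar>sin ((y - x) / 2)\<bar>)"
    by (simp add: cos_diff_cos abs_mult)
  also have "\<dots> \<le> 2 * (1 * \<bar>(y - x) / 2\<bar>)"
    by (intro mult_left_mono mult_mono abs_sin_le_one abs_sin_x_le_abs_x) auto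
  finally show ?thesis by simp
qed

lemma abs_sin_diff_le: "\<bar>sin x - sin y\<bar> \<le> \<bar>x - y\<bar>" for x y :: real
proof -
  have "\<bar>sin x - sin y\<bar> = 2 * (\<bar>sin ((x - y) / 2)\<bar> * \<bar>cos ((x + y) / 2)\<bar>)"
    by (simp add: sin_diff_sin abs_mult)
  also have "\<dots> \<le> 2 * (\<bar>(x - y) / 2\<bar> * 1)"
    by (intro mult_left_mono mult_mono abs_cos_le_one abs_sin_x_le_abs_x) auto
  finally show ?thesis by simp
qed

lemma abs_sin_ge:
  fixes \<eta> :: real
  assumes "\<bar>\<eta>\<bar> \<le> 1"
  shows "cos 1 * \<bar>\<eta>\<bar> \<le> \<bar>sin \<eta>\<bar>"
proof -
  have pos: "cos 1 * y \<le> sin y" if y: "0 < y" "y \<le> 1" for y :: real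
  proof -
    obtain z where z: "0 < z" "z < y" "sin y - sin 0 = (y - 0) * cos z"
      using MVT2[of 0 y sin cos] y by (auto intro: derivative_intros)
    have "cos 1 \<le> cos z" using z y pi_gt3 by (intro cos_monotone_0_pi_le) auto
    then show ?thesis using z y by (simp add: mult.commute)
  qed
  have "0 \<le> sin \<bar>\<eta>\<bar>" using assms pi_gt3 by (intro sin_ge_zero) auto
  then have "\<bar>sin \<eta>\<bar> = sin \<bar>\<eta>\<bar>" by (cases "\<eta> \<ge> 0") auto
  then show ?thesis using pos[of "\<bar>\<eta>\<bar>"] assms by (cases "\<eta> = 0") auto
qed

lemma cos_1_pos: "0 < cos (1::real)"
  using pi_gt3 by (intro cos_gt_zero) auto

text \<open>For large \<open>k\<close> the function \<open>chs (\<gamma> - (k pi)^2)\<close> is a cosine of frequency \<open>s\<close>. The factorization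
  \<open>(s - k pi) (s + k pi) = - \<gamma>\<close> shows that \<open>s\<close> differs from \<open>k pi\<close> by \<open>O(1 / k)\<close>.\<close>

lemma frequency_shift:
  fixes \<gamma> :: real
  assumes "real k \<ge> 2 * \<bar>\<gamma>\<bar> + 1"
  obtains s where "0 < s" "\<gamma> - (real k * pi)\<^sup>2 = - (s\<^sup>2)" "real k * pi / 2 \<le> s"
    "\<bar>s - real k * pi\<bar> * (s + real k * pi) = \<bar>\<gamma>\<bar>" "\<bar>s - real k * pi\<bar> * real k \<le> \<bar>\<gamma>\<bar>" "real k \<le> s"
proof -
  define r where "r = real k * pi"
  have k: "1 \<le> real k" using assms by linarith
  have r1: "2 * real k \<le> r" using mult_left_mono[of 2 pi "real k"] pi_gt3 by (simp add: r_def mult.commute)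
  have r: "2 * real k \<le> r" "1 \<le> r" using k r1 by linarith+
  have "real k * 1 \<le> real k * real k" using k by (intro mult_left_mono) auto
  also have "4 * (real k * real k) \<le> r * r" using r mult_mono[of "2 * real k" r "2 * real k" r] by simp
  finally have r2: "4 * real k \<le> r\<^sup>2" by (simp add: power2_eq_square)
  have g: "\<gamma> \<le> r\<^sup>2 / 4" using assms r2 by linarith
  define s where "s = sqrt (r\<^sup>2 - \<gamma>)"
  have s2: "s\<^sup>2 = r\<^sup>2 - \<gamma>"
    unfolding s_def using g zero_le_power2[of r] by (intro real_sqrt_pow2) linarith
  have "(r / 2)\<^sup>2 = r\<^sup>2 / 4" by (simp add: power_divide)
  then have "(r / 2)\<^sup>2 \<le> s\<^sup>2" using g zero_le_power2[of r] unfolding s2 by linarith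
  moreover have "0 \<le> s" unfolding s_def using g zero_le_power2[of r] by (intro real_sqrt_ge_zero) linarith
  ultimately have s: "r / 2 \<le> s" by (rule power2_le_imp_le)
  have "(s - r) * (s + r) = - \<gamma>" using s2 by (simp add: algebra_simps power2_eq_square)
  then have "\<bar>s - r\<bar> * \<bar>s + r\<bar> = \<bar>\<gamma>\<bar>" by (simp flip: abs_mult)
  then have prod: "\<bar>s - r\<bar> * (s + r) = \<bar>\<gamma>\<bar>" using s r by simp
  have "\<bar>s - r\<bar> * real k \<le> \<bar>s - r\<bar> * (s + r)"
    using s r by (intro mult_left_mono) linarith+
  then show ?thesis using that[of s] s r s2 prod by (simp add: r_def[symmetric])
qed

lemma chs_asymptotic: "\<exists>C\<ge>0. \<forall>k. \<forall>x\<in>{0..1}. (real k + 1) * \<bar>chs (\<gamma> - (real k * pi)\<^sup>2) x - cos (real k * pi * x)\<bar> \<le> C"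
proof (rule uniform_bound_from_tail[where K = "nat \<lceil>2 * \<bar>\<gamma>\<bar> + 1\<rceil>" and C = "2 * \<bar>\<gamma>\<bar>"])
  fix k
  show "\<exists>C. \<forall>x\<in>{0..1}. (real k + 1) * \<bar>chs (\<gamma> - (real k * pi)\<^sup>2) x - cos (real k * pi * x)\<bar> \<le> C"
    by (intro continuous_bounded_Icc continuous_intros chs_cont)
next
  fix k and x :: real assume "nat \<lceil>2 * \<bar>\<gamma>\<bar> + 1\<rceil> \<le> k" and x: "x \<in> {0..1}"
  then have k: "real k \<ge> 2 * \<bar>\<gamma>\<bar> + 1" by linarith
  obtain s where s: "\<gamma> - (real k * pi)\<^sup>2 = - (s\<^sup>2)" "\<bar>s - real k * pi\<bar> * real k \<le> \<bar>\<gamma>\<bar>"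
    using frequency_shift[OF k] by metis
  have "\<bar>cos (s * x) - cos (real k * pi * x)\<bar> \<le> \<bar>s * x - real k * pi * x\<bar>"
    by (rule abs_cos_diff_le)
  also have "\<dots> = \<bar>s - real k * pi\<bar> * x" using x by (simp add: abs_mult flip: left_diff_distrib)
  also have "\<dots> \<le> \<bar>s - real k * pi\<bar> * 1" using x by (intro mult_left_mono) auto
  finally have "(real k + 1) * \<bar>cos (s * x) - cos (real k * pi * x)\<bar> \<le> (real k + real k) * \<bar>s - real k * pi\<bar>"
    using k by (intro mult_mono) auto
  also have "\<dots> \<le> 2 * \<bar>\<gamma>\<bar>" using s(2) by (simp add: mult_ac)
  finally show "(real k + 1) * \<bar>chs (\<gamma> - (real k * pi)\<^sup>2) x - cos (real k * pi * x)\<bar> \<le> 2 * \<bar>\<gamma>\<bar>"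
    by (simp add: s(1) chs_neg_square)
qed

lemma snhs_asymptotic: "\<exists>C\<ge>0. \<forall>k. \<forall>x\<in>{0..1}. \<bar>snhs (\<gamma> - (real k * pi)\<^sup>2) x + real k * pi * sin (real k * pi * x)\<bar> \<le> C"
proof (rule uniform_bound_from_tail[where K = "nat \<lceil>2 * \<bar>\<gamma>\<bar> + 1\<rceil>" and C = "2 * \<bar>\<gamma>\<bar>"])
  fix k
  show "\<exists>C. \<forall>x\<in>{0..1}. \<bar>snhs (\<gamma> - (real k * pi)\<^sup>2) x + real k * pi * sin (real k * pi * x)\<bar> \<le> C"
    by (intro continuous_bounded_Icc continuous_intros snhs_cont)
next
  fix k and x :: real assume "nat \<lceil>2 * \<bar>\<gamma>\<bar> + 1\<rceil> \<le> k" and x: "x \<in> {0..1}"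
  then have k: "real k \<ge> 2 * \<bar>\<gamma>\<bar> + 1" by linarith
  obtain s where s: "\<gamma> - (real k * pi)\<^sup>2 = - (s\<^sup>2)" "\<bar>s - real k * pi\<bar> * (s + real k * pi) = \<bar>\<gamma>\<bar>" "0 < s"
     "\<bar>s - real k * pi\<bar> * real k \<le> \<bar>\<gamma>\<bar>"
    using frequency_shift[OF k] by metis
  define r where "r = real k * pi"
  have r: "0 \<le> r" by (simp add: r_def)
  have "\<bar>sin (s * x) - sin (r * x)\<bar> \<le> \<bar>s * x - r * x\<bar>" by (rule abs_sin_diff_le)
  also have "\<dots> = \<bar>s - r\<bar> * x" using x by (simp add: abs_mult flip: left_diff_distrib)
  also have "\<dots> \<le> \<bar>s - r\<bar> * 1" using x by (intro mult_left_mono) auto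
  finally have "r * \<bar>sin (s * x) - sin (r * x)\<bar> \<le> r * \<bar>s - r\<bar>" using r by (intro mult_left_mono) auto
  also have "\<dots> \<le> \<bar>s - r\<bar> * (s + r)" using s(3) by (simp add: algebra_simps)
  finally have 1: "r * \<bar>sin (s * x) - sin (r * x)\<bar> \<le> \<bar>\<gamma>\<bar>" using s(2) by (simp add: r_def)
  have "\<bar>s - r\<bar> * \<bar>sin (s * x)\<bar> \<le> \<bar>s - r\<bar> * 1" by (intro mult_left_mono abs_sin_le_one) auto
  also have "\<dots> \<le> \<bar>s - r\<bar> * real k" using k by (intro mult_left_mono) auto
  finally have 2: "\<bar>s - r\<bar> * \<bar>sin (s * x)\<bar> \<le> \<bar>\<gamma>\<bar>" using s(4) by (simp add: r_def)
  have "- s * sin (s * x) + r * sin (r * x) = - ((s - r) * sin (s * x)) - r * (sin (s * x) - sin (r * x))"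
    by (simp add: algebra_simps)
  then have "\<bar>- s * sin (s * x) + r * sin (r * x)\<bar> \<le> \<bar>s - r\<bar> * \<bar>sin (s * x)\<bar> + r * \<bar>sin (s * x) - sin (r * x)\<bar>"
    using r abs_triangle_ineq4[of "- ((s - r) * sin (s * x))" "r * (sin (s * x) - sin (r * x))"]
    by (simp add: abs_mult)
  with 1 2 show "\<bar>snhs (\<gamma> - (real k * pi)\<^sup>2) x + real k * pi * sin (real k * pi * x)\<bar> \<le> 2 * \<bar>\<gamma>\<bar>"
    by (simp add: s(1) snhs_neg_square r_def)
qed

text \<open>Here \<open>snhs\<close> is \<open>- s sin s\<close> for large \<open>k\<close>. The sine is of the size of the frequency shift, about
  \<open>\<bar>\<gamma>\<bar> / (2 s)\<close>, so the product stays away from zero when \<open>\<gamma> \<noteq> 0\<close>.\<close>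

lemma snhs_inverse_bounded:
  assumes "\<And>k. snhs (\<gamma> - (real k * pi)\<^sup>2) 1 \<noteq> 0" "\<gamma> \<noteq> 0"
  shows "\<exists>C\<ge>0. \<forall>k. \<bar>inverse (snhs (\<gamma> - (real k * pi)\<^sup>2) 1)\<bar> \<le> C"
proof -
  have "\<exists>C\<ge>0. \<forall>k. \<forall>x\<in>{()}. \<bar>inverse (snhs (\<gamma> - (real k * pi)\<^sup>2) 1)\<bar> \<le> C"
  proof (rule uniform_bound_from_tail[where K = "nat \<lceil>2 * \<bar>\<gamma>\<bar> + 1\<rceil>" and C = "3 / (cos 1 * \<bar>\<gamma>\<bar>)"])
    fix k assume "nat \<lceil>2 * \<bar>\<gamma>\<bar> + 1\<rceil> \<le> k"
    then have k: "real k \<ge> 2 * \<bar>\<gamma>\<bar> + 1" by linarith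
    obtain s where s: "\<gamma> - (real k * pi)\<^sup>2 = - (s\<^sup>2)" "\<bar>s - real k * pi\<bar> * (s + real k * pi) = \<bar>\<gamma>\<bar>" "0 < s"
       "\<bar>s - real k * pi\<bar> * real k \<le> \<bar>\<gamma>\<bar>" "real k * pi / 2 \<le> s"
      using frequency_shift[OF k] by metis
    define \<eta> where "\<eta> = s - real k * pi"
    have "\<bar>\<eta>\<bar> * (2 * \<bar>\<gamma>\<bar> + 1) \<le> \<bar>\<gamma>\<bar>"
      using s(4) k mult_left_mono[OF k, of "\<bar>\<eta>\<bar>"] by (simp add: \<eta>_def)
    then have "\<bar>\<eta>\<bar> * (2 * \<bar>\<gamma>\<bar> + 1) \<le> 1 * (2 * \<bar>\<gamma>\<bar> + 1)"
      by (rule order_trans) simp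
    then have \<eta>: "\<bar>\<eta>\<bar> \<le> 1" by (rule mult_right_le_imp_le) linarith
    have "sin s = sin (\<eta> + real k * pi)" by (simp add: \<eta>_def)
    also have "\<dots> = sin \<eta> * (- 1) ^ k" by (simp add: sin_add cos_npi sin_npi)
    finally have "\<bar>sin s\<bar> = \<bar>sin \<eta>\<bar>" by (simp add: abs_mult power_abs)
    then have "s * (cos 1 * \<bar>\<eta>\<bar>) \<le> s * \<bar>sin s\<bar>"
      using abs_sin_ge[OF \<eta>] s(3) by simp
    moreover have "\<bar>\<gamma>\<bar> \<le> 3 * (s * \<bar>\<eta>\<bar>)"
      using s(2,5) mult_left_mono[of "s + real k * pi" "3 * s" "\<bar>\<eta>\<bar>"] by (simp add: \<eta>_def mult_ac)
    then have "cos 1 * \<bar>\<gamma>\<bar> \<le> cos 1 * (3 * (s * \<bar>\<eta>\<bar>))" using cos_1_pos by (intro mult_left_mono) auto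
    ultimately have "cos 1 * \<bar>\<gamma>\<bar> / 3 \<le> s * \<bar>sin s\<bar>" by (simp add: mult_ac)
    moreover have "0 < cos 1 * \<bar>\<gamma>\<bar> / 3" using cos_1_pos assms(2) by simp
    ultimately have "inverse (s * \<bar>sin s\<bar>) \<le> inverse (cos 1 * \<bar>\<gamma>\<bar> / 3)" by (rule le_imp_inverse_le)
    then show "\<bar>inverse (snhs (\<gamma> - (real k * pi)\<^sup>2) 1)\<bar> \<le> 3 / (cos 1 * \<bar>\<gamma>\<bar>)"
      using s(1,3) by (simp add: snhs_neg_square abs_mult inverse_eq_divide)
  qed auto
  then show ?thesis by simp
qed

context cascade
begin

lemma lam_diff: "lam a i k - a j = (a i - a j) - (real k * pi)\<^sup>2"
  by (simp add: lam_def power_mult_distrib)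

lemma a_neq: "i \<in> {1..N} \<Longrightarrow> j \<in> {1..N} \<Longrightarrow> i \<noteq> j \<Longrightarrow> a i \<noteq> a j"
  using lam_neq[of i j 0 0] by (simp add: lam_def)

lemma psi_coeff_bounded:
  assumes "i \<in> {1..N}" "j \<in> {i..N}"
  shows "\<exists>C\<ge>0. \<forall>k. \<bar>psi_coeff a i k j\<bar> \<le> C"
proof -
  have "\<exists>C\<ge>0. \<forall>k. \<bar>\<Prod>j'\<in>J. inverse (snhs (lam a i k - a j') 1)\<bar> \<le> C" if "finite J" "J \<subseteq> {i<..N}" for J
    using that
  proof (induction rule: finite_induct)
    case empty
    show ?case by (intro exI[of _ 1]) simp
  next
    case (insert l J)
    obtain C where C: "0 \<le> C" "\<And>k. \<bar>\<Prod>j'\<in>J. inverse (snhs (lam a i k - a j') 1)\<bar> \<le> C"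
      using insert by auto
    have l: "l \<in> {1..N}" "i \<noteq> l" using insert assms by auto
    obtain D where D: "0 \<le> D" "\<And>k. \<bar>inverse (snhs (lam a i k - a l) 1)\<bar> \<le> D"
      using snhs_inverse_bounded[of "a i - a l"] snhs_lam_nonzero[OF assms(1) l] a_neq[OF assms(1) l]
      by (auto simp: lam_diff)
    have "\<bar>inverse (snhs (lam a i k - a l) 1)\<bar> * \<bar>\<Prod>j'\<in>J. inverse (snhs (lam a i k - a j') 1)\<bar> \<le> D * C" for k
      by (intro mult_mono C D) auto
    then show ?case using insert(1,2) C D by (intro exI[of _ "D * C"]) (simp add: abs_mult)
  qed
  moreover have "{i+1..j} \<subseteq> {i<..N}" using assms by auto
  ultimately obtain C where C: "0 \<le> C"
    "\<And>k. \<bar>\<Prod>j'\<in>{i+1..j}. inverse (snhs (lam a i k - a j') 1)\<bar> \<le> C"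
    by (metis finite_atLeastAtMost)
  have "\<bar>psi_coeff a i k j\<bar> \<le> 2 * C" for k
  proof -
    have "\<bar>psi_coeff a i k j\<bar> = \<bar>mu k\<bar> * \<bar>\<Prod>j'\<in>{i+1..j}. inverse (snhs (lam a i k - a j') 1)\<bar>"
      by (simp add: psi_coeff_def abs_mult power_abs prod_inversef[unfolded o_def] divide_inverse)
    also have "\<dots> \<le> 2 * C"
      using C(1) by (intro mult_mono C(2)) (auto simp: mu_def real_le_lsqrt)
    finally show ?thesis .
  qed
  then show ?thesis using C(1) by (intro exI[of _ "2 * C"]) auto
qed

lemma inner_psi_bound:
  assumes ij: "i \<in> {1..N}" "j \<in> {i..N}"
  shows "\<exists>C\<ge>0. \<forall>k f. \<bar>inner f (L2_of (psi a i k j))\<bar> \<le> C * (\<bar>inner f (L2_of (cosf k))\<bar> + norm f / (real k + 1))"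
proof -
  obtain P where P: "0 \<le> P" "\<And>k. \<bar>psi_coeff a i k j\<bar> \<le> P" using psi_coeff_bounded[OF ij] by auto
  obtain A where A: "0 \<le> A" "\<And>k x. x \<in> {0..1} \<Longrightarrow> (real k + 1) * \<bar>chs (lam a i k - a j) x - cos (real k * pi * x)\<bar> \<le> A"
    using chs_asymptotic[of "a i - a j"] by (auto simp: lam_diff)
  have "\<bar>inner f (L2_of (psi a i k j))\<bar> \<le> P * (1 + A) * (\<bar>inner f (L2_of (cosf k))\<bar> + norm f / (real k + 1))" for k f
  proof -
    define h where "h = chs (lam a i k - a j)"
    define e where "e x = cos (real k * pi * x)" for x
    have c: "continuous_on {0..1} h" "continuous_on {0..1} e"
      unfolding h_def e_def by (intro chs_cont continuous_intros)+
    have sq: "square_integrable h" "square_integrable e" using c continuous_square_integrable by blast+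
    have psi: "L2_of (psi a i k j) = psi_coeff a i k j *\<^sub>R L2_of h"
      unfolding L2_of_scale[OF sq(1), symmetric]
      by (rule arg_cong[of _ _ L2_of]) (use ij in \<open>simp add: fun_eq_iff psi_eq h_def\<close>)
    have "norm (L2_of (\<lambda>x. h x - e x)) \<le> A / (real k + 1)"
      using A(2) c by (intro norm_L2_of_le_cont continuous_intros)
        (simp_all add: h_def e_def pos_le_divide_eq mult.commute)
    then have he: "norm (L2_of h - L2_of e) \<le> A / (real k + 1)" by (simp add: L2_of_diff sq)
    have "L2_of (cosf k) = mu k *\<^sub>R L2_of e"
      unfolding L2_of_scale[OF sq(2), symmetric] by (simp add: cosf_def[abs_def] e_def)
    then have "\<bar>inner f (L2_of e)\<bar> * 1 \<le> \<bar>inner f (L2_of (cosf k))\<bar>"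
      by (simp add: abs_mult mu_def mult_le_cancel_right1)
    moreover have "\<bar>inner f (L2_of h - L2_of e)\<bar> \<le> norm f * (A / (real k + 1))"
      using Cauchy_Schwarz_ineq2[of f "L2_of h - L2_of e"] mult_left_mono[OF he, of "norm f"] by simp
    ultimately have "\<bar>inner f (L2_of h)\<bar> \<le> \<bar>inner f (L2_of (cosf k))\<bar> + A * (norm f / (real k + 1))"
      by (simp add: inner_diff_right mult.commute)
    also have "\<dots> \<le> (1 + A) * (\<bar>inner f (L2_of (cosf k))\<bar> + norm f / (real k + 1))"
    proof -
      have "0 \<le> A * \<bar>inner f (L2_of (cosf k))\<bar>" "0 \<le> norm f / (real k + 1)" using A(1) by auto
      then show ?thesis unfolding distrib_left distrib_right mult_1 by linarith
    qed
    finally have "\<bar>psi_coeff a i k j\<bar> * \<bar>inner f (L2_of h)\<bar>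
        \<le> P * ((1 + A) * (\<bar>inner f (L2_of (cosf k))\<bar> + norm f / (real k + 1)))"
      using P by (intro mult_mono) auto
    then show ?thesis by (simp add: psi abs_mult mult.assoc)
  qed
  then show ?thesis using P A by (intro exI[of _ "P * (1 + A)"]) auto
qed

text \<open>As \<open>chs d\<close> is the derivative of \<open>snhs d / d\<close> and \<open>d\<close> is of order \<open>k ^ 2\<close>, integration by parts gains
  \<open>1 / k\<close>: it leaves a sine coefficient of the derivative and terms of order \<open>1 / k\<close>. For the finitely
  many small \<open>k\<close>, where \<open>d\<close> may vanish, the unweighted bound is used.\<close>

lemma inner_psi_weighted_bound:
  assumes ij: "i \<in> {1..N}" "j \<in> {i..N}"
  shows "\<exists>C\<ge>0. \<forall>k. \<forall>f\<in>H1. real k * \<bar>inner f (L2_of (psi a i k j))\<bar>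
    \<le> C * (\<bar>inner (weak_deriv f) (L2_of (sinf k))\<bar> + (norm f + norm (weak_deriv f)) / (real k + 1))"
proof -
  define \<gamma> where "\<gamma> = a i - a j"
  obtain P where P: "0 \<le> P" "\<And>k. \<bar>psi_coeff a i k j\<bar> \<le> P" using psi_coeff_bounded[OF ij] by auto
  obtain A where A: "0 \<le> A" "\<And>k x. x \<in> {0..1} \<Longrightarrow>
      \<bar>snhs (lam a i k - a j) x + real k * pi * sin (real k * pi * x)\<bar> \<le> A"
    using snhs_asymptotic[of \<gamma>] by (auto simp: lam_diff \<gamma>_def)
  obtain C where C: "0 \<le> C" "\<And>k f. \<bar>inner f (L2_of (psi a i k j))\<bar>
      \<le> C * (\<bar>inner f (L2_of (cosf k))\<bar> + norm f / (real k + 1))"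
    using inner_psi_bound[OF ij] by auto
  define K where "K = nat \<lceil>2 * \<bar>\<gamma>\<bar> + 1\<rceil>"
  define D where "D = real K * (real K + 1) * (2 * C) + P * (pi + 4 * A)"
  have parts: "0 \<le> real K * (real K + 1) * (2 * C)" "0 \<le> P * (pi + 4 * A)"
    using C(1) P(1) A(1) pi_ge_zero by (auto intro!: mult_nonneg_nonneg)
  have "real k * \<bar>inner f (L2_of (psi a i k j))\<bar>
    \<le> D * (\<bar>inner (weak_deriv f) (L2_of (sinf k))\<bar> + (norm f + norm (weak_deriv f)) / (real k + 1))"
    (is "?l \<le> D * ?r") if f: "f \<in> H1" for k f
  proof -
    have r0: "0 \<le> ?r" by (intro add_nonneg_nonneg divide_nonneg_nonneg) auto
    show ?thesis
    proof (cases "k < K")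
      case True
      have "\<bar>inner f (L2_of (cosf k))\<bar> \<le> norm f" using l2b_member[OF bessel_cosf] .
      moreover have "norm f / (real k + 1) \<le> norm f" by (simp add: divide_le_eq mult_left_mono algebra_simps)
      ultimately have "\<bar>inner f (L2_of (psi a i k j))\<bar> \<le> C * (2 * norm f)"
        using C(2)[of f k] mult_left_mono[of "\<bar>inner f (L2_of (cosf k))\<bar> + norm f / (real k + 1)" "2 * norm f" C] C(1) by linarith
      then have "?l \<le> real K * (C * (2 * norm f))"
        using True by (intro mult_mono) auto
      also have "norm f = (real k + 1) * (norm f / (real k + 1))" by simp
      also have "\<dots> \<le> (real K + 1) * ?r"
      proof (rule mult_mono)
        have "norm f / (real k + 1) \<le> (norm f + norm (weak_deriv f)) / (real k + 1)"
          by (intro divide_right_mono) auto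
        then show "norm f / (real k + 1) \<le> ?r" by linarith
      qed (use True in auto)
      finally have "?l \<le> real K * (C * (2 * ((real K + 1) * ?r)))"
        using C(1) by (simp add: mult_left_mono)
      also have "\<dots> = real K * (real K + 1) * (2 * C) * ?r" by (simp add: mult_ac)
      also have "\<dots> \<le> D * ?r" using parts r0 by (intro mult_right_mono) (auto simp: D_def)
      finally show ?thesis .
    next
      case False
      then have k: "real k \<ge> 2 * \<bar>\<gamma>\<bar> + 1" unfolding K_def by linarith
      then have k1: "1 \<le> real k" by linarith
      define d where "d = lam a i k - a j"
      obtain s where s: "d = - (s\<^sup>2)" "real k \<le> s"
        using frequency_shift[OF k] by (metis d_def lam_diff \<gamma>_def)
      have k2: "(real k)\<^sup>2 \<le> \<bar>d\<bar>" using s k1 by (simp add: power_mono)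
      have c: "continuous_on {0..1} (snhs d)" "continuous_on {0..1} (chs d)" "continuous_on {0..1} (\<lambda>x. d * chs d x)"
        by (intro snhs_cont chs_cont continuous_intros)+
      have sq: "square_integrable (chs d)" using c continuous_square_integrable by blast
      have psi: "L2_of (psi a i k j) = psi_coeff a i k j *\<^sub>R L2_of (chs d)"
        unfolding L2_of_scale[OF sq, symmetric]
        by (rule arg_cong[of _ _ L2_of]) (use ij in \<open>simp add: fun_eq_iff psi_eq d_def\<close>)
      have ibp: "d * inner f (L2_of (chs d)) = pt f 1 * snhs d 1 - inner (weak_deriv f) (L2_of (snhs d))"
        using H1_by_parts[OF f snhs_deriv c(3)] sq by (simp add: L2_of_scale)
      have "\<bar>snhs d 1\<bar> \<le> A" using A(2)[of 1 k] by (simp add: d_def sin_npi)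
      then have 1: "\<bar>pt f 1 * snhs d 1\<bar> \<le> (norm f + norm (weak_deriv f)) * A"
        unfolding abs_mult by (intro mult_mono H1_pt_le[OF f]) auto
      define e where "e x = - (real k * pi / sqrt 2) * sinf k x" for x
      have ec: "continuous_on {0..1} e" unfolding e_def by (intro continuous_intros)
      have e: "L2_of e = - (real k * pi / sqrt 2) *\<^sub>R L2_of (sinf k)"
        unfolding e_def by (rule L2_of_scale) simp
      have "norm (L2_of (\<lambda>x. snhs d x - e x)) \<le> A"
      proof (intro norm_L2_of_le_cont continuous_intros c ec)
        fix x :: real assume x: "x \<in> {0..1}"
        have "snhs d x - e x = snhs (lam a i k - a j) x + real k * pi * sin (real k * pi * x)"
          by (simp add: e_def sinf_def d_def)
        then show "\<bar>snhs d x - e x\<bar> \<le> A" using A(2)[OF x, of k] by simp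
      qed
      then have "norm (L2_of (snhs d) - L2_of e) \<le> A"
        using c ec by (simp add: L2_of_diff continuous_square_integrable)
      then have "\<bar>inner (weak_deriv f) (L2_of (snhs d) - L2_of e)\<bar> \<le> norm (weak_deriv f) * A"
        using Cauchy_Schwarz_ineq2[of "weak_deriv f" "L2_of (snhs d) - L2_of e"]
          mult_left_mono[of "norm (L2_of (snhs d) - L2_of e)" A "norm (weak_deriv f)"] by simp
      moreover have "\<bar>inner (weak_deriv f) (L2_of e)\<bar> \<le> real k * pi * \<bar>inner (weak_deriv f) (L2_of (sinf k))\<bar>"
      proof -
        have "\<bar>inner (weak_deriv f) (L2_of e)\<bar> = real k * pi / sqrt 2 * \<bar>inner (weak_deriv f) (L2_of (sinf k))\<bar>"
          by (simp add: e abs_mult)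
        also have "\<dots> \<le> real k * pi * \<bar>inner (weak_deriv f) (L2_of (sinf k))\<bar>"
        proof (rule mult_right_mono)
          have "real k * pi / sqrt 2 \<le> real k * pi / 1" by (intro divide_left_mono) auto
          then show "real k * pi / sqrt 2 \<le> real k * pi" by simp
        qed simp
        finally show ?thesis .
      qed
      ultimately have 2: "\<bar>inner (weak_deriv f) (L2_of (snhs d))\<bar>
          \<le> real k * pi * \<bar>inner (weak_deriv f) (L2_of (sinf k))\<bar> + norm (weak_deriv f) * A"
        by (simp add: inner_diff_right)
      have "(real k)\<^sup>2 * \<bar>inner f (L2_of (chs d))\<bar> \<le> \<bar>d\<bar> * \<bar>inner f (L2_of (chs d))\<bar>"
        using k2 by (intro mult_right_mono) auto
      also have "\<dots> \<le> real k * pi * \<bar>inner (weak_deriv f) (L2_of (sinf k))\<bar> + 2 * A * (norm f + norm (weak_deriv f))"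
      proof -
        have "0 \<le> A * norm f" using A(1) by simp
        then show ?thesis using 1 2 unfolding abs_mult[symmetric] ibp by (simp add: algebra_simps)
      qed
      also have "\<dots> = real k * (pi * \<bar>inner (weak_deriv f) (L2_of (sinf k))\<bar> + 2 * A * (norm f + norm (weak_deriv f)) / real k)"
      proof -
        have "real k * (u + z / real k) = real k * u + z" for u z using k1 by (simp add: field_simps)
        then show ?thesis by (simp only: mult.assoc)
      qed
      finally have "real k * (real k * \<bar>inner f (L2_of (chs d))\<bar>)
          \<le> real k * (pi * \<bar>inner (weak_deriv f) (L2_of (sinf k))\<bar> + 2 * A * (norm f + norm (weak_deriv f)) / real k)"
        by (simp only: power2_eq_square mult.assoc)
      then have "real k * \<bar>inner f (L2_of (chs d))\<bar>
          \<le> pi * \<bar>inner (weak_deriv f) (L2_of (sinf k))\<bar> + 2 * A * (norm f + norm (weak_deriv f)) / real k"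
        using k1 by (simp add: mult_le_cancel_left)
      also have "2 * A * (norm f + norm (weak_deriv f)) / real k
          \<le> 4 * A * ((norm f + norm (weak_deriv f)) / (real k + 1))"
      proof -
        have "1 / real k \<le> 2 / (real k + 1)" using k1 by (simp add: field_simps)
        then have "2 * A * (norm f + norm (weak_deriv f)) * (1 / real k)
            \<le> 2 * A * (norm f + norm (weak_deriv f)) * (2 / (real k + 1))"
          using A(1) by (intro mult_left_mono) auto
        then show ?thesis by simp
      qed
      also have "pi * \<bar>inner (weak_deriv f) (L2_of (sinf k))\<bar> + 4 * A * ((norm f + norm (weak_deriv f)) / (real k + 1))
          \<le> (pi + 4 * A) * ?r"
        using A(1) pi_ge_zero unfolding distrib_left distrib_right by (simp add: mult_nonneg_nonneg)
      finally have "real k * \<bar>inner f (L2_of (chs d))\<bar> \<le> (pi + 4 * A) * ?r" by simp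
      then have "\<bar>psi_coeff a i k j\<bar> * (real k * \<bar>inner f (L2_of (chs d))\<bar>) \<le> P * ((pi + 4 * A) * ?r)"
        by (intro mult_mono[OF P(2)]) (use P in auto)
      then have "?l \<le> P * (pi + 4 * A) * ?r" by (simp add: psi abs_mult mult_ac)
      also have "\<dots> \<le> D * ?r" using parts r0 by (intro mult_right_mono) (auto simp: D_def)
      finally show ?thesis .
    qed
  qed
  then show ?thesis using parts by (intro exI[of _ D]) (auto simp: D_def)
qed

end

section \<open>The eigenfunctions form a Riesz basis\<close>

lemma uniform_factor:
  fixes f g :: "'i \<Rightarrow> 'x \<Rightarrow> real"
  assumes "finite I" "\<And>i. i \<in> I \<Longrightarrow> \<exists>C\<ge>0. \<forall>x\<in>X. f i x \<le> C * g i x" "\<And>i x. 0 \<le> g i x"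
  shows "\<exists>C\<ge>0. \<forall>i\<in>I. \<forall>x\<in>X. f i x \<le> C * g i x"
proof -
  obtain c where c: "\<And>i. i \<in> I \<Longrightarrow> 0 \<le> c i" "\<And>i x. i \<in> I \<Longrightarrow> x \<in> X \<Longrightarrow> f i x \<le> c i * g i x"
    using assms(2) by metis
  show ?thesis
  proof (intro exI[of _ "\<Sum>i\<in>I. c i"] conjI ballI)
    show "0 \<le> (\<Sum>i\<in>I. c i)" using c by (intro sum_nonneg) auto
    fix i x assume i: "i \<in> I" and x: "x \<in> X"
    have "c i \<le> (\<Sum>i\<in>I. c i)" using assms(1) c i by (intro member_le_sum) auto
    then have "c i * g i x \<le> (\<Sum>i\<in>I. c i) * g i x" using assms(3) by (intro mult_right_mono)
    then show "f i x \<le> (\<Sum>i\<in>I. c i) * g i x" using c(2)[OF i x] by linarith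
  qed
qed

lemma norm_H0_bounds:
  "j \<in> {1..N} \<Longrightarrow> norm (y j) \<le> norm_H0 N y" "norm_H0 N y \<le> (\<Sum>j=1..N. norm (y j))"
proof -
  have eq: "norm_H0 N y = L2_set (\<lambda>j. norm (y j)) {1..N}" by (simp add: norm_H0_def L2_set_def)
  show "j \<in> {1..N} \<Longrightarrow> norm (y j) \<le> norm_H0 N y"
    unfolding eq by (rule member_le_L2_set[of _ _ "\<lambda>j. norm (y j)"]) auto
  show "norm_H0 N y \<le> (\<Sum>j=1..N. norm (y j))"
    unfolding eq by (rule L2_set_le_sum) auto
qed

lemma norm_H1_bounds:
  "j \<in> {1..N} \<Longrightarrow> norm (y j) + norm (weak_deriv (y j)) \<le> 2 * norm_H1 N y"
  "norm_H1 N y \<le> (\<Sum>j=1..N. norm (y j) + norm (weak_deriv (y j)))" "norm_H0 N y \<le> norm_H1 N y"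
proof -
  show "norm_H0 N y \<le> norm_H1 N y"
    unfolding norm_H0_def norm_H1_def by (intro real_sqrt_le_mono sum_mono) auto
  have eq: "norm_H1 N y = L2_set (\<lambda>j. sqrt ((norm (y j))\<^sup>2 + (norm (weak_deriv (y j)))\<^sup>2)) {1..N}"
    by (simp add: norm_H1_def L2_set_def)
  show "norm (y j) + norm (weak_deriv (y j)) \<le> 2 * norm_H1 N y" if "j \<in> {1..N}"
  proof -
    have "sqrt ((norm (y j))\<^sup>2 + (norm (weak_deriv (y j)))\<^sup>2) \<le> norm_H1 N y"
      unfolding eq using that
      by (intro member_le_L2_set[of _ _ "\<lambda>j. sqrt ((norm (y j))\<^sup>2 + (norm (weak_deriv (y j)))\<^sup>2)"]) auto
    moreover have "norm (y j) \<le> sqrt ((norm (y j))\<^sup>2 + (norm (weak_deriv (y j)))\<^sup>2)"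
      "norm (weak_deriv (y j)) \<le> sqrt ((norm (y j))\<^sup>2 + (norm (weak_deriv (y j)))\<^sup>2)"
      by (auto intro!: real_le_rsqrt)
    ultimately show ?thesis by linarith
  qed
  have "norm_H1 N y \<le> (\<Sum>j=1..N. sqrt ((norm (y j))\<^sup>2 + (norm (weak_deriv (y j)))\<^sup>2))"
    unfolding eq by (rule L2_set_le_sum) auto
  also have "\<dots> \<le> (\<Sum>j=1..N. norm (y j) + norm (weak_deriv (y j)))"
    by (intro sum_mono sqrt_sum_squares_le_sum) auto
  finally show "norm_H1 N y \<le> (\<Sum>j=1..N. norm (y j) + norm (weak_deriv (y j)))" .
qed

context cascade
begin

lemma inner_psi_l2b: "\<exists>C\<ge>0. \<forall>i\<in>{1..N}. \<forall>j\<in>{i..N}. \<forall>f. l2b (\<lambda>k. inner f (L2_of (psi a i k j))) (C * norm f)"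
proof -
  define I where "I = (SIGMA i:{1..N}. {i..N})"
  have "\<exists>C\<ge>0. \<forall>p\<in>I. \<forall>x\<in>UNIV. (case p of (i, j) \<Rightarrow> case x of (k, f) \<Rightarrow> \<bar>inner f (L2_of (psi a i k j))\<bar>)
      \<le> C * (case x of (k, f) \<Rightarrow> \<bar>inner f (L2_of (cosf k))\<bar> + norm f / (real k + 1))"
    using inner_psi_bound by (intro uniform_factor) (auto simp: I_def)
  then obtain C where C: "0 \<le> C" "\<And>i j k f. i \<in> {1..N} \<Longrightarrow> j \<in> {i..N} \<Longrightarrow>
      \<bar>inner f (L2_of (psi a i k j))\<bar> \<le> C * (\<bar>inner f (L2_of (cosf k))\<bar> + norm f / (real k + 1))"
    by (fastforce simp: I_def)
  have "l2b (\<lambda>k. inner f (L2_of (psi a i k j))) (3 * C * norm f)" if "i \<in> {1..N}" "j \<in> {i..N}" for i j f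
  proof (rule l2b_mono)
    have "l2b (\<lambda>k. \<bar>inner f (L2_of (cosf k))\<bar>) (norm f)"
      by (rule l2b_mono[OF bessel_cosf[of f]]) auto
    moreover have "l2b (\<lambda>k. norm f * (1 / (real k + 1))) (\<bar>norm f\<bar> * 2)"
      by (intro l2b_scale l2b_harmonic)
    ultimately show "l2b (\<lambda>k. C * (\<bar>inner f (L2_of (cosf k))\<bar> + norm f * (1 / (real k + 1)))) (\<bar>C\<bar> * (norm f + \<bar>norm f\<bar> * 2))"
      by (rule l2b_scale[OF l2b_add])
    show "\<bar>inner f (L2_of (psi a i k j))\<bar> \<le> \<bar>C * (\<bar>inner f (L2_of (cosf k))\<bar> + norm f * (1 / (real k + 1)))\<bar>" for k
      using C(2)[OF that, of f k] C(1) by simp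
  qed (use C(1) in auto)
  then show ?thesis using C(1) by (intro exI[of _ "3 * C"]) auto
qed

lemma inner_psi_weighted_l2b:
  "\<exists>C\<ge>0. \<forall>i\<in>{1..N}. \<forall>j\<in>{i..N}. \<forall>f\<in>H1. l2b (\<lambda>k. real k * inner f (L2_of (psi a i k j))) (C * (norm f + norm (weak_deriv f)))"
proof -
  define I where "I = (SIGMA i:{1..N}. {i..N})"
  have "\<exists>C\<ge>0. \<forall>p\<in>I. \<forall>x\<in>UNIV \<times> H1. (case p of (i, j) \<Rightarrow> case x of (k, f) \<Rightarrow> real k * \<bar>inner f (L2_of (psi a i k j))\<bar>)
      \<le> C * (case x of (k, f) \<Rightarrow> \<bar>inner (weak_deriv f) (L2_of (sinf k))\<bar> + (norm f + norm (weak_deriv f)) / (real k + 1))"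
    using inner_psi_weighted_bound by (intro uniform_factor) (auto simp: I_def)
  then obtain C where C: "0 \<le> C" "\<And>i j k f. i \<in> {1..N} \<Longrightarrow> j \<in> {i..N} \<Longrightarrow> f \<in> H1 \<Longrightarrow>
      real k * \<bar>inner f (L2_of (psi a i k j))\<bar> \<le>
      C * (\<bar>inner (weak_deriv f) (L2_of (sinf k))\<bar> + (norm f + norm (weak_deriv f)) / (real k + 1))"
    by (fastforce simp: I_def)
  have "l2b (\<lambda>k. real k * inner f (L2_of (psi a i k j))) (3 * C * (norm f + norm (weak_deriv f)))"
    if "i \<in> {1..N}" "j \<in> {i..N}" "f \<in> H1" for i j f
  proof (rule l2b_mono)
    define S where "S = norm f + norm (weak_deriv f)"
    have S: "0 \<le> S" by (simp add: S_def)
    have "l2b (\<lambda>k. \<bar>inner (weak_deriv f) (L2_of (sinf k))\<bar>) S"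
      by (rule l2b_mono[OF bessel_sinf[of "weak_deriv f"]]) (auto simp: S_def)
    moreover have "l2b (\<lambda>k. S * (1 / (real k + 1))) (\<bar>S\<bar> * 2)"
      by (intro l2b_scale l2b_harmonic)
    ultimately show "l2b (\<lambda>k. C * (\<bar>inner (weak_deriv f) (L2_of (sinf k))\<bar> + S * (1 / (real k + 1)))) (\<bar>C\<bar> * (S + \<bar>S\<bar> * 2))"
      by (rule l2b_scale[OF l2b_add])
    show "\<bar>real k * inner f (L2_of (psi a i k j))\<bar> \<le> \<bar>C * (\<bar>inner (weak_deriv f) (L2_of (sinf k))\<bar> + S * (1 / (real k + 1)))\<bar>" for k
      using C(2)[OF that, of k] C(1) S by (simp add: S_def abs_mult)
    show "\<bar>C\<bar> * (S + \<bar>S\<bar> * 2) \<le> 3 * C * (norm f + norm (weak_deriv f))"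
      using C(1) S unfolding S_def[symmetric] by simp
  qed
  then show ?thesis using C(1) by (intro exI[of _ "3 * C"]) auto
qed

theorem coef_bessel: "\<exists>C\<ge>0. \<forall>i\<in>{1..N}. \<forall>f. l2b (\<lambda>k. coef N a i k f) (C * (\<Sum>j=1..N. norm (f j)))"
proof -
  obtain C where C: "0 \<le> C" "\<And>i j f. i \<in> {1..N} \<Longrightarrow> j \<in> {i..N} \<Longrightarrow>
      l2b (\<lambda>k. inner f (L2_of (psi a i k j))) (C * norm f)"
    using inner_psi_l2b by auto
  have "l2b (\<lambda>k. coef N a i k f) (C * (\<Sum>j=1..N. norm (f j)))" if i: "i \<in> {1..N}" for i f
  proof (rule l2b_mono)
    show "l2b (\<lambda>k. \<Sum>j\<in>{i..N}. inner (f j) (L2_of (psi a i k j))) (\<Sum>j\<in>{i..N}. C * norm (f j))"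
      using C(2)[OF i] by (intro l2b_sum) auto
    show "(\<Sum>j\<in>{i..N}. C * norm (f j)) \<le> C * (\<Sum>j=1..N. norm (f j))"
      unfolding sum_distrib_left using C(1) i by (intro sum_mono2) auto
  qed (simp add: coef_triangular[OF i])
  then show ?thesis using C(1) by auto
qed

theorem coef_bessel_H1:
  "\<exists>C\<ge>0. \<forall>i\<in>{1..N}. \<forall>f. (\<forall>j\<in>{1..N}. f j \<in> H1) \<longrightarrow>
    l2b (\<lambda>k. real k * coef N a i k f) (C * (\<Sum>j=1..N. norm (f j) + norm (weak_deriv (f j))))"
proof -
  obtain C where C: "0 \<le> C" "\<And>i j f. i \<in> {1..N} \<Longrightarrow> j \<in> {i..N} \<Longrightarrow> f \<in> H1 \<Longrightarrow>
      l2b (\<lambda>k. real k * inner f (L2_of (psi a i k j))) (C * (norm f + norm (weak_deriv f)))"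
    using inner_psi_weighted_l2b by auto
  have "l2b (\<lambda>k. real k * coef N a i k f) (C * (\<Sum>j=1..N. norm (f j) + norm (weak_deriv (f j))))"
    if i: "i \<in> {1..N}" and f: "\<forall>j\<in>{1..N}. f j \<in> H1" for i f
  proof (rule l2b_mono)
    show "l2b (\<lambda>k. \<Sum>j\<in>{i..N}. real k * inner (f j) (L2_of (psi a i k j))) (\<Sum>j\<in>{i..N}. C * (norm (f j) + norm (weak_deriv (f j))))"
      using C(2)[OF i] f i by (intro l2b_sum) auto
    show "(\<Sum>j\<in>{i..N}. C * (norm (f j) + norm (weak_deriv (f j)))) \<le> C * (\<Sum>j=1..N. norm (f j) + norm (weak_deriv (f j)))"
      unfolding sum_distrib_left using C(1) i by (intro sum_mono2) auto
  qed (simp add: coef_triangular[OF i] sum_distrib_left)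
  then show ?thesis using C(1) by auto
qed

text \<open>The coefficient with index \<open>i\<close> is the cosine coefficient of \<open>f i\<close> plus contributions of the later
  components, which the induction has already bounded.\<close>

lemma riesz_lower_component:
  "i \<in> {1..N} \<Longrightarrow> \<exists>D\<ge>0. \<forall>f R. (\<forall>i\<in>{1..N}. l2b (\<lambda>k. coef N a i k f) R) \<longrightarrow> norm (f i) \<le> D * R"
proof (induction "N - i" arbitrary: i rule: less_induct)
  case less
  note i = less(2)
  obtain C where C: "0 \<le> C" "\<And>i j f. i \<in> {1..N} \<Longrightarrow> j \<in> {i..N} \<Longrightarrow>
      l2b (\<lambda>k. inner f (L2_of (psi a i k j))) (C * norm f)"
    using inner_psi_l2b by auto
  have "\<exists>D\<ge>0. \<forall>f R. (\<forall>i\<in>{1..N}. l2b (\<lambda>k. coef N a i k f) R) \<longrightarrow> norm (f j) \<le> D * R" if "j \<in> {i<..N}" for j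
    using that i by (intro less(1)) auto
  then obtain D where D: "\<And>j. j \<in> {i<..N} \<Longrightarrow> 0 \<le> D j" "\<And>j f R. j \<in> {i<..N} \<Longrightarrow>
      (\<forall>i\<in>{1..N}. l2b (\<lambda>k. coef N a i k f) R) \<Longrightarrow> norm (f j) \<le> D j * R"
    by metis
  show ?case
  proof (intro exI[of _ "1 + (\<Sum>j\<in>{i<..N}. C * D j)"] conjI allI impI)
    show "0 \<le> 1 + (\<Sum>j\<in>{i<..N}. C * D j)"
      using C(1) D(1) by (intro add_nonneg_nonneg sum_nonneg) auto
    fix f R assume R: "\<forall>i\<in>{1..N}. l2b (\<lambda>k. coef N a i k f) R"
    have eq: "inner (f i) (L2_of (cosf k)) = coef N a i k f + (-1) * (\<Sum>j\<in>{i<..N}. inner (f j) (L2_of (psi a i k j)))" for k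
      by (simp add: coef_head[OF i])
    have "l2b (\<lambda>k. inner (f i) (L2_of (cosf k))) (R + \<bar>-1\<bar> * (\<Sum>j\<in>{i<..N}. C * norm (f j)))"
      unfolding eq using R i by (intro l2b_add l2b_scale l2b_sum C(2)) auto
    then have "norm (f i) \<le> R + (\<Sum>j\<in>{i<..N}. C * norm (f j))"
      by (intro cosf_parseval_le) simp
    also have "\<dots> \<le> R + (\<Sum>j\<in>{i<..N}. C * (D j * R))"
      using D(2)[OF _ R] C(1) by (intro add_left_mono sum_mono mult_left_mono)
    finally show "norm (f i) \<le> (1 + (\<Sum>j\<in>{i<..N}. C * D j)) * R"
      by (simp add: distrib_right sum_distrib_right mult.assoc)
  qed
qed

theorem riesz_lower:
  "\<exists>D\<ge>0. \<forall>f R. (\<forall>i\<in>{1..N}. l2b (\<lambda>k. coef N a i k f) R) \<longrightarrow> (\<forall>j\<in>{1..N}. norm (f j) \<le> D * R)"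
proof -
  have "\<exists>D\<ge>0. \<forall>j\<in>{1..N}. \<forall>x\<in>{(f, R). \<forall>i\<in>{1..N}. l2b (\<lambda>k. coef N a i k f) R}.
      (case x of (f, R) \<Rightarrow> norm (f j)) \<le> D * (case x of (f, R) \<Rightarrow> \<bar>R\<bar>)"
  proof (rule uniform_factor)
    fix j assume "j \<in> {1..N}"
    from riesz_lower_component[OF this] obtain D where D: "0 \<le> D"
      "\<And>f R. \<forall>i\<in>{1..N}. l2b (\<lambda>k. coef N a i k f) R \<Longrightarrow> norm (f j) \<le> D * R" by auto
    have "norm (f j) \<le> D * \<bar>R\<bar>" if "\<forall>i\<in>{1..N}. l2b (\<lambda>k. coef N a i k f) R" for f R
      using D(2)[OF that] mult_left_mono[of R "\<bar>R\<bar>" D] D(1) by linarith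
    then show "\<exists>D\<ge>0. \<forall>x\<in>{(f, R). \<forall>i\<in>{1..N}. l2b (\<lambda>k. coef N a i k f) R}.
      (case x of (f, R) \<Rightarrow> norm (f j)) \<le> D * (case x of (f, R) \<Rightarrow> \<bar>R\<bar>)"
      using D(1) by auto
  qed auto
  then obtain D where D: "0 \<le> D" "\<And>f R j. \<forall>i\<in>{1..N}. l2b (\<lambda>k. coef N a i k f) R \<Longrightarrow> j \<in> {1..N} \<Longrightarrow> norm (f j) \<le> D * \<bar>R\<bar>"
    by fastforce
  have "0 \<le> R" if "\<forall>i\<in>{1..N}. l2b (\<lambda>k. coef N a i k f) R" for f R
    using that N l2b_nonneg by (meson atLeastAtMost_iff order_refl)
  then show ?thesis using D by (intro exI[of _ D]) (metis abs_of_nonneg)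
qed

text \<open>The recursion of \<open>riesz_lower_component\<close> with the weight \<open>k\<close>; it also yields membership in \<open>H1\<close>, which
  the contributions of the later components require.\<close>

lemma riesz_lower_H1_component:
  "i \<in> {1..N} \<Longrightarrow> \<exists>D\<ge>0. \<forall>f R. (\<forall>i\<in>{1..N}. l2b (\<lambda>k. coef N a i k f) R \<and> l2b (\<lambda>k. real k * coef N a i k f) R) \<longrightarrow>
    f i \<in> H1 \<and> norm (f i) + norm (weak_deriv (f i)) \<le> D * R"
proof (induction "N - i" arbitrary: i rule: less_induct)
  case less
  note i = less(2)
  define H where "H f R \<longleftrightarrow> (\<forall>i\<in>{1..N}. l2b (\<lambda>k. coef N a i k f) R \<and> l2b (\<lambda>k. real k * coef N a i k f) R)" for f R
  obtain C where C: "0 \<le> C" "\<And>i j f. i \<in> {1..N} \<Longrightarrow> j \<in> {i..N} \<Longrightarrow> f \<in> H1 \<Longrightarrow>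
      l2b (\<lambda>k. real k * inner f (L2_of (psi a i k j))) (C * (norm f + norm (weak_deriv f)))"
    using inner_psi_weighted_l2b by auto
  obtain D0 where D0: "0 \<le> D0" "\<And>f R. H f R \<Longrightarrow> norm (f i) \<le> D0 * R"
    using riesz_lower_component[OF i] by (auto simp: H_def)
  have "\<exists>D\<ge>0. \<forall>f R. H f R \<longrightarrow> f j \<in> H1 \<and> norm (f j) + norm (weak_deriv (f j)) \<le> D * R" if "j \<in> {i<..N}" for j
    unfolding H_def using that i by (intro less(1)) auto
  then obtain D where D: "\<And>j. j \<in> {i<..N} \<Longrightarrow> 0 \<le> D j"
      "\<And>j f R. j \<in> {i<..N} \<Longrightarrow> H f R \<Longrightarrow> f j \<in> H1"
      "\<And>j f R. j \<in> {i<..N} \<Longrightarrow> H f R \<Longrightarrow> norm (f j) + norm (weak_deriv (f j)) \<le> D j * R"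
    by metis
  have "\<exists>D\<ge>0. \<forall>f R. H f R \<longrightarrow> f i \<in> H1 \<and> norm (f i) + norm (weak_deriv (f i)) \<le> D * R"
  proof (intro exI[of _ "D0 + pi * (1 + (\<Sum>j\<in>{i<..N}. C * D j))"] conjI allI impI)
    show "0 \<le> D0 + pi * (1 + (\<Sum>j\<in>{i<..N}. C * D j))"
      using C(1) D(1) D0(1) pi_ge_zero by (intro add_nonneg_nonneg mult_nonneg_nonneg sum_nonneg) auto
    fix f R assume R: "H f R"
    have eq: "real k * inner (f i) (L2_of (cosf k)) = real k * coef N a i k f
        + (-1) * (\<Sum>j\<in>{i<..N}. real k * inner (f j) (L2_of (psi a i k j)))" for k
      by (simp add: coef_head[OF i] distrib_left sum_distrib_left sum_negf)
    have w: "l2b (\<lambda>k. real k * inner (f i) (L2_of (cosf k)))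
        (R + \<bar>-1\<bar> * (\<Sum>j\<in>{i<..N}. C * (norm (f j) + norm (weak_deriv (f j)))))"
      unfolding eq using R i D(2)[OF _ R] by (intro l2b_add l2b_scale l2b_sum C(2)) (auto simp: H_def)
    show "f i \<in> H1" by (rule H1_if_cosf_weighted[OF w])
    have "norm (weak_deriv (f i)) \<le> pi * (R + (\<Sum>j\<in>{i<..N}. C * (norm (f j) + norm (weak_deriv (f j)))))"
      using H1_if_cosf_weighted(2)[OF w] by simp
    also have "\<dots> \<le> pi * (R + (\<Sum>j\<in>{i<..N}. C * (D j * R)))"
      using D(3)[OF _ R] C(1) pi_ge_zero by (intro mult_left_mono add_left_mono sum_mono)
    also have "\<dots> = pi * (1 + (\<Sum>j\<in>{i<..N}. C * D j)) * R"
      by (simp add: distrib_right sum_distrib_right mult.assoc)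
    finally show "norm (f i) + norm (weak_deriv (f i)) \<le> (D0 + pi * (1 + (\<Sum>j\<in>{i<..N}. C * D j))) * R"
      using D0(2)[OF R] by (simp add: distrib_right)
  qed
  then show ?case by (simp add: H_def)
qed

theorem riesz_lower_H1:
  "\<exists>D\<ge>0. \<forall>f R. (\<forall>i\<in>{1..N}. l2b (\<lambda>k. coef N a i k f) R \<and> l2b (\<lambda>k. real k * coef N a i k f) R) \<longrightarrow>
    (\<forall>j\<in>{1..N}. f j \<in> H1 \<and> norm (f j) + norm (weak_deriv (f j)) \<le> D * R)"
proof -
  define H where "H f R \<longleftrightarrow> (\<forall>i\<in>{1..N}. l2b (\<lambda>k. coef N a i k f) R \<and> l2b (\<lambda>k. real k * coef N a i k f) R)" for f R
  have comp: "\<exists>D\<ge>0. \<forall>f R. H f R \<longrightarrow> f j \<in> H1 \<and> norm (f j) + norm (weak_deriv (f j)) \<le> D * R" if "j \<in> {1..N}" for j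
    unfolding H_def by (rule riesz_lower_H1_component[OF that])
  have "\<exists>D\<ge>0. \<forall>j\<in>{1..N}. \<forall>x\<in>{(f, R). H f R}.
      (case x of (f, R) \<Rightarrow> norm (f j) + norm (weak_deriv (f j))) \<le> D * (case x of (f, R) \<Rightarrow> \<bar>R\<bar>)"
  proof (rule uniform_factor)
    fix j assume "j \<in> {1..N}"
    from comp[OF this] obtain D where D: "0 \<le> D"
      "\<And>f R. H f R \<Longrightarrow> norm (f j) + norm (weak_deriv (f j)) \<le> D * R" by auto
    have "norm (f j) + norm (weak_deriv (f j)) \<le> D * \<bar>R\<bar>" if "H f R" for f R
      using D(2)[OF that] mult_left_mono[of R "\<bar>R\<bar>" D] D(1) by linarith
    then show "\<exists>D\<ge>0. \<forall>x\<in>{(f, R). H f R}.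
      (case x of (f, R) \<Rightarrow> norm (f j) + norm (weak_deriv (f j))) \<le> D * (case x of (f, R) \<Rightarrow> \<bar>R\<bar>)"
      using D(1) by auto
  qed auto
  then obtain D where D: "0 \<le> D" "\<And>f R j. H f R \<Longrightarrow> j \<in> {1..N} \<Longrightarrow> norm (f j) + norm (weak_deriv (f j)) \<le> D * \<bar>R\<bar>"
    by fastforce
  have nn: "0 \<le> R" if "H f R" for f R
    using that N l2b_nonneg unfolding H_def by (meson atLeastAtMost_iff order_refl)
  have "f j \<in> H1 \<and> norm (f j) + norm (weak_deriv (f j)) \<le> D * R" if "H f R" "j \<in> {1..N}" for f R j
    using comp[OF that(2)] D(2)[OF that] nn[OF that(1)] that(1) by auto
  then show ?thesis using D(1) unfolding H_def by blast
qed

end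

section \<open>Modal equations\<close>

lemma coef_cong: "(\<And>j. j \<in> {1..N} \<Longrightarrow> f j = g j) \<Longrightarrow> coef N a i k f = coef N a i k g"
  unfolding coef_def by (intro sum.cong) auto

lemma at_within_Icc_Ici:
  fixes t T :: real
  assumes "t < T"
  shows "at t within {0..T} = at t within {0..}"
  by (rule at_within_nhd[of _ "{..<T}"]) (use assms in auto)

text \<open>A mild solution satisfies the equation in integrated form only. Paired with \<open>psi\<close> this becomes a scalar
  integral equation with continuous data, which can be differentiated.\<close>

lemma (in cascade) modal_ode:
  assumes sol: "cascade_mild_solution N a u y" and i: "i \<in> {1..N}"
    and u: "\<And>t. 0 \<le> t \<Longrightarrow> (u has_real_derivative v t) (at t within {0..})" and t: "0 \<le> t"
  shows "((\<lambda>s. coef N a i k (lifted (y s) (u s))) has_real_derivative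
     lam a i k * coef N a i k (lifted (y t) (u t)) + alpha N a i k * u t + beta N a i k * v t)
     (at t within {0..})"
proof -
  define q where "q s = coef N a i k (y s)" for s
  define p where "p = psi_coeff a i k N"
  have qc: "continuous_on {0..} q"
    unfolding q_def coef_def
    using sol by (intro continuous_intros) (auto simp: cascade_mild_solution_def)
  have uc: "continuous_on {0..} u" using sol by (auto simp: cascade_mild_solution_def)
  have q_eq: "q s = q 0 + (lam a i k * integral {0..s} q - p * integral {0..s} u)" if s: "0 \<le> s" for s
  proof -
    obtain Y where Y: "\<And>j. j \<in> {1..N} \<Longrightarrow> ((\<lambda>s. y s j) has_integral Y j) {0..s}"
      "cascade_dom N Y (integral {0..s} u)" "\<And>j. j \<in> {1..N} \<Longrightarrow> y s j = y 0 j + cascade_op a Y j"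
      using sol s unfolding cascade_mild_solution_def by blast
    have "(q has_integral coef N a i k Y) {0..s}"
      unfolding q_def coef_def
    proof (rule has_integral_sum)
      fix j assume "j \<in> {1..N}"
      from has_integral_linear[OF Y(1)[OF this] bounded_linear_inner_left[of "L2_of (psi a i k j)"]]
      show "((\<lambda>s. inner (y s j) (L2_of (psi a i k j))) has_integral inner (Y j) (L2_of (psi a i k j))) {0..s}"
        by (simp add: o_def)
    qed simp
    then have "coef N a i k Y = integral {0..s} q" by (simp add: integral_unique)
    moreover have "q s = q 0 + coef N a i k (cascade_op a Y)"
      unfolding q_def coef_add[symmetric] by (intro coef_cong Y(3))
    ultimately show ?thesis
      using green[OF Y(2) i, of k] by (simp add: p_def mult.commute)
  qed
  define T where "T = t + 1"
  have tT: "t \<in> {0..T}" "t < T" using t by (auto simp: T_def)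
  have qc': "continuous_on {0..T} q" and uc': "continuous_on {0..T} u"
    using qc uc continuous_on_subset[of "{0..}" _ "{0..T}"] by auto
  have "((\<lambda>s. q 0 + (lam a i k * integral {0..s} q - p * integral {0..s} u)) has_real_derivative
      lam a i k * q t - p * u t) (at t within {0..T})"
    using integral_has_real_derivative[OF qc' tT(1)] integral_has_real_derivative[OF uc' tT(1)]
    by (auto intro!: derivative_eq_intros)
  then have "(q has_real_derivative lam a i k * q t - p * u t) (at t within {0..T})"
    by (rule has_field_derivative_transform_within[where d = 1]) (use tT in \<open>auto intro!: q_eq[symmetric]\<close>)
  then have dq: "(q has_real_derivative lam a i k * q t - p * u t) (at t within {0..})"
    by (simp add: at_within_Icc_Ici[OF tT(2)])
  have w: "coef N a i k (lifted (y s) (u s)) = q s + beta N a i k * u s" for s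
    by (simp add: coef_diff coef_scale q_def beta_coef)
  have "((\<lambda>s. q s + beta N a i k * u s) has_real_derivative
      (lam a i k * q t - p * u t) + beta N a i k * v t) (at t within {0..})"
    by (intro DERIV_add DERIV_cmult dq u t)
  then show ?thesis
    unfolding w by (rule DERIV_cong) (simp add: alpha_beta[OF i] p_def algebra_simps)
qed

section \<open>The finite-dimensional matrices in modal coordinates\<close>

text \<open>The order in which \<open>stack\<close> and \<open>A1\<close> list the head modes.\<close>

definition mode_list :: "nat \<Rightarrow> (nat \<Rightarrow> nat) \<Rightarrow> (nat \<times> nat) list" where
  "mode_list N n0 = concat (map (\<lambda>i. map (Pair i) [0..<n0 i]) [1..<Suc N])"

lemma length_mode_list: "length (mode_list N n0) = dim0 N n0"
proof -
  have "length (mode_list N n0) = sum_list (map n0 [1..<Suc N])"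
    by (simp add: mode_list_def length_concat o_def)
  also have "\<dots> = dim0 N n0"
    by (simp only: sum_list_distinct_conv_sum_set distinct_upt set_upt dim0_def atLeastLessThanSuc_atLeastAtMost)
  finally show ?thesis .
qed

lemma set_mode_list: "set (mode_list N n0) = (SIGMA i:{1..N}. {..<n0 i})"
  by (auto simp: mode_list_def)

lemma distinct_mode_list: "distinct (mode_list N n0)"
proof -
  have "distinct (concat (map (\<lambda>i. map (Pair i) [0..<n0 i]) is))" if "distinct is" for "is" :: "nat list"
    using that by (induction "is") (auto simp: distinct_map inj_on_def)
  then show ?thesis by (simp add: mode_list_def)
qed

lemma stack_mode_list: "stack N n0 f = vec_of_list (map (\<lambda>(i, k). f i k) (mode_list N n0))"
  by (simp add: stack_def mode_list_def map_concat o_def)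

lemma stack_index:
  assumes "p < dim0 N n0"
  shows "stack N n0 f $ p = f (fst (mode_list N n0 ! p)) (snd (mode_list N n0 ! p))"
  using assms by (simp add: stack_mode_list length_mode_list case_prod_beta vec_of_list_index)

lemma dim_stack [simp]: "dim_vec (stack N n0 f) = dim0 N n0"
  by (simp add: stack_mode_list length_mode_list)

lemma sum_mode_list:
  "(\<Sum>p<dim0 N n0. g (fst (mode_list N n0 ! p)) (snd (mode_list N n0 ! p))) = (\<Sum>i=1..N. \<Sum>k<n0 i. g i k)"
proof -
  have "(\<Sum>p<dim0 N n0. g (fst (mode_list N n0 ! p)) (snd (mode_list N n0 ! p)))
      = sum_list (map (\<lambda>x. g (fst x) (snd x)) (mode_list N n0))"
    by (simp add: sum_list_sum_nth length_mode_list atLeast0LessThan)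
  also have "\<dots> = (\<Sum>x\<in>(SIGMA i:{1..N}. {..<n0 i}). g (fst x) (snd x))"
    by (simp only: sum_list_distinct_conv_sum_set[OF distinct_mode_list] set_mode_list)
  also have "\<dots> = (\<Sum>i=1..N. \<Sum>k<n0 i. g i k)"
    by (subst sum.Sigma) (auto simp: case_prod_beta)
  finally show ?thesis .
qed

lemma mode_list_nth:
  assumes "p < dim0 N n0"
  shows "fst (mode_list N n0 ! p) \<in> {1..N}" "snd (mode_list N n0 ! p) < n0 (fst (mode_list N n0 ! p))"
proof -
  have "mode_list N n0 ! p \<in> set (mode_list N n0)"
    using assms by (simp add: length_mode_list)
  then have "mode_list N n0 ! p \<in> (SIGMA i:{1..N}. {..<n0 i})"
    by (simp only: set_mode_list)
  then show "fst (mode_list N n0 ! p) \<in> {1..N}" "snd (mode_list N n0 ! p) < n0 (fst (mode_list N n0 ! p))"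
    by auto
qed

lemma mode_list_surj:
  assumes "i \<in> {1..N}" "k < n0 i"
  obtains p where "p < dim0 N n0" "mode_list N n0 ! p = (i, k)"
proof -
  have "(i, k) \<in> set (mode_list N n0)" using assms by (simp add: set_mode_list)
  then show ?thesis using that by (auto simp: in_set_conv_nth length_mode_list)
qed

lemma four_block_diag:
  "four_block_mat (mat_diag m f) (0\<^sub>m m l) (0\<^sub>m l m) (mat_diag l g)
    = mat_diag (m + l) (\<lambda>p. if p < m then f p else g (p - m))"
  by (intro eq_matI) (auto simp: mat_diag_def)

lemma diag_block_mat_diag:
  "diag_block_mat (map (\<lambda>i. mat_diag (n i) (f i)) is)
    = mat_diag (length (concat (map (\<lambda>i. map (Pair i) [0..<n i]) is)))
        (\<lambda>p. (\<lambda>(i, k). f i k) (concat (map (\<lambda>i. map (Pair i) [0..<n i]) is) ! p))"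
proof (induction "is")
  case Nil
  show ?case by (intro eq_matI) (auto simp: mat_diag_def)
next
  case (Cons i "is")
  have dim: "dim_row (mat_diag m g) = m" "dim_col (mat_diag m g) = m" for m and g :: "nat \<Rightarrow> 'a"
    by (simp_all add: mat_diag_def)
  have "(if p < n i then f i p else (\<lambda>(i, k). f i k) (concat (map (\<lambda>i. map (Pair i) [0..<n i]) is) ! (p - n i)))
      = (\<lambda>(i, k). f i k) (concat (map (\<lambda>i. map (Pair i) [0..<n i]) (i # is)) ! p)" for p
    by (simp add: nth_append)
  then show ?case
    by (simp only: list.map diag_block_mat.simps Let_def Cons.IH dim four_block_diag concat.simps length_append
        length_map length_upt diff_zero)
qed

lemma A1_diag: "A1 N a n0 = mat_diag (dim0 N n0) (\<lambda>p. lam a (fst (mode_list N n0 ! p)) (snd (mode_list N n0 ! p)))"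
  unfolding A1_def diag_block_mat_diag mode_list_def[symmetric] length_mode_list by (simp add: case_prod_beta)

lemma A1_carrier: "A1 N a n0 \<in> carrier_mat (dim0 N n0) (dim0 N n0)"
  by (simp add: A1_diag)

lemma A1_index: "p < dim0 N n0 \<Longrightarrow> q < dim0 N n0 \<Longrightarrow>
    A1 N a n0 $$ (p, q) = (if p = q then lam a (fst (mode_list N n0 ! q)) (snd (mode_list N n0 ! q)) else 0)"
  by (simp add: A1_diag mat_diag_def)

lemma mat_of_col_times_row:
  assumes v: "v \<in> carrier_vec d" and w: "w \<in> carrier_vec e"
  shows "mat_of_col v * mat_of_row w \<in> carrier_mat d e"
    "p < d \<Longrightarrow> q < e \<Longrightarrow> (mat_of_col v * mat_of_row w) $$ (p, q) = v $ p * w $ q"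
proof -
  have dims: "dim_vec v = d" "dim_vec w = e" using v w by auto
  have V: "mat_of_col v \<in> carrier_mat d 1"
    unfolding mat_of_col_def dims mat_of_cols_def by simp
  have W: "mat_of_row w \<in> carrier_mat 1 e" using w by (rule mat_of_row_carrier)
  show "mat_of_col v * mat_of_row w \<in> carrier_mat d e" using V W by (rule mult_carrier_mat)
  assume p: "p < d" and q: "q < e"
  have "(mat_of_col v * mat_of_row w) $$ (p, q) = (\<Sum>l\<in>{0..<1}. mat_of_col v $$ (p, l) * mat_of_row w $$ (l, q))"
    using p q carrier_matD[OF V] carrier_matD[OF W] by (simp add: scalar_prod_def)
  also have "\<dots> = v $ p * w $ q"
    using p q by (simp add: mat_of_col_def mat_of_cols_def mat_of_row_def dims)
  finally show "(mat_of_col v * mat_of_row w) $$ (p, q) = v $ p * w $ q" .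
qed

lemma observer_matrix:
  fixes a :: "nat \<Rightarrow> real" and c :: "real \<Rightarrow> real"
  assumes "L \<in> carrier_vec (dim0 N n0)"
  defines "M \<equiv> A1 N a n0 - mat_of_col L * mat_of_row (C1 N a c n0)"
  shows "M \<in> carrier_mat (dim0 N n0) (dim0 N n0)"
    "p < dim0 N n0 \<Longrightarrow> q < dim0 N n0 \<Longrightarrow> M $$ (p, q) = A1 N a n0 $$ (p, q) - L $ p * C1 N a c n0 $ q"
proof -
  have C: "C1 N a c n0 \<in> carrier_vec (dim0 N n0)" by (rule carrier_vecI) (simp add: C1_def)
  note m = mat_of_col_times_row[OF assms(1) C]
  show "M \<in> carrier_mat (dim0 N n0) (dim0 N n0)" unfolding M_def using m(1) by (rule minus_carrier_mat)
  show "p < dim0 N n0 \<Longrightarrow> q < dim0 N n0 \<Longrightarrow> M $$ (p, q) = A1 N a n0 $$ (p, q) - L $ p * C1 N a c n0 $ q"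
    unfolding M_def using m(2)[of p q] carrier_matD[OF m(1)] by simp
qed

lemma controller_matrix:
  fixes a :: "nat \<Rightarrow> real" and ku :: real
  assumes "Kx \<in> carrier_vec (dim0 N n0)"
  defines "M \<equiv> A1a N a n0 - B1a N a n0 * gain_row Kx ku" and "d \<equiv> dim0 N n0"
  shows "M \<in> carrier_mat (Suc d) (Suc d)"
    "p < d \<Longrightarrow> q < d \<Longrightarrow> M $$ (p, q) = A1 N a n0 $$ (p, q) - B1v N a n0 $ p * Kx $ q"
    "p < d \<Longrightarrow> M $$ (p, d) = B1u N a n0 $ p - B1v N a n0 $ p * ku"
    "q < d \<Longrightarrow> M $$ (d, q) = - (Kx $ q)"
    "M $$ (d, d) = - ku"
proof -
  have B: "(B1v N a n0 @\<^sub>v vec_of_list [1]) \<in> carrier_vec (Suc d)"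
    by (rule carrier_vecI) (simp add: B1v_def d_def)
  have K: "(Kx @\<^sub>v vec_of_list [ku]) \<in> carrier_vec (Suc d)"
    by (rule carrier_vecI) (use carrier_vecD[OF assms(1)] in \<open>simp add: d_def\<close>)
  have m1: "B1a N a n0 * gain_row Kx ku \<in> carrier_mat (Suc d) (Suc d)"
    unfolding B1a_def gain_row_def by (rule mat_of_col_times_row(1)[OF B K])
  have m2: "(B1a N a n0 * gain_row Kx ku) $$ (p, q)
      = (B1v N a n0 @\<^sub>v vec_of_list [1]) $ p * (Kx @\<^sub>v vec_of_list [ku]) $ q" if "p < Suc d" "q < Suc d" for p q
    unfolding B1a_def gain_row_def by (rule mat_of_col_times_row(2)[OF B K that])
  show "M \<in> carrier_mat (Suc d) (Suc d)" unfolding M_def using m1 by (rule minus_carrier_mat)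
  have dims: "dim_row (A1 N a n0) = d" "dim_col (A1 N a n0) = d" "dim_vec (B1u N a n0) = d"
     "dim_vec (B1v N a n0) = d" "dim_vec Kx = d"
    using carrier_matD[OF A1_carrier[of N a n0]] carrier_vecD[OF assms(1)] by (simp_all add: d_def B1u_def B1v_def)
  have M: "M $$ (p, q) = A1a N a n0 $$ (p, q)
      - (B1v N a n0 @\<^sub>v vec_of_list [1]) $ p * (Kx @\<^sub>v vec_of_list [ku]) $ q" if "p < Suc d" "q < Suc d" for p q
    unfolding M_def using m2[OF that] carrier_matD[OF m1] that by simp
  have fb: "A1a N a n0 $$ (p, q) = (if p < d then if q < d then A1 N a n0 $$ (p, q) else B1u N a n0 $ p else 0)"
    if "p < Suc d" "q < Suc d" for p q
    using that unfolding A1a_def mat_of_col_def mat_of_cols_def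
    by (subst index_mat_four_block) (auto simp: dims d_def[symmetric])
  show "p < d \<Longrightarrow> q < d \<Longrightarrow> M $$ (p, q) = A1 N a n0 $$ (p, q) - B1v N a n0 $ p * Kx $ q"
    using M[of p q] fb[of p q] dims by simp
  show "p < d \<Longrightarrow> M $$ (p, d) = B1u N a n0 $ p - B1v N a n0 $ p * ku"
    using M[of p d] fb[of p d] dims by simp
  show "q < d \<Longrightarrow> M $$ (d, q) = - (Kx $ q)"
    using M[of d q] fb[of d q] dims by simp
  show "M $$ (d, d) = - ku"
    using M[of d d] fb[of d d] dims by simp
qed

section \<open>Error dynamics of the observer\<close>

locale controlled_cascade = cascade +
  fixes c :: "real \<Rightarrow> real" and \<delta> :: real and n0 :: "nat \<Rightarrow> nat"
    and Kx :: "real vec" and ku :: real and L :: "real vec"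
  assumes c_sq: "square_integrable c"
    and c_lifting: "N = 1 \<Longrightarrow> (LINT x|unit_leb. c x * lifting x) = 0"
    and lam_n0: "\<And>i. i \<in> {1..N} \<Longrightarrow> lam a i (n0 i) < - \<delta>"
    and Kx: "Kx \<in> carrier_vec (dim0 N n0)" and L: "L \<in> carrier_vec (dim0 N n0)"
    and K_abscissa: "spectral_abscissa (A1a N a n0 - B1a N a n0 * gain_row Kx ku) < ereal (- \<delta>)"
    and L_abscissa: "spectral_abscissa (A1 N a n0 - mat_of_col L * mat_of_row (C1 N a c n0)) < ereal (- \<delta>)"
begin

abbreviation d :: nat where "d \<equiv> dim0 N n0"
abbreviation mi :: "nat \<Rightarrow> nat" where "mi p \<equiv> fst (mode_list N n0 ! p)"
abbreviation mk :: "nat \<Rightarrow> nat" where "mk p \<equiv> snd (mode_list N n0 ! p)"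

definition gap :: "nat \<Rightarrow> nat \<Rightarrow> real" where "gap i k = - \<delta> - lam a i k"

abbreviation closed_loop where
  "closed_loop \<equiv> \<lambda>n y u Xh xh. closed_loop_solution N a c n0 n Kx ku L y u Xh xh"

lemma lam_below:
  assumes "i \<in> {1..N}" "n0 i \<le> k"
  shows "lam a i k < - \<delta>"
proof -
  have "lam a i k \<le> lam a i (n0 i)"
    using assms(2) unfolding lam_def by (intro diff_left_mono mult_right_mono power_mono) auto
  then show ?thesis using lam_n0[OF assms(1)] by simp
qed

lemma gap_pos: "i \<in> {1..N} \<Longrightarrow> n0 i \<le> k \<Longrightarrow> 0 < gap i k"
  using lam_below by (simp add: gap_def less_diff_eq)

text \<open>The factor \<open>k + 1\<close> is what the estimate in \<open>H1\<close> has to absorb; it also shows that \<open>1 / gap\<close> tends to \<open>0\<close>.\<close>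

lemma gap_growth: "\<exists>C\<ge>0. \<forall>i\<in>{1..N}. \<forall>k\<ge>n0 i. (real k + 1) / gap i k \<le> C"
proof -
  have "\<exists>C\<ge>0. \<forall>i\<in>{1..N}. \<forall>k\<in>UNIV. (if n0 i \<le> k then (real k + 1) / gap i k else 0) \<le> C * 1"
  proof (rule uniform_factor)
    fix i assume i: "i \<in> {1..N}"
    have "\<exists>C\<ge>0. \<forall>k. \<forall>x\<in>{()}. (if n0 i \<le> k then (real k + 1) / gap i k else 0) \<le> C"
    proof (rule uniform_bound_from_tail[where K = "nat \<lceil>\<bar>a i\<bar> + \<bar>\<delta>\<bar> + 2\<rceil>" and C = 1])
      fix k assume "nat \<lceil>\<bar>a i\<bar> + \<bar>\<delta>\<bar> + 2\<rceil> \<le> k"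
      then have k: "real k \<ge> \<bar>a i\<bar> + \<bar>\<delta>\<bar> + 2" by linarith
      have "2 * real k \<le> real k * real k" using k by (intro mult_right_mono) auto
      also have "real k * real k * 1 \<le> (real k)\<^sup>2 * pi\<^sup>2"
        unfolding power2_eq_square using mult_mono[of 1 pi 1 pi] pi_ge_two by (intro mult_left_mono) auto
      finally have "real k + 1 \<le> gap i k"
        using k by (simp add: gap_def lam_def)
      moreover have "0 < gap i k" using calculation by linarith
      ultimately show "(if n0 i \<le> k then (real k + 1) / gap i k else 0) \<le> 1" by (simp add: divide_le_eq)
    qed auto
    then show "\<exists>C\<ge>0. \<forall>k\<in>UNIV. (if n0 i \<le> k then (real k + 1) / gap i k else 0) \<le> C * 1" by auto
  qed auto
  then show ?thesis by (metis UNIV_I mult.right_neutral)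
qed

lemma gap_large:
  assumes "0 < \<eta>"
  shows "\<exists>M. \<forall>i\<in>{1..N}. \<forall>k. M < k \<longrightarrow> n0 i \<le> k \<longrightarrow> 1 / gap i k \<le> \<eta>"
proof -
  obtain C where C: "0 \<le> C" "\<And>i k. i \<in> {1..N} \<Longrightarrow> n0 i \<le> k \<Longrightarrow> (real k + 1) / gap i k \<le> C"
    using gap_growth by blast
  have "1 / gap i k \<le> \<eta>" if "i \<in> {1..N}" "nat \<lceil>C / \<eta>\<rceil> < k" "n0 i \<le> k" for i k
  proof -
    have "C / \<eta> \<le> real k + 1" using that(2) by linarith
    then have "C \<le> \<eta> * (real k + 1)" using assms by (simp add: divide_le_eq mult.commute)
    then have "(real k + 1) / gap i k \<le> \<eta> * (real k + 1)" using C(2)[OF that(1,3)] by linarith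
    then have "(real k + 1) * (1 / gap i k) \<le> (real k + 1) * \<eta>" by (simp add: mult.commute)
    then show ?thesis by (rule mult_left_le_imp_le) simp
  qed
  then show ?thesis by (intro exI[of _ "nat \<lceil>C / \<eta>\<rceil>"]) auto
qed

text \<open>The output sees the lifting only when the measured component is the actuated one, that is for
  \<open>N = 1\<close>; the kernel \<open>c\<close> is orthogonal to it in that case.\<close>

lemma inner_c_Lift: "inner (L2_of c) (Lift 1) = 0"
proof (cases "N = 1")
  case True
  then have "Lift 1 = L2_of lifting" unfolding Lift_def by simp
  then show ?thesis using c_lifting[OF True] by (simp add: inner_L2_of c_sq lifting_sq)
qed (simp add: Lift_def)

lemma inner_c_Phi: "inner (L2_of c) (Phi i k 1) = c_coeff a c i k"
  by (simp add: Phi_def inner_L2_of c_sq c_coeff_def)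

end

locale closed_loop_run = controlled_cascade +
  fixes n :: "nat \<Rightarrow> nat" and y :: "real \<Rightarrow> nat \<Rightarrow> L2" and u :: "real \<Rightarrow> real"
    and Xh :: "real \<Rightarrow> real vec" and xh :: "real \<Rightarrow> nat \<Rightarrow> nat \<Rightarrow> real"
  assumes n0_le: "\<And>i. i \<in> {1..N} \<Longrightarrow> n0 i \<le> n i"
    and sol: "closed_loop n y u Xh xh"
begin

definition v :: "real \<Rightarrow> real" where "v t = - (Kx \<bullet> Xh t) - ku * u t"
definition W :: "real \<Rightarrow> nat \<Rightarrow> L2" where "W t j = y t j - u t *\<^sub>R Lift j"
definition w :: "nat \<Rightarrow> nat \<Rightarrow> real \<Rightarrow> real" where "w i k t = coef N a i k (W t)"
definition innov :: "real \<Rightarrow> real" where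
  "innov t = C1 N a c n0 \<bullet> Xh t + obs_tail N n0 n (\<lambda>i k. c_coeff a c i k * xh t i k) - inner (L2_of c) (y t 1)"
definition err :: "nat \<Rightarrow> real \<Rightarrow> real" where "err p t = Xh t $ p - w (mi p) (mk p) t"
definition tail_err :: "nat \<Rightarrow> nat \<Rightarrow> real \<Rightarrow> real" where "tail_err i k t = xh t i k - w i k t"
text \<open>The part of \<open>W\<close> carried by the neglected modes.\<close>

definition rest :: "real \<Rightarrow> nat \<Rightarrow> L2" where
  "rest t j = W t j - (\<Sum>i=1..N. \<Sum>k\<le>n i. w i k t *\<^sub>R Phi i k j)"

lemma Xh_carrier: "0 \<le> t \<Longrightarrow> Xh t \<in> carrier_vec d"
  and mild: "cascade_mild_solution N a u y"
  and u_deriv: "0 \<le> t \<Longrightarrow> (u has_real_derivative v t) (at t within {0..})"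
  and Xh_deriv: "0 \<le> t \<Longrightarrow> p < d \<Longrightarrow> ((\<lambda>s. Xh s $ p) has_real_derivative
      (A1 N a n0 *\<^sub>v Xh t + u t \<cdot>\<^sub>v B1u N a n0 + v t \<cdot>\<^sub>v B1v N a n0 - innov t \<cdot>\<^sub>v L) $ p) (at t within {0..})"
  and xh_deriv: "0 \<le> t \<Longrightarrow> i \<in> {1..N} \<Longrightarrow> k \<in> {n0 i..n i} \<Longrightarrow> ((\<lambda>s. xh s i k) has_real_derivative
      lam a i k * xh t i k + alpha N a i k * u t + beta N a i k * v t) (at t within {0..})"
  using sol unfolding closed_loop_solution_def Let_def v_def innov_def by blast+

lemma w_deriv:
  assumes "0 \<le> t" "i \<in> {1..N}"
  shows "(w i k has_real_derivative lam a i k * w i k t + alpha N a i k * u t + beta N a i k * v t) (at t within {0..})"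
proof -
  have W: "W = (\<lambda>s j. y s j - u s *\<^sub>R Lift j)" by (simp add: fun_eq_iff W_def)
  have w: "w i k = (\<lambda>s. coef N a i k (lifted (y s) (u s)))" by (rule ext) (simp add: w_def W)
  show ?thesis
    unfolding w by (rule modal_ode[OF mild assms(2) u_deriv assms(1)])
qed

lemma scalar_prod_Xh: "0 \<le> t \<Longrightarrow> x \<bullet> Xh t = (\<Sum>q<d. x $ q * Xh t $ q)"
  using carrier_vecD[OF Xh_carrier] by (simp add: scalar_prod_def atLeast0LessThan)

lemma v_eq: "0 \<le> t \<Longrightarrow> v t = - (\<Sum>q<d. Kx $ q * Xh t $ q) - ku * u t"
  by (simp add: v_def scalar_prod_Xh)

lemma Xh_deriv_component:
  assumes t: "0 \<le> t" and p: "p < d"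
  shows "((\<lambda>s. Xh s $ p) has_real_derivative
      lam a (mi p) (mk p) * Xh t $ p + u t * alpha N a (mi p) (mk p) + v t * beta N a (mi p) (mk p) - innov t * L $ p)
      (at t within {0..})"
proof -
  have dims: "dim_vec (Xh t) = d" "dim_vec L = d" "dim_row (A1 N a n0) = d" "dim_col (A1 N a n0) = d"
     "dim_vec (B1u N a n0) = d" "dim_vec (B1v N a n0) = d"
    using carrier_vecD[OF Xh_carrier[OF t]] carrier_vecD[OF L] carrier_matD[OF A1_carrier[of N a n0]]
    by (simp_all add: B1u_def B1v_def)
  have "(A1 N a n0 *\<^sub>v Xh t) $ p = (\<Sum>q<d. A1 N a n0 $$ (p, q) * Xh t $ q)"
    using p dims by (simp add: scalar_prod_def atLeast0LessThan)
  also have "\<dots> = (\<Sum>q<d. if q = p then lam a (mi p) (mk p) * Xh t $ p else 0)"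
    using p by (intro sum.cong) (auto simp: A1_index)
  also have "\<dots> = lam a (mi p) (mk p) * Xh t $ p" using p by simp
  finally have "(A1 N a n0 *\<^sub>v Xh t + u t \<cdot>\<^sub>v B1u N a n0 + v t \<cdot>\<^sub>v B1v N a n0 - innov t \<cdot>\<^sub>v L) $ p
     = lam a (mi p) (mk p) * Xh t $ p + u t * alpha N a (mi p) (mk p) + v t * beta N a (mi p) (mk p) - innov t * L $ p"
    using p dims by (simp add: B1u_def B1v_def stack_index)
  then show ?thesis using Xh_deriv[OF t p] by simp
qed

lemma tail_err_deriv:
  assumes "0 \<le> t" "i \<in> {1..N}" "k \<in> {n0 i..n i}"
  shows "(tail_err i k has_real_derivative lam a i k * tail_err i k t) (at t within {0..})"
proof -
  have "((\<lambda>s. xh s i k - w i k s) has_real_derivative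
      (lam a i k * xh t i k + alpha N a i k * u t + beta N a i k * v t)
      - (lam a i k * w i k t + alpha N a i k * u t + beta N a i k * v t)) (at t within {0..})"
    by (intro DERIV_diff xh_deriv w_deriv assms)
  then show ?thesis
    unfolding tail_err_def[abs_def] by (rule DERIV_cong) (simp add: algebra_simps)
qed

text \<open>By biorthogonality, removing a finite part of the expansion along \<open>Phi\<close> removes exactly the
  corresponding coefficients.\<close>

lemma coef_rest:
  assumes i: "i \<in> {1..N}"
  shows "coef N a i k (rest t) = (if k \<le> n i then 0 else w i k t)"
proof -
  have "coef N a i k (rest t) = w i k t - (\<Sum>i'=1..N. \<Sum>k'\<le>n i'. w i' k' t * coef N a i k (Phi i' k'))"
    unfolding rest_def[abs_def] by (simp add: coef_diff coef_sum coef_scale w_def)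
  also have "(\<Sum>i'=1..N. \<Sum>k'\<le>n i'. w i' k' t * coef N a i k (Phi i' k'))
      = (\<Sum>i'=1..N. \<Sum>k'\<le>n i'. if i' = i then (if k' = k then w i k t else 0) else 0)"
    by (intro sum.cong refl) (auto simp: biorthogonal[OF i])
  also have "\<dots> = (\<Sum>i'=1..N. if i' = i then (\<Sum>k'\<le>n i. if k' = k then w i k t else 0) else 0)"
    by (intro sum.cong) auto
  also have "\<dots> = (if k \<le> n i then w i k t else 0)"
    using i by simp
  finally show ?thesis by simp
qed

lemma sum_modes_split:
  "(\<Sum>i=1..N. \<Sum>k\<le>n i. g i k) = (\<Sum>p<d. g (mi p) (mk p)) + obs_tail N n0 n (g :: nat \<Rightarrow> nat \<Rightarrow> real)"
proof -
  have "(\<Sum>k\<le>n i. g i k) = (\<Sum>k<n0 i. g i k) + (\<Sum>k=n0 i..n i. g i k)" if "i \<in> {1..N}" for i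
  proof -
    have "{..n i} = {..<n0 i} \<union> {n0 i..n i}" using n0_le[OF that] by auto
    moreover have "{..<n0 i} \<inter> {n0 i..n i} = {}" by auto
    ultimately show ?thesis by (simp add: sum.union_disjoint)
  qed
  then show ?thesis
    by (simp add: sum_mode_list[of g] obs_tail_def sum.distrib)
qed

lemma output_eq:
  "inner (L2_of c) (y t 1) = (\<Sum>p<d. C1 N a c n0 $ p * w (mi p) (mk p) t)
     + obs_tail N n0 n (\<lambda>i k. c_coeff a c i k * w i k t) + inner (L2_of c) (rest t 1)"
proof -
  have "y t 1 = rest t 1 + (\<Sum>i=1..N. \<Sum>k\<le>n i. w i k t *\<^sub>R Phi i k 1) + u t *\<^sub>R Lift 1"
    by (simp add: rest_def W_def)
  then have "inner (L2_of c) (y t 1) = inner (L2_of c) (rest t 1) + (\<Sum>i=1..N. \<Sum>k\<le>n i. c_coeff a c i k * w i k t)"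
    using inner_c_Lift by (simp add: inner_add_right inner_sum_right inner_c_Phi[unfolded One_nat_def] mult.commute)
  also have "(\<Sum>i=1..N. \<Sum>k\<le>n i. c_coeff a c i k * w i k t)
      = (\<Sum>p<d. c_coeff a c (mi p) (mk p) * w (mi p) (mk p) t) + obs_tail N n0 n (\<lambda>i k. c_coeff a c i k * w i k t)"
    by (rule sum_modes_split)
  also have "(\<Sum>p<d. c_coeff a c (mi p) (mk p) * w (mi p) (mk p) t) = (\<Sum>p<d. C1 N a c n0 $ p * w (mi p) (mk p) t)"
    by (intro sum.cong) (auto simp: C1_def stack_index)
  finally show ?thesis by simp
qed

lemma innov_eq:
  assumes "0 \<le> t"
  shows "innov t = (\<Sum>p<d. C1 N a c n0 $ p * err p t) + obs_tail N n0 n (\<lambda>i k. c_coeff a c i k * tail_err i k t)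
     - inner (L2_of c) (rest t 1)"
  unfolding innov_def output_eq scalar_prod_Xh[OF assms] err_def tail_err_def obs_tail_def
  by (simp add: right_diff_distrib sum_subtractf)

lemma err_deriv:
  assumes t: "0 \<le> t" and p: "p < d"
  defines "M \<equiv> A1 N a n0 - mat_of_col L * mat_of_row (C1 N a c n0)"
  shows "(err p has_real_derivative (\<Sum>q<d. M $$ (p, q) * err q t)
     + - L $ p * (innov t - (\<Sum>q<d. C1 N a c n0 $ q * err q t))) (at t within {0..})"
proof -
  have "((\<lambda>s. Xh s $ p - w (mi p) (mk p) s) has_real_derivative
      (lam a (mi p) (mk p) * Xh t $ p + u t * alpha N a (mi p) (mk p) + v t * beta N a (mi p) (mk p) - innov t * L $ p)
      - (lam a (mi p) (mk p) * w (mi p) (mk p) t + alpha N a (mi p) (mk p) * u t + beta N a (mi p) (mk p) * v t))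
      (at t within {0..})"
    using mode_list_nth[OF p] by (intro DERIV_diff Xh_deriv_component w_deriv t p) auto
  moreover have "(\<Sum>q<d. M $$ (p, q) * err q t) = lam a (mi p) (mk p) * err p t - L $ p * (\<Sum>q<d. C1 N a c n0 $ q * err q t)"
  proof -
    have "(\<Sum>q<d. M $$ (p, q) * err q t)
        = (\<Sum>q<d. (if q = p then lam a (mi p) (mk p) * err p t else 0) - L $ p * (C1 N a c n0 $ q * err q t))"
      unfolding M_def using p by (intro sum.cong) (auto simp: observer_matrix(2)[OF L] A1_index algebra_simps)
    then show ?thesis using p by (simp add: sum_subtractf sum_distrib_left)
  qed
  ultimately show ?thesis
    unfolding err_def[abs_def] by (elim DERIV_cong) (simp add: algebra_simps)
qed

text \<open>The observer state followed by the input, the state vector of \<open>A1a - B1a K\<close>.\<close>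

definition x :: "real \<Rightarrow> nat \<Rightarrow> real" where "x t p = (if p < d then Xh t $ p else u t)"

lemma x_deriv:
  assumes t: "0 \<le> t" and p: "p < Suc d"
  defines "M \<equiv> A1a N a n0 - B1a N a n0 * gain_row Kx ku"
  shows "((\<lambda>s. x s p) has_real_derivative (\<Sum>q<Suc d. M $$ (p, q) * x t q)
     + (if p < d then - L $ p * innov t else 0)) (at t within {0..})"
proof (cases "p < d")
  case True
  have "(\<Sum>q<Suc d. M $$ (p, q) * x t q) = (\<Sum>q<d. M $$ (p, q) * Xh t $ q) + M $$ (p, d) * u t"
    by (simp add: x_def)
  also have "(\<Sum>q<d. M $$ (p, q) * Xh t $ q)
      = (\<Sum>q<d. (if q = p then lam a (mi p) (mk p) * Xh t $ p else 0) - B1v N a n0 $ p * (Kx $ q * Xh t $ q))"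
    unfolding M_def using True
    by (intro sum.cong) (auto simp: controller_matrix(2)[OF Kx] A1_index algebra_simps)
  also have "\<dots> = lam a (mi p) (mk p) * Xh t $ p - B1v N a n0 $ p * (\<Sum>q<d. Kx $ q * Xh t $ q)"
    using True by (simp add: sum_subtractf sum_distrib_left)
  finally have eq: "(\<Sum>q<Suc d. M $$ (p, q) * x t q) = lam a (mi p) (mk p) * Xh t $ p
      - B1v N a n0 $ p * (\<Sum>q<d. Kx $ q * Xh t $ q) + M $$ (p, d) * u t" .
  have Mpd: "M $$ (p, d) = alpha N a (mi p) (mk p) - beta N a (mi p) (mk p) * ku"
    using True by (simp add: M_def controller_matrix(3)[OF Kx True] B1u_def B1v_def stack_index)
  have "(\<Sum>q<Suc d. M $$ (p, q) * x t q) = lam a (mi p) (mk p) * Xh t $ p + u t * alpha N a (mi p) (mk p)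
      + v t * beta N a (mi p) (mk p)"
    unfolding eq v_eq[OF t] Mpd using True by (simp add: B1v_def stack_index algebra_simps)
  then show ?thesis using Xh_deriv_component[OF t True] True by (simp add: x_def mult.commute del: sum.lessThan_Suc)
next
  case False
  then have pd: "p = d" using p by simp
  have "(\<Sum>q<Suc d. M $$ (d, q) * x t q) = (\<Sum>q<d. - (Kx $ q) * Xh t $ q) - ku * u t"
    by (simp add: x_def M_def controller_matrix(4,5)[OF Kx])
  then have "(\<Sum>q<Suc d. M $$ (d, q) * x t q) = v t" using v_eq[OF t] by (simp add: sum_negf)
  then show ?thesis using u_deriv[OF t] pd by (simp add: x_def[abs_def])
qed

lemma mode_bound:
  assumes i: "i \<in> {1..N}" and k: "n0 i \<le> k" and t: "t \<in> {0..T}"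
    and u: "\<And>s. s \<in> {0..T} \<Longrightarrow> \<bar>u s\<bar> \<le> m * exp (- \<delta> * s)"
    and v: "\<And>s. s \<in> {0..T} \<Longrightarrow> \<bar>v s\<bar> \<le> m' * exp (- \<delta> * s)"
  shows "\<bar>w i k t\<bar> \<le> exp (- \<delta> * t) * (\<bar>w i k 0\<bar> + (\<bar>alpha N a i k\<bar> * m + \<bar>beta N a i k\<bar> * m') / gap i k)"
  unfolding gap_def
proof (rule scalar_decay_real[OF t, of _ _ "\<lambda>s. alpha N a i k * u s + beta N a i k * v s"])
  fix s assume s: "s \<in> {0..T}"
  show "(w i k has_real_derivative lam a i k * w i k s + (alpha N a i k * u s + beta N a i k * v s)) (at s within {0..T})"
    using DERIV_subset[OF w_deriv[OF _ i, of s k], of "{0..T}"] s by (simp add: add.assoc)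
  have "\<bar>alpha N a i k * u s + beta N a i k * v s\<bar> \<le> \<bar>alpha N a i k\<bar> * \<bar>u s\<bar> + \<bar>beta N a i k\<bar> * \<bar>v s\<bar>"
    by (simp flip: abs_mult add: abs_triangle_ineq)
  also have "\<dots> \<le> \<bar>alpha N a i k\<bar> * (m * exp (- \<delta> * s)) + \<bar>beta N a i k\<bar> * (m' * exp (- \<delta> * s))"
    using u[OF s] v[OF s] by (intro add_mono mult_left_mono) auto
  finally show "\<bar>alpha N a i k * u s + beta N a i k * v s\<bar>
      \<le> (\<bar>alpha N a i k\<bar> * m + \<bar>beta N a i k\<bar> * m') * exp (- \<delta> * s)"
    by (simp add: algebra_simps)
qed (rule lam_below[OF i k])

lemma tail_err_bound:
  assumes "i \<in> {1..N}" "k \<in> {n0 i..n i}" "0 \<le> t"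
  shows "\<bar>tail_err i k t\<bar> \<le> exp (- \<delta> * t) * \<bar>tail_err i k 0\<bar>"
proof -
  have "\<bar>tail_err i k t\<bar> \<le> exp (- \<delta> * t) * (\<bar>tail_err i k 0\<bar> + 0 / (- \<delta> - lam a i k))"
  proof (rule scalar_decay_real[of t t _ _ "\<lambda>_. 0"])
    fix s assume s: "s \<in> {0..t}"
    show "(tail_err i k has_real_derivative lam a i k * tail_err i k s + 0) (at s within {0..t})"
      using DERIV_subset[OF tail_err_deriv[OF _ assms(1,2), of s], of "{0..t}"] s by simp
  qed (use assms lam_below in auto)
  then show ?thesis by simp
qed

end

section \<open>Exponential decay of the closed loop\<close>

lemma controller_norm_bounds:
  assumes X: "X \<in> carrier_vec (dim0 N n0)"
  shows "\<bar>u\<bar> \<le> controller_norm N n0 n u X x"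
    "p < dim0 N n0 \<Longrightarrow> \<bar>X $ p\<bar> \<le> controller_norm N n0 n u X x"
    "i \<in> {1..N} \<Longrightarrow> k \<in> {n0 i..n i} \<Longrightarrow> \<bar>x i k\<bar> \<le> controller_norm N n0 n u X x"
    "controller_norm N n0 n u X x \<le> \<bar>u\<bar> + (\<Sum>p<dim0 N n0. \<bar>X $ p\<bar>) + obs_tail N n0 n (\<lambda>i k. \<bar>x i k\<bar>)"
proof -
  have "X \<bullet> X = (\<Sum>p<dim0 N n0. (X $ p)\<^sup>2)"
    using carrier_vecD[OF X] by (simp add: scalar_prod_def atLeast0LessThan power2_eq_square)
  then have nX: "sqrt (X \<bullet> X) = L2_set (($) X) {..<dim0 N n0}" by (simp add: L2_set_def)
  have tail: "0 \<le> obs_tail N n0 n (\<lambda>i k. \<bar>x i k\<bar>)"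
    unfolding obs_tail_def by (intro sum_nonneg) auto
  have nX0: "0 \<le> sqrt (X \<bullet> X)" unfolding nX by simp
  show "\<bar>u\<bar> \<le> controller_norm N n0 n u X x"
    using tail nX0 by (simp add: controller_norm_def)
  show "\<bar>X $ p\<bar> \<le> controller_norm N n0 n u X x" if "p < dim0 N n0"
  proof -
    have "\<bar>X $ p\<bar> \<le> L2_set (\<lambda>p. \<bar>X $ p\<bar>) {..<dim0 N n0}"
      using that by (intro member_le_L2_set[of _ _ "\<lambda>p. \<bar>X $ p\<bar>"]) auto
    also have "\<dots> = sqrt (X \<bullet> X)" unfolding nX by (simp add: L2_set_def)
    finally show ?thesis using tail by (simp add: controller_norm_def)
  qed
  show "\<bar>x i k\<bar> \<le> controller_norm N n0 n u X x" if "i \<in> {1..N}" "k \<in> {n0 i..n i}"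
  proof -
    have "\<bar>x i k\<bar> \<le> (\<Sum>k=n0 i..n i. \<bar>x i k\<bar>)"
      using that(2) by (intro member_le_sum[of k "{n0 i..n i}" "\<lambda>k. \<bar>x i k\<bar>"]) auto
    also have "\<dots> \<le> obs_tail N n0 n (\<lambda>i k. \<bar>x i k\<bar>)"
      unfolding obs_tail_def using that(1)
      by (intro member_le_sum[of i "{1..N}" "\<lambda>i. \<Sum>k=n0 i..n i. \<bar>x i k\<bar>"]) (auto intro: sum_nonneg)
    finally show ?thesis using nX0 abs_ge_zero[of u] unfolding controller_norm_def by linarith
  qed
  show "controller_norm N n0 n u X x \<le> \<bar>u\<bar> + (\<Sum>p<dim0 N n0. \<bar>X $ p\<bar>) + obs_tail N n0 n (\<lambda>i k. \<bar>x i k\<bar>)"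
    unfolding controller_norm_def nX using L2_set_le_sum_abs[of "($) X" "{..<dim0 N n0}"] by simp
qed

lemma obs_tail_mono:
  assumes "\<And>i k. i \<in> {1..N} \<Longrightarrow> k \<in> {n0 i..n i} \<Longrightarrow> f i k \<le> g i k"
  shows "obs_tail N n0 n f \<le> obs_tail N n0 n g"
  unfolding obs_tail_def using assms by (intro sum_mono) auto

lemma obs_tail_mult_le:
  fixes f g :: "nat \<Rightarrow> nat \<Rightarrow> real"
  assumes "\<And>i k. i \<in> {1..N} \<Longrightarrow> k \<in> {n0 i..n i} \<Longrightarrow> \<bar>g i k\<bar> \<le> B"
  shows "\<bar>obs_tail N n0 n (\<lambda>i k. f i k * g i k)\<bar> \<le> obs_tail N n0 n (\<lambda>i k. \<bar>f i k\<bar>) * B"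
proof -
  have "\<bar>obs_tail N n0 n (\<lambda>i k. f i k * g i k)\<bar> \<le> obs_tail N n0 n (\<lambda>i k. \<bar>f i k * g i k\<bar>)"
    unfolding obs_tail_def by (intro order_trans[OF sum_abs] sum_mono) auto
  also have "\<dots> \<le> obs_tail N n0 n (\<lambda>i k. \<bar>f i k\<bar> * B)"
    using assms by (intro obs_tail_mono) (auto simp: abs_mult intro: mult_left_mono)
  finally show ?thesis by (simp add: obs_tail_def sum_distrib_right)
qed

lemma sum_abs_mult_le:
  fixes f g :: "nat \<Rightarrow> real"
  assumes "\<And>p. p < m \<Longrightarrow> \<bar>g p\<bar> \<le> B"
  shows "\<bar>\<Sum>p<m. f p * g p\<bar> \<le> (\<Sum>p<m. \<bar>f p\<bar>) * B"
proof -
  have "\<bar>\<Sum>p<m. f p * g p\<bar> \<le> (\<Sum>p<m. \<bar>f p * g p\<bar>)" by (rule sum_abs)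
  also have "\<dots> \<le> (\<Sum>p<m. \<bar>f p\<bar> * B)"
    using assms by (intro sum_mono) (auto simp: abs_mult intro: mult_left_mono)
  finally show ?thesis by (simp add: sum_distrib_right)
qed

context controlled_cascade
begin

lemma source_coefficients:
  "\<exists>B\<ge>0. \<forall>i\<in>{1..N}. l2b (\<lambda>k. alpha N a i k) B \<and> l2b (\<lambda>k. beta N a i k) B"
proof -
  obtain C where C: "0 \<le> C" "\<And>i f. i \<in> {1..N} \<Longrightarrow> l2b (\<lambda>k. coef N a i k f) (C * (\<Sum>j=1..N. norm (f j)))"
    using coef_bessel by auto
  define B where "B = C * (\<Sum>j=1..N. norm (L2_of (alpha_fun N a j))) + C * (\<Sum>j=1..N. norm (Lift j))"
  have p: "0 \<le> C * (\<Sum>j=1..N. norm (L2_of (alpha_fun N a j)))" "0 \<le> C * (\<Sum>j=1..N. norm (Lift j))"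
    using C(1) by (auto intro!: mult_nonneg_nonneg sum_nonneg)
  have "l2b (\<lambda>k. alpha N a i k) B \<and> l2b (\<lambda>k. beta N a i k) B" if i: "i \<in> {1..N}" for i
  proof
    show "l2b (\<lambda>k. alpha N a i k) B"
      by (rule l2b_mono[OF C(2)[OF i, of "\<lambda>j. L2_of (alpha_fun N a j)"]]) (use p in \<open>auto simp: alpha_coef B_def\<close>)
    show "l2b (\<lambda>k. beta N a i k) B"
      by (rule l2b_mono[OF C(2)[OF i, of Lift]]) (use p in \<open>auto simp: beta_coef B_def\<close>)
  qed
  then show ?thesis using p by (intro exI[of _ B]) (auto simp: B_def)
qed

lemma initial_coefficients:
  "\<exists>B\<ge>0. \<forall>i\<in>{1..N}. \<forall>y u. l2b (\<lambda>k. coef N a i k (lifted y u)) (B * (norm_H0 N y + \<bar>u\<bar>))"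
proof -
  obtain C where C: "0 \<le> C" "\<And>i f. i \<in> {1..N} \<Longrightarrow> l2b (\<lambda>k. coef N a i k f) (C * (\<Sum>j=1..N. norm (f j)))"
    using coef_bessel by auto
  define B where "B = real N + (\<Sum>j=1..N. norm (Lift j))"
  have B: "real N \<le> B" "(\<Sum>j=1..N. norm (Lift j)) \<le> B" "0 \<le> B"
    by (auto simp: B_def intro!: sum_nonneg add_nonneg_nonneg)
  have "(\<Sum>j=1..N. norm (y j - u *\<^sub>R Lift j)) \<le> B * (norm_H0 N y + \<bar>u\<bar>)" for y u
  proof -
    have "(\<Sum>j=1..N. norm (y j - u *\<^sub>R Lift j)) \<le> (\<Sum>j=1..N. norm_H0 N y + \<bar>u\<bar> * norm (Lift j))"
    proof (intro sum_mono)
      fix j assume "j \<in> {1..N}"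
      then show "norm (y j - u *\<^sub>R Lift j) \<le> norm_H0 N y + \<bar>u\<bar> * norm (Lift j)"
        using norm_triangle_ineq4[of "y j" "u *\<^sub>R Lift j"] norm_H0_bounds(1)[of j N y] by simp
    qed
    also have "\<dots> = real N * norm_H0 N y + (\<Sum>j=1..N. norm (Lift j)) * \<bar>u\<bar>"
      by (simp add: sum.distrib sum_distrib_left[symmetric] mult.commute)
    also have "\<dots> \<le> B * norm_H0 N y + B * \<bar>u\<bar>"
      using B by (intro add_mono mult_right_mono) (auto simp: norm_H0_def sum_nonneg)
    finally show ?thesis by (simp add: distrib_left)
  qed
  then have "l2b (\<lambda>k. coef N a i k (lifted y u)) (C * B * (norm_H0 N y + \<bar>u\<bar>))" if "i \<in> {1..N}" for i y u
    using C(1) by (intro l2b_mono[OF C(2)[OF that]]) (auto simp: mult.assoc intro: mult_left_mono)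
  then show ?thesis using C(1) B(3) by (intro exI[of _ "C * B"]) auto
qed

lemma Lift_H1: "j \<in> {1..N} \<Longrightarrow> Lift j \<in> H1"
  using Lift_dom by (auto simp: cascade_dom_def H2_def)

lemma initial_coefficients_H1:
  "\<exists>B\<ge>0. \<forall>i\<in>{1..N}. \<forall>y u. (\<forall>j\<in>{1..N}. y j \<in> H1) \<longrightarrow>
     l2b (\<lambda>k. real k * coef N a i k (lifted y u)) (B * (norm_H1 N y + \<bar>u\<bar>))"
proof -
  obtain C where C: "0 \<le> C" "\<And>i f. i \<in> {1..N} \<Longrightarrow> (\<forall>j\<in>{1..N}. f j \<in> H1) \<Longrightarrow>
      l2b (\<lambda>k. real k * coef N a i k f) (C * (\<Sum>j=1..N. norm (f j) + norm (weak_deriv (f j))))"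
    using coef_bessel_H1 by auto
  define \<Sigma> where "\<Sigma> = (\<Sum>j=1..N. norm (Lift j) + norm (weak_deriv (Lift j)))"
  define B where "B = real N * 2 + \<Sigma>"
  have B: "real N * 2 \<le> B" "\<Sigma> \<le> B" "0 \<le> B"
    by (auto simp: B_def \<Sigma>_def intro!: sum_nonneg add_nonneg_nonneg)
  have "l2b (\<lambda>k. real k * coef N a i k (lifted y u)) (C * B * (norm_H1 N y + \<bar>u\<bar>))"
    if i: "i \<in> {1..N}" and y: "\<forall>j\<in>{1..N}. y j \<in> H1" for i y u
  proof (rule l2b_mono[OF C(2)[OF i]])
    have eq: "y j - u *\<^sub>R Lift j = y j + (- u) *\<^sub>R Lift j" for j by simp
    show H1: "\<forall>j\<in>{1..N}. y j - u *\<^sub>R Lift j \<in> H1"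
    proof
      fix j assume "j \<in> {1..N}"
      then have "y j + (- u) *\<^sub>R Lift j \<in> H1" using y Lift_H1 by (intro H1_add H1_scale) auto
      then show "y j - u *\<^sub>R Lift j \<in> H1" by simp
    qed
    have "(\<Sum>j=1..N. norm (y j - u *\<^sub>R Lift j) + norm (weak_deriv (y j - u *\<^sub>R Lift j)))
        \<le> (\<Sum>j=1..N. 2 * norm_H1 N y + \<bar>u\<bar> * (norm (Lift j) + norm (weak_deriv (Lift j))))"
    proof (intro sum_mono)
      fix j assume j: "j \<in> {1..N}"
      have "weak_deriv (y j - u *\<^sub>R Lift j) = weak_deriv (y j) + (- u) *\<^sub>R weak_deriv (Lift j)"
        unfolding eq using y Lift_H1[OF j] j by (simp only: weak_deriv_add weak_deriv_scale H1_scale)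
      then have "norm (weak_deriv (y j - u *\<^sub>R Lift j)) \<le> norm (weak_deriv (y j)) + \<bar>u\<bar> * norm (weak_deriv (Lift j))"
        using norm_triangle_ineq[of "weak_deriv (y j)" "(- u) *\<^sub>R weak_deriv (Lift j)"] by simp
      moreover have "norm (y j - u *\<^sub>R Lift j) \<le> norm (y j) + \<bar>u\<bar> * norm (Lift j)"
        using norm_triangle_ineq4[of "y j" "u *\<^sub>R Lift j"] by simp
      ultimately show "norm (y j - u *\<^sub>R Lift j) + norm (weak_deriv (y j - u *\<^sub>R Lift j))
          \<le> 2 * norm_H1 N y + \<bar>u\<bar> * (norm (Lift j) + norm (weak_deriv (Lift j)))"
        using norm_H1_bounds(1)[OF j, of y] by (simp add: distrib_left)
    qed
    also have "\<dots> = real N * 2 * norm_H1 N y + \<Sigma> * \<bar>u\<bar>"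
      by (simp add: sum.distrib sum_distrib_left[symmetric] \<Sigma>_def mult.commute)
    also have "\<dots> \<le> B * norm_H1 N y + B * \<bar>u\<bar>"
      using B by (intro add_mono mult_right_mono) (auto simp: norm_H1_def sum_nonneg)
    finally show "C * (\<Sum>j=1..N. norm (y j - u *\<^sub>R Lift j) + norm (weak_deriv (y j - u *\<^sub>R Lift j)))
        \<le> C * B * (norm_H1 N y + \<bar>u\<bar>)"
      unfolding mult.assoc using C(1) by (intro mult_left_mono) (auto simp: distrib_left)
  qed simp
  then show ?thesis using C(1) B(3) by (intro exI[of _ "C * B"]) auto
qed

definition Kabs :: real where "Kabs = (\<Sum>q<d. \<bar>Kx $ q\<bar>) + \<bar>ku\<bar>"

lemma Kabs_nonneg: "0 \<le> Kabs" by (auto simp: Kabs_def intro!: add_nonneg_nonneg sum_nonneg)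

definition size0 :: "(nat \<Rightarrow> nat) \<Rightarrow> (real \<Rightarrow> nat \<Rightarrow> L2) \<Rightarrow> (real \<Rightarrow> real) \<Rightarrow> (real \<Rightarrow> real vec) \<Rightarrow> (real \<Rightarrow> nat \<Rightarrow> nat \<Rightarrow> real) \<Rightarrow> real"
  where "size0 n y u Xh xh = norm_H0 N (y 0) + controller_norm N n0 n (u 0) (Xh 0) (xh 0)"

text \<open>What the finite-dimensional part of the loop provides; all other modes then decay by their own
  dissipation.\<close>

definition controller_estimate ::
    "(nat \<Rightarrow> nat) \<Rightarrow> real \<Rightarrow> (real \<Rightarrow> nat \<Rightarrow> L2) \<Rightarrow> (real \<Rightarrow> real) \<Rightarrow> (real \<Rightarrow> real vec) \<Rightarrow> (real \<Rightarrow> nat \<Rightarrow> nat \<Rightarrow> real) \<Rightarrow> real \<Rightarrow> bool"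
  where "controller_estimate n C y u Xh xh t \<longleftrightarrow>
       \<bar>u t\<bar> \<le> C * size0 n y u Xh xh * exp (- \<delta> * t) \<and>
       (\<forall>p<d. \<bar>Xh t $ p\<bar> \<le> C * size0 n y u Xh xh * exp (- \<delta> * t)) \<and>
       (\<forall>i\<in>{1..N}. \<forall>k<n0 i. \<bar>coef N a i k (lifted (y t) (u t))\<bar> \<le> C * size0 n y u Xh xh * exp (- \<delta> * t)) \<and>
       (\<forall>i\<in>{1..N}. \<forall>k\<in>{n0 i..n i}.
          \<bar>xh t i k - coef N a i k (lifted (y t) (u t))\<bar> \<le> C * size0 n y u Xh xh * exp (- \<delta> * t))"

end

lemma (in closed_loop_run) v_bound:
  assumes "0 \<le> t" "\<And>p. p < d \<Longrightarrow> \<bar>Xh t $ p\<bar> \<le> m" "\<bar>u t\<bar> \<le> m"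
  shows "\<bar>v t\<bar> \<le> Kabs * m"
proof -
  have "\<bar>v t\<bar> \<le> \<bar>\<Sum>q<d. Kx $ q * Xh t $ q\<bar> + \<bar>ku * u t\<bar>" unfolding v_eq[OF assms(1)] by linarith
  also have "\<dots> \<le> (\<Sum>q<d. \<bar>Kx $ q\<bar>) * m + \<bar>ku\<bar> * m"
    using assms by (intro add_mono sum_abs_mult_le) (auto simp: abs_mult intro: mult_left_mono)
  finally show ?thesis by (simp add: Kabs_def distrib_right)
qed

text \<open>The small-gain argument. All constants except \<open>\<tau>\<close> and those derived from it are fixed before the
  orders \<open>n\<close>; \<open>\<tau>\<close> multiplies the initial data only and does not enter the loop gain.\<close>

theorem (in controlled_cascade) controller_decay:
  "\<exists>M. \<forall>n. (\<forall>i\<in>{1..N}. n0 i \<le> n i \<and> M \<le> n i) \<longrightarrow>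
    (\<exists>C\<ge>0. \<forall>y u Xh xh. closed_loop n y u Xh xh \<longrightarrow> (\<forall>t\<ge>0. controller_estimate n C y u Xh xh t))"
proof -
  obtain \<kappa>1 where \<kappa>1: "0 \<le> \<kappa>1" "forced_decay \<delta> d (A1 N a n0 - mat_of_col L * mat_of_row (C1 N a c n0)) \<kappa>1"
    by (rule linear_system_decay[OF observer_matrix(1)[OF L] L_abscissa])
  obtain \<kappa>2 where \<kappa>2: "0 \<le> \<kappa>2" "forced_decay \<delta> (Suc d) (A1a N a n0 - B1a N a n0 * gain_row Kx ku) \<kappa>2"
    by (rule linear_system_decay[OF controller_matrix(1)[OF Kx] K_abscissa])
  note observer = \<kappa>1(2)[unfolded forced_decay_def, rule_format]
  note feedback = \<kappa>2(2)[unfolded forced_decay_def, rule_format]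
  obtain AB where AB: "0 \<le> AB" "\<And>i. i \<in> {1..N} \<Longrightarrow> l2b (\<lambda>k. alpha N a i k) AB" "\<And>i. i \<in> {1..N} \<Longrightarrow> l2b (\<lambda>k. beta N a i k) AB"
    using source_coefficients by auto
  obtain B0 where B0: "0 \<le> B0" "\<And>i y u. i \<in> {1..N} \<Longrightarrow>
      l2b (\<lambda>k. coef N a i k (lifted y u)) (B0 * (norm_H0 N y + \<bar>u\<bar>))"
    using initial_coefficients by auto
  obtain D where D: "0 \<le> D" "\<And>f R. (\<forall>i\<in>{1..N}. l2b (\<lambda>k. coef N a i k f) R) \<Longrightarrow> norm (f 1) \<le> D * R"
    using riesz_lower N by fastforce
  define KK where "KK = Kabs"
  define \<Lambda> where "\<Lambda> = (\<Sum>p<d. \<bar>L $ p\<bar>)"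
  define CC where "CC = (\<Sum>p<d. \<bar>C1 N a c n0 $ p\<bar>)"
  define nc where "nc = norm (L2_of c)"
  have nonneg: "0 \<le> KK" "0 \<le> \<Lambda>" "0 \<le> CC" "0 \<le> nc"
    unfolding KK_def \<Lambda>_def CC_def nc_def by (auto intro!: Kabs_nonneg sum_nonneg)
  \<comment> \<open>The loop gain is \<open>Q * \<eta>\<close>: \<open>Q\<close> does not involve the truncation orders, while \<open>\<eta>\<close>, the gain
    of the neglected modes, is as small as desired.\<close>
  define Q where "Q = (real d + 1) * \<kappa>2 * \<Lambda> * (CC * \<kappa>1 * \<Lambda> + 1) * nc * D * AB * (1 + KK)"
  define \<eta> where "\<eta> = 1 / (2 * (Q + 1))"
  have Q: "0 \<le> Q"
    unfolding Q_def using nonneg \<kappa>1(1) \<kappa>2(1) AB D by (intro mult_nonneg_nonneg add_nonneg_nonneg) auto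
  then have \<eta>: "0 < \<eta>" "Q * \<eta> \<le> 1 / 2" by (auto simp: \<eta>_def field_simps)
  obtain M where M: "\<And>i k. i \<in> {1..N} \<Longrightarrow> M < k \<Longrightarrow> n0 i \<le> k \<Longrightarrow> 1 / gap i k \<le> \<eta>"
    using gap_large[OF \<eta>(1)] by blast
  show ?thesis
  proof (intro exI[of _ M] allI impI)
    fix n :: "nat \<Rightarrow> nat" assume n: "\<forall>i\<in>{1..N}. n0 i \<le> n i \<and> M \<le> n i"
    \<comment> \<open>Bounds the contribution of the tail errors to the output, relative to the initial data.\<close>
    define \<tau> where "\<tau> = obs_tail N n0 n (\<lambda>i k. \<bar>c_coeff a c i k\<bar>) * (1 + B0)"
    have \<tau>: "0 \<le> \<tau>" unfolding \<tau>_def obs_tail_def using B0(1) by (intro mult_nonneg_nonneg sum_nonneg) auto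
    \<comment> \<open>With these constants the loop inequality below reads \<open>m \<le> P * J + Q * \<eta> * m\<close>.\<close>
    define P where "P = (real d + 1) * \<kappa>2 * (1 + \<Lambda> * (CC * \<kappa>1 * ((1 + B0) + \<Lambda> * (\<tau> + nc * D * B0)) + \<tau> + nc * D * B0))"
    have P: "0 \<le> P"
      unfolding P_def using nonneg \<kappa>1(1) \<kappa>2(1) D B0 \<tau> by (intro mult_nonneg_nonneg add_nonneg_nonneg) auto
    define zc where "zc = nc * D * (B0 + \<eta> * AB * (1 + KK) * (2 * P))"
    define r1 where "r1 = (1 + B0) + \<Lambda> * (\<tau> + zc)"
    have zc: "0 \<le> zc" unfolding zc_def using nonneg D B0 \<eta> AB P by (intro mult_nonneg_nonneg add_nonneg_nonneg) auto
    have r1: "0 \<le> r1" unfolding r1_def using nonneg B0 \<tau> zc by (intro mult_nonneg_nonneg add_nonneg_nonneg) auto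
    define C where "C = 2 * P + \<kappa>1 * r1 + (1 + B0)"
    have C: "0 \<le> C" "2 * P \<le> C" "2 * P + \<kappa>1 * r1 \<le> C" "1 + B0 \<le> C"
      unfolding C_def using P r1 \<kappa>1(1) B0 by (auto intro!: add_nonneg_nonneg mult_nonneg_nonneg)
    have main: "controller_estimate n C y u Xh xh t"
      if sol: "closed_loop n y u Xh xh" and t: "0 \<le> t" for y u Xh xh t
    proof -
      interpret R: closed_loop_run N a c \<delta> n0 Kx ku L n y u Xh xh
        by unfold_locales (use n sol in auto)
      define J where "J = size0 n y u Xh xh"
      have H0: "0 \<le> norm_H0 N (y 0)" by (simp add: norm_H0_def sum_nonneg)
      have u0: "\<bar>u 0\<bar> \<le> J" and X0: "\<And>p. p < d \<Longrightarrow> \<bar>Xh 0 $ p\<bar> \<le> J"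
        and x0: "\<And>i k. i \<in> {1..N} \<Longrightarrow> k \<in> {n0 i..n i} \<Longrightarrow> \<bar>xh 0 i k\<bar> \<le> J"
        using controller_norm_bounds[OF R.Xh_carrier[OF order_refl], where u = "u 0" and n = n and x = "xh 0"] H0
        by (auto simp: J_def size0_def intro: add_increasing)
      have J: "0 \<le> J" using u0 by linarith
      have W: "R.w i k s = coef N a i k (lifted (y s) (u s))" for i k s
        by (simp add: R.w_def R.W_def[abs_def])
      have w0: "l2b (\<lambda>k. R.w i k 0) (B0 * J)" if "i \<in> {1..N}" for i
      proof (rule l2b_mono[OF B0(2)[OF that, of "y 0" "u 0"]])
        have "norm_H0 N (y 0) + \<bar>u 0\<bar> \<le> J"
          using controller_norm_bounds(1)[OF R.Xh_carrier[OF order_refl], where u = "u 0" and n = n and x = "xh 0"]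
          by (simp add: J_def size0_def)
        then show "B0 * (norm_H0 N (y 0) + \<bar>u 0\<bar>) \<le> B0 * J" using B0(1) by (intro mult_left_mono)
      qed (simp add: W)
      have w0_le: "\<bar>R.w i k 0\<bar> \<le> B0 * J" if "i \<in> {1..N}" for i k by (rule l2b_member[OF w0[OF that]])
      define E where "E s = exp (- \<delta> * s)" for s
      have E: "0 < E s" for s by (simp add: E_def)
      \<comment> \<open>The weighted size of the finite-dimensional state, and its maximum on \<open>{0..t}\<close>.\<close>
      define X where "X s = exp (\<delta> * s) * (\<bar>u s\<bar> + (\<Sum>p<d. \<bar>Xh s $ p\<bar>))" for s
      have "continuous_on {0..} u"
        by (rule DERIV_continuous_on[OF R.u_deriv]) simp
      moreover have "continuous_on {0..} (\<lambda>s. Xh s $ p)" if "p < d" for p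
        by (rule DERIV_continuous_on[OF R.Xh_deriv_component[OF _ that]]) simp
      ultimately have "continuous_on {0..} X" unfolding X_def by (intro continuous_intros) auto
      then have "continuous_on {0..t} X" by (rule continuous_on_subset) auto
      then obtain s0 where s0: "s0 \<in> {0..t}" "\<And>s. s \<in> {0..t} \<Longrightarrow> X s \<le> X s0"
        using continuous_attains_sup[of "{0..t}" X] t by auto
      define m where "m = X s0"
      have m: "0 \<le> m" unfolding m_def X_def by (intro mult_nonneg_nonneg add_nonneg_nonneg sum_nonneg) auto
      have Xm: "\<bar>u s\<bar> + (\<Sum>p<d. \<bar>Xh s $ p\<bar>) \<le> m * E s" if "s \<in> {0..t}" for s
      proof -
        have "\<bar>u s\<bar> + (\<Sum>p<d. \<bar>Xh s $ p\<bar>) = X s * E s" by (simp add: X_def E_def exp_minus field_simps)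
        then show ?thesis using s0(2)[OF that] E[of s] by (simp add: m_def)
      qed
      have sum_nn: "0 \<le> (\<Sum>p<d. \<bar>Xh s $ p\<bar>)" for s by (intro sum_nonneg) auto
      have um: "\<bar>u s\<bar> \<le> m * E s" if "s \<in> {0..t}" for s
        using Xm[OF that] sum_nn[of s] by linarith
      have Xhm: "\<bar>Xh s $ p\<bar> \<le> m * E s" if "s \<in> {0..t}" "p < d" for s p
      proof -
        have "\<bar>Xh s $ p\<bar> \<le> (\<Sum>p<d. \<bar>Xh s $ p\<bar>)" using that(2) by (intro member_le_sum[of p "{..<d}" "\<lambda>p. \<bar>Xh s $ p\<bar>"]) auto
        then show ?thesis using Xm[OF that(1)] by linarith
      qed
      have vm: "\<bar>R.v s\<bar> \<le> (KK * m) * E s" if "s \<in> {0..t}" for s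
        using R.v_bound[of s "m * E s"] um[OF that] Xhm[OF that] that by (simp add: KK_def mult.assoc)
      define Z where "Z = nc * D * (B0 * J + \<eta> * AB * (1 + KK) * m)"
      have Z0: "0 \<le> Z" unfolding Z_def using nonneg D B0 J \<eta> AB m by (intro mult_nonneg_nonneg add_nonneg_nonneg) auto
      have \<zeta>: "\<bar>inner (L2_of c) (R.rest s 1)\<bar> \<le> Z * E s" if s: "s \<in> {0..t}" for s
      proof -
        have "l2b (\<lambda>k. coef N a i k (R.rest s)) (E s * (B0 * J + \<eta> * AB * (1 + KK) * m))" if i: "i \<in> {1..N}" for i
        proof (rule l2b_mono)
          have "l2b (\<lambda>k. \<bar>R.w i k 0\<bar>) (B0 * J)" "l2b (\<lambda>k. \<bar>alpha N a i k\<bar>) AB" "l2b (\<lambda>k. \<bar>beta N a i k\<bar>) AB"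
            by (rule l2b_mono[OF w0[OF i]] l2b_mono[OF AB(2)[OF i]] l2b_mono[OF AB(3)[OF i]]; simp)+
          then show "l2b (\<lambda>k. E s * (\<bar>R.w i k 0\<bar> + \<eta> * (m * \<bar>alpha N a i k\<bar> + (KK * m) * \<bar>beta N a i k\<bar>)))
              (\<bar>E s\<bar> * (B0 * J + \<bar>\<eta>\<bar> * (\<bar>m\<bar> * AB + \<bar>KK * m\<bar> * AB)))"
            by (intro l2b_scale[of _ _ "E s"] l2b_add l2b_scale[of _ _ \<eta>] l2b_scale[of _ _ m] l2b_scale[of _ _ "KK * m"])
          show "\<bar>E s\<bar> * (B0 * J + \<bar>\<eta>\<bar> * (\<bar>m\<bar> * AB + \<bar>KK * m\<bar> * AB)) \<le> E s * (B0 * J + \<eta> * AB * (1 + KK) * m)"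
            using E[of s] \<eta>(1) m nonneg(1) by (simp add: abs_mult algebra_simps)
          fix k
          show "\<bar>coef N a i k (R.rest s)\<bar> \<le> \<bar>E s * (\<bar>R.w i k 0\<bar> + \<eta> * (m * \<bar>alpha N a i k\<bar> + (KK * m) * \<bar>beta N a i k\<bar>))\<bar>"
          proof (cases "k \<le> n i")
            case False
            moreover have "n0 i \<le> n i" "M \<le> n i" using n i by blast+
            ultimately have k: "n0 i \<le> k" "M < k" by linarith+
            have src: "0 \<le> \<bar>alpha N a i k\<bar> * m + \<bar>beta N a i k\<bar> * (KK * m)" using m nonneg by simp
            have "\<bar>R.w i k s\<bar> \<le> exp (- \<delta> * s) * (\<bar>R.w i k 0\<bar> + (\<bar>alpha N a i k\<bar> * m + \<bar>beta N a i k\<bar> * (KK * m)) / gap i k)"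
              using um vm by (intro R.mode_bound[OF i k(1) s]) (auto simp: E_def)
            also have "(\<bar>alpha N a i k\<bar> * m + \<bar>beta N a i k\<bar> * (KK * m)) / gap i k \<le> (\<bar>alpha N a i k\<bar> * m + \<bar>beta N a i k\<bar> * (KK * m)) * \<eta>"
              using mult_left_mono[OF M[OF i k(2,1)] src] by simp
            finally have "\<bar>R.w i k s\<bar> \<le> E s * (\<bar>R.w i k 0\<bar> + \<eta> * (m * \<bar>alpha N a i k\<bar> + (KK * m) * \<bar>beta N a i k\<bar>))"
              by (simp add: E_def mult_ac)
            then show ?thesis using False R.coef_rest[OF i] by simp
          qed (use R.coef_rest[OF i] in simp)
        qed
        then have "norm (R.rest s 1) \<le> D * (E s * (B0 * J + \<eta> * AB * (1 + KK) * m))" by (intro D(2)) auto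
        then have "nc * norm (R.rest s 1) \<le> nc * (D * (E s * (B0 * J + \<eta> * AB * (1 + KK) * m)))"
          using nonneg by (intro mult_left_mono) auto
        then show ?thesis
          using Cauchy_Schwarz_ineq2[of "L2_of c" "R.rest s 1"] by (simp add: Z_def nc_def mult_ac)
      qed
      have tail0: "\<bar>R.tail_err i k 0\<bar> \<le> (1 + B0) * J" if "i \<in> {1..N}" "k \<in> {n0 i..n i}" for i k
        unfolding R.tail_err_def using x0[OF that] w0_le[OF that(1), of k] by (simp add: distrib_right)
      have tail: "\<bar>R.tail_err i k s\<bar> \<le> (1 + B0) * J * E s" if "i \<in> {1..N}" "k \<in> {n0 i..n i}" "0 \<le> s" for i k s
      proof -
        have "\<bar>R.tail_err i k s\<bar> \<le> E s * \<bar>R.tail_err i k 0\<bar>"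
          using R.tail_err_bound[OF that] by (simp add: E_def)
        also have "\<dots> \<le> E s * ((1 + B0) * J)"
          using tail0[OF that(1,2)] E[of s] by (intro mult_left_mono) auto
        finally show ?thesis by (simp only: mult.commute)
      qed
      have tail_sum: "\<bar>obs_tail N n0 n (\<lambda>i k. c_coeff a c i k * R.tail_err i k s)\<bar> \<le> \<tau> * J * E s" if "0 \<le> s" for s
        using obs_tail_mult_le[of N n0 n "\<lambda>i k. R.tail_err i k s" "(1 + B0) * J * E s" "\<lambda>i k. c_coeff a c i k"] tail that
        by (simp add: \<tau>_def mult.assoc)
      have Lle: "\<bar>L $ p\<bar> \<le> \<Lambda>" if "p < d" for p
        unfolding \<Lambda>_def using that by (intro member_le_sum[of p "{..<d}" "\<lambda>p. \<bar>L $ p\<bar>"]) auto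
      define R1 where "R1 = (1 + B0) * J + \<Lambda> * (\<tau> * J + Z)"
      have R1: "0 \<le> \<Lambda> * (\<tau> * J + Z)" "0 \<le> (1 + B0) * J" "0 \<le> R1"
        unfolding R1_def using nonneg \<tau> J Z0 B0 by (auto intro!: mult_nonneg_nonneg add_nonneg_nonneg)
      have err: "\<bar>R.err p s\<bar> \<le> \<kappa>1 * R1 * E s" if s: "s \<in> {0..t}" and p: "p < d" for s p
      proof -
        have "\<bar>R.err p s\<bar> \<le> \<kappa>1 * exp (- \<delta> * s) * R1"
        proof (rule observer[where x = "\<lambda>s p. R.err p s" and T = t and
              g = "\<lambda>s p. - L $ p * (R.innov s - (\<Sum>q<d. C1 N a c n0 $ q * R.err q s))"])
          fix s p assume s: "s \<in> {0..t}" and p: "p < d"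
          show "((\<lambda>s. R.err p s) has_real_derivative
              (\<Sum>q<d. (A1 N a n0 - mat_of_col L * mat_of_row (C1 N a c n0)) $$ (p, q) * R.err q s)
              + - L $ p * (R.innov s - (\<Sum>q<d. C1 N a c n0 $ q * R.err q s))) (at s within {0..t})"
            using s by (intro DERIV_subset[OF R.err_deriv] p) auto
          have "\<bar>R.innov s - (\<Sum>q<d. C1 N a c n0 $ q * R.err q s)\<bar> \<le> \<tau> * J * E s + Z * E s"
            using R.innov_eq[of s] tail_sum[of s] \<zeta>[OF s] s by simp
          then have "\<bar>L $ p\<bar> * \<bar>R.innov s - (\<Sum>q<d. C1 N a c n0 $ q * R.err q s)\<bar> \<le> \<Lambda> * (\<tau> * J * E s + Z * E s)"
            using Lle[OF p] nonneg by (intro mult_mono) auto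
          also have "\<dots> = \<Lambda> * (\<tau> * J + Z) * E s" by (simp add: algebra_simps)
          also have "\<dots> \<le> R1 * E s" unfolding R1_def using R1(2) E[of s] by (intro mult_right_mono) auto
          finally show "\<bar>- L $ p * (R.innov s - (\<Sum>q<d. C1 N a c n0 $ q * R.err q s))\<bar> \<le> R1 * exp (- \<delta> * s)"
            by (simp add: abs_mult E_def)
        next
          fix p assume p: "p < d"
          have "\<bar>R.err p 0\<bar> \<le> J + B0 * J"
            unfolding R.err_def using X0[OF p] w0_le[OF mode_list_nth(1)[OF p], of "mk p"] by linarith
          then show "\<bar>R.err p 0\<bar> \<le> R1" using R1(1) by (simp add: R1_def algebra_simps)
        qed (use R1 s p in auto)
        then show ?thesis by (simp add: E_def mult_ac)
      qed
      define I where "I = CC * (\<kappa>1 * R1) + \<tau> * J + Z"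
      have I0: "0 \<le> I" unfolding I_def using nonneg \<kappa>1(1) R1 \<tau> J Z0 by (intro add_nonneg_nonneg mult_nonneg_nonneg) auto
      have innov: "\<bar>R.innov s\<bar> \<le> I * E s" if s: "s \<in> {0..t}" for s
      proof -
        have "\<bar>\<Sum>p<d. C1 N a c n0 $ p * R.err p s\<bar> \<le> CC * (\<kappa>1 * R1 * E s)"
          unfolding CC_def using err[OF s] by (intro sum_abs_mult_le)
        then show ?thesis
          using R.innov_eq[of s] tail_sum[of s] \<zeta>[OF s] s by (simp add: I_def algebra_simps)
      qed
      define R2 where "R2 = J + \<Lambda> * I"
      have R2: "0 \<le> \<Lambda> * I" "0 \<le> R2" unfolding R2_def using nonneg I0 J by auto
      have x_s0: "\<bar>R.x s0 p\<bar> \<le> \<kappa>2 * R2 * E s0" if p: "p < Suc d" for p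
      proof -
        have "\<bar>R.x s0 p\<bar> \<le> \<kappa>2 * exp (- \<delta> * s0) * R2"
        proof (rule feedback[where T = t and g = "\<lambda>s p. if p < d then - L $ p * R.innov s else 0"])
          fix s p assume s: "s \<in> {0..t}" and p: "p < Suc d"
          then show "((\<lambda>s. R.x s p) has_real_derivative
              (\<Sum>q<Suc d. (A1a N a n0 - B1a N a n0 * gain_row Kx ku) $$ (p, q) * R.x s q)
              + (if p < d then - L $ p * R.innov s else 0)) (at s within {0..t})"
            by (intro DERIV_subset[OF R.x_deriv]) auto
          have "\<bar>L $ p\<bar> * \<bar>R.innov s\<bar> \<le> R2 * E s" if "p < d"
          proof -
            have "\<bar>L $ p\<bar> * \<bar>R.innov s\<bar> \<le> \<Lambda> * (I * E s)"
              using Lle[OF that] innov[OF s] nonneg by (intro mult_mono) auto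
            also have "\<dots> \<le> R2 * E s" unfolding R2_def mult.assoc[symmetric] using J E[of s] by (intro mult_right_mono) auto
            finally show ?thesis .
          qed
          then show "\<bar>if p < d then - L $ p * R.innov s else 0\<bar> \<le> R2 * exp (- \<delta> * s)"
            using R2(2) by (auto simp: abs_mult E_def)
        next
          fix p show "\<bar>R.x 0 p\<bar> \<le> R2"
          proof (cases "p < d")
            case True
            then show ?thesis using X0[OF True] R2(1) by (simp add: R.x_def R2_def)
          next
            case False
            then show ?thesis using u0 R2(1) by (simp add: R.x_def R2_def)
          qed
        qed (use R2 s0 p in auto)
        then show ?thesis by (simp add: E_def mult_ac)
      qed
      have "\<bar>u s0\<bar> + (\<Sum>p<d. \<bar>Xh s0 $ p\<bar>) = (\<Sum>p<Suc d. \<bar>R.x s0 p\<bar>)" by (simp add: R.x_def)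
      also have "\<dots> \<le> (\<Sum>p<Suc d. \<kappa>2 * R2 * E s0)" using x_s0 by (intro sum_mono) auto
      finally have "X s0 \<le> exp (\<delta> * s0) * ((real d + 1) * (\<kappa>2 * R2 * E s0))"
        unfolding X_def by (intro mult_left_mono) (auto simp: algebra_simps)
      also have "\<dots> = (real d + 1) * \<kappa>2 * R2" by (simp add: E_def exp_minus field_simps)
      also have "\<dots> = P * J + Q * \<eta> * m"
      proof -
        define G where "G = nc * D * AB * (1 + KK) * \<eta> * m"
        define h where "h = (1 + B0) + \<Lambda> * (\<tau> + nc * D * B0)"
        have Z: "Z = nc * D * B0 * J + G" by (simp add: Z_def G_def algebra_simps)
        have R1: "R1 = h * J + \<Lambda> * G" by (simp add: R1_def h_def Z algebra_simps)
        have "I = (CC * \<kappa>1 * h + \<tau> + nc * D * B0) * J + (CC * \<kappa>1 * \<Lambda> + 1) * G"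
          by (simp add: I_def R1 Z algebra_simps)
        moreover define r2 where "r2 = 1 + \<Lambda> * (CC * \<kappa>1 * h + \<tau> + nc * D * B0)"
        ultimately have "R2 = r2 * J + \<Lambda> * (CC * \<kappa>1 * \<Lambda> + 1) * G"
          by (simp add: R2_def algebra_simps)
        moreover have "P = (real d + 1) * \<kappa>2 * r2" by (simp only: P_def r2_def h_def)
        moreover have "e * (r2 * J + g) = e * r2 * J + e * g" for e g :: real by (simp only: distrib_left mult.assoc)
        ultimately have "(real d + 1) * \<kappa>2 * R2 = P * J + (real d + 1) * \<kappa>2 * (\<Lambda> * (CC * \<kappa>1 * \<Lambda> + 1) * G)"
          by (simp only:)
        then show ?thesis by (simp add: Q_def G_def mult_ac)
      qed
      finally have "m \<le> P * J + Q * \<eta> * m" by (simp add: m_def)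
      moreover have "Q * \<eta> * m \<le> 1 / 2 * m" using \<eta>(2) m by (intro mult_right_mono)
      ultimately have mP: "m \<le> 2 * P * J" by simp
      have "Z \<le> nc * D * (B0 * J + \<eta> * AB * (1 + KK) * (2 * P * J))"
        unfolding Z_def using mP nonneg D \<eta> AB by (intro mult_left_mono add_left_mono mult_nonneg_nonneg) auto
      also have "\<dots> = zc * J" unfolding zc_def by (simp add: algebra_simps)
      finally have "R1 \<le> (1 + B0) * J + \<Lambda> * (\<tau> * J + zc * J)"
        unfolding R1_def using nonneg by (intro add_left_mono mult_left_mono) auto
      also have "\<dots> = r1 * J" by (simp add: r1_def algebra_simps)
      finally have R1_le: "\<kappa>1 * R1 \<le> \<kappa>1 * r1 * J" using \<kappa>1(1) by (simp add: mult.assoc mult_left_mono)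
      have tt: "t \<in> {0..t}" using t by simp
      have mC: "m * E t \<le> C * J * E t"
        using order_trans[OF mP mult_right_mono[OF C(2) J]] E[of t] by (simp add: mult.commute)
      have 1: "\<bar>u t\<bar> \<le> C * J * E t" using um[OF tt] mC by linarith
      have 2: "\<bar>Xh t $ p\<bar> \<le> C * J * E t" if "p < d" for p using Xhm[OF tt that] mC by linarith
      have 3: "\<bar>coef N a i k (lifted (y t) (u t))\<bar> \<le> C * J * E t" if ik: "i \<in> {1..N}" "k < n0 i" for i k
      proof -
        obtain p where p: "p < d" "mode_list N n0 ! p = (i, k)" using mode_list_surj[of i N k n0] ik by blast
        have "\<bar>R.w i k t\<bar> \<le> \<bar>Xh t $ p\<bar> + \<bar>R.err p t\<bar>" using p by (simp add: R.err_def)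
        also have "\<dots> \<le> m * E t + \<kappa>1 * R1 * E t" by (intro add_mono Xhm[OF tt p(1)] err[OF tt p(1)])
        also have "\<dots> \<le> C * J * E t"
        proof -
          have "m + \<kappa>1 * R1 \<le> C * J"
            using mP R1_le mult_right_mono[OF C(3) J] unfolding distrib_right by linarith
          then have "(m + \<kappa>1 * R1) * E t \<le> C * J * E t" using E[of t] by (intro mult_right_mono) auto
          then show ?thesis by (simp only: distrib_right)
        qed
        finally show ?thesis by (simp add: W)
      qed
      have 4: "\<bar>xh t i k - coef N a i k (lifted (y t) (u t))\<bar> \<le> C * J * E t"
        if "i \<in> {1..N}" "k \<in> {n0 i..n i}" for i k
      proof -
        have "\<bar>R.tail_err i k t\<bar> \<le> (1 + B0) * J * E t" by (rule tail[OF that t])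
        also have "\<dots> \<le> C * J * E t" using C(4) J E[of t] by (intro mult_right_mono) auto
        finally show ?thesis by (simp add: R.tail_err_def W)
      qed
      from 1 2 3 4 show ?thesis unfolding controller_estimate_def J_def E_def by blast
    qed
    show "\<exists>C\<ge>0. \<forall>y u Xh xh. closed_loop n y u Xh xh \<longrightarrow> (\<forall>t\<ge>0. controller_estimate n C y u Xh xh t)"
      using C(1) main by blast
  qed
qed

context controlled_cascade
begin

lemma size0_nonneg:
  assumes "closed_loop n y u Xh xh"
  shows "0 \<le> size0 n y u Xh xh" "norm_H0 N (y 0) + \<bar>u 0\<bar> \<le> size0 n y u Xh xh"
proof -
  have "Xh 0 \<in> carrier_vec d" using assms by (auto simp: closed_loop_solution_def Let_def)
  from controller_norm_bounds(1)[OF this, of "u 0" n "xh 0"]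
  have cn: "\<bar>u 0\<bar> \<le> controller_norm N n0 n (u 0) (Xh 0) (xh 0)" .
  moreover have "0 \<le> norm_H0 N (y 0)" by (simp add: norm_H0_def sum_nonneg)
  ultimately show "0 \<le> size0 n y u Xh xh" "norm_H0 N (y 0) + \<bar>u 0\<bar> \<le> size0 n y u Xh xh"
    by (simp_all add: size0_def)
qed

definition modes_estimate ::
    "(nat \<Rightarrow> nat) \<Rightarrow> real \<Rightarrow> (real \<Rightarrow> nat \<Rightarrow> L2) \<Rightarrow> (real \<Rightarrow> real) \<Rightarrow> (real \<Rightarrow> real vec) \<Rightarrow> (real \<Rightarrow> nat \<Rightarrow> nat \<Rightarrow> real) \<Rightarrow> bool"
  where "modes_estimate n K y u Xh xh \<longleftrightarrow>
    (\<forall>t \<omega> R0. 0 \<le> t \<longrightarrow> (\<forall>k. 0 \<le> \<omega> k \<and> \<omega> k \<le> real k + 1) \<longrightarrow>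
      (\<forall>i\<in>{1..N}. l2b (\<lambda>k. \<omega> k * coef N a i k (lifted (y 0) (u 0))) R0) \<longrightarrow>
      (\<forall>i\<in>{1..N}. l2b (\<lambda>k. \<omega> k * coef N a i k (lifted (y t) (u t)))
        (exp (- \<delta> * t) * (R0 + K * size0 n y u Xh xh))))"

text \<open>The head modes are controlled by the observer, the others by their own dissipation; the weight
  is \<open>1\<close> for the estimate in the mean-square norm and \<open>k\<close> for the one in the energy norm.\<close>

lemma weighted_modes_decay:
  assumes C: "0 \<le> C"
  shows "\<exists>K\<ge>0. \<forall>n y u Xh xh.
    (\<forall>i\<in>{1..N}. n0 i \<le> n i) \<longrightarrow> closed_loop n y u Xh xh \<longrightarrow>
    (\<forall>s\<ge>0. controller_estimate n C y u Xh xh s) \<longrightarrow>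
    modes_estimate n K y u Xh xh"
proof -
  obtain AB where AB: "0 \<le> AB" "\<And>i. i \<in> {1..N} \<Longrightarrow> l2b (\<lambda>k. alpha N a i k) AB" "\<And>i. i \<in> {1..N} \<Longrightarrow> l2b (\<lambda>k. beta N a i k) AB"
    using source_coefficients by auto
  obtain G where G: "0 \<le> G" "\<And>i k. i \<in> {1..N} \<Longrightarrow> n0 i \<le> k \<Longrightarrow> (real k + 1) / gap i k \<le> G"
    using gap_growth by blast
  define H where "H = (\<Sum>i=1..N. \<Sum>k<n0 i. real k + 1)"
  have H0: "0 \<le> H" unfolding H_def by (intro sum_nonneg) auto
  define K where "K = G * AB * (1 + Kabs) * C + H * C"
  have K: "0 \<le> K" unfolding K_def using G AB C H0 Kabs_nonneg by (intro mult_nonneg_nonneg add_nonneg_nonneg) auto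
  show ?thesis
  proof (rule exI[of _ K], rule conjI[OF K], intro allI impI)
    fix n y u Xh xh
    assume n: "\<forall>i\<in>{1..N}. n0 i \<le> n i" and sol: "closed_loop n y u Xh xh"
      and est: "\<forall>s\<ge>0. controller_estimate n C y u Xh xh s"
    show "modes_estimate n K y u Xh xh"
      unfolding modes_estimate_def
    proof (intro allI impI ballI)
      fix t :: real and \<omega> :: "nat \<Rightarrow> real" and R0 :: real and i
      assume t: "0 \<le> t" and \<omega>: "\<forall>k. 0 \<le> \<omega> k \<and> \<omega> k \<le> real k + 1"
        and R0: "\<forall>i\<in>{1..N}. l2b (\<lambda>k. \<omega> k * coef N a i k (lifted (y 0) (u 0))) R0"
        and i: "i \<in> {1..N}"
      note dec = est[unfolded controller_estimate_def]
      interpret R: closed_loop_run N a c \<delta> n0 Kx ku L n y u Xh xh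
        by unfold_locales (use n sol in auto)
      define J where "J = size0 n y u Xh xh"
      have J: "0 \<le> J" unfolding J_def by (rule size0_nonneg[OF sol])
      define E where "E = exp (- \<delta> * t)"
      have E: "0 < E" by (simp add: E_def)
      have W: "R.w i k s = coef N a i k (lifted (y s) (u s))" for k s
        by (simp add: R.w_def R.W_def[abs_def])
      define head where "head k = (if k < n0 i then (real k + 1) * (C * J) else 0)" for k
      define f where "f k = E * (\<bar>\<omega> k * R.w i k 0\<bar> + G * (C * J * \<bar>alpha N a i k\<bar> + Kabs * (C * J) * \<bar>beta N a i k\<bar>) + head k)" for k
      have CJ: "0 \<le> C * J" "0 \<le> Kabs * (C * J)" using C J Kabs_nonneg by auto
      have head_nn: "0 \<le> head k" for k using CJ by (simp add: head_def)
      have "l2b head (\<Sum>k<n0 i. \<bar>head k\<bar>)"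
        by (rule l2b_finite_support) (simp add: head_def)
      moreover have "(\<Sum>k<n0 i. \<bar>head k\<bar>) \<le> H * (C * J)"
      proof -
        have "(\<Sum>k<n0 i. \<bar>head k\<bar>) = (\<Sum>k<n0 i. real k + 1) * (C * J)"
          unfolding sum_distrib_right by (intro sum.cong) (auto simp only: abs_of_nonneg[OF head_nn], auto simp: head_def)
        also have "(\<Sum>k<n0 i. real k + 1) \<le> H"
          unfolding H_def using i by (intro member_le_sum[of i "{1..N}" "\<lambda>i. \<Sum>k<n0 i. real k + 1"]) (auto intro!: sum_nonneg add_nonneg_nonneg)
        finally show ?thesis using CJ(1) by (simp add: mult_right_mono)
      qed
      ultimately have head: "l2b head (H * (C * J))"
        using l2b_mono[of head "\<Sum>k<n0 i. \<bar>head k\<bar>" head "H * (C * J)"] by simp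
      have l2: "l2b (\<lambda>k. \<bar>\<omega> k * R.w i k 0\<bar>) R0" "l2b (\<lambda>k. \<bar>alpha N a i k\<bar>) AB" "l2b (\<lambda>k. \<bar>beta N a i k\<bar>) AB"
        by (rule l2b_mono[OF R0[rule_format, OF i]] l2b_mono[OF AB(2)[OF i]] l2b_mono[OF AB(3)[OF i]]; simp add: W)+
      have "l2b f (\<bar>E\<bar> * (R0 + \<bar>G\<bar> * (\<bar>C * J\<bar> * AB + \<bar>Kabs * (C * J)\<bar> * AB) + H * (C * J)))"
        unfolding f_def
        by (intro l2b_scale[of _ _ E] l2b_add l2b_scale[of _ _ G] l2b_scale[of _ _ "C * J"] l2b_scale[of _ _ "Kabs * (C * J)"] l2 head)
      also have "\<bar>E\<bar> * (R0 + \<bar>G\<bar> * (\<bar>C * J\<bar> * AB + \<bar>Kabs * (C * J)\<bar> * AB) + H * (C * J)) = E * (R0 + K * J)"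
        using E G(1) C J Kabs_nonneg by (simp add: K_def abs_mult algebra_simps)
      finally have f: "l2b f (E * (R0 + K * J))" .
      show "l2b (\<lambda>k. \<omega> k * coef N a i k (lifted (y t) (u t))) (exp (- \<delta> * t) * (R0 + K * size0 n y u Xh xh))"
      proof (rule l2b_mono[OF f])
        fix k
        have \<omega>k: "0 \<le> \<omega> k" "\<omega> k \<le> real k + 1" using \<omega> by auto
        have src: "0 \<le> \<bar>alpha N a i k\<bar> * (C * J) + \<bar>beta N a i k\<bar> * (Kabs * (C * J))" using C J Kabs_nonneg by (intro add_nonneg_nonneg mult_nonneg_nonneg) auto
        have "\<omega> k * \<bar>R.w i k t\<bar> \<le> f k"
        proof (cases "k < n0 i")
          case True
          have "\<bar>R.w i k t\<bar> \<le> C * J * E" using dec t i True by (auto simp: W J_def E_def)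
          then have "\<omega> k * \<bar>R.w i k t\<bar> \<le> (real k + 1) * (C * J * E)" using \<omega>k by (intro mult_mono) auto
          also have "\<dots> = E * head k" using True by (simp add: head_def)
          also have "\<dots> \<le> f k"
            unfolding f_def using E G(1) CJ by (intro mult_left_mono) (auto intro!: add_nonneg_nonneg mult_nonneg_nonneg)
          finally show ?thesis .
        next
          case False
          then have k: "n0 i \<le> k" by simp
          have "\<bar>R.w i k t\<bar> \<le> exp (- \<delta> * t) * (\<bar>R.w i k 0\<bar> + (\<bar>alpha N a i k\<bar> * (C * J) + \<bar>beta N a i k\<bar> * (Kabs * (C * J))) / gap i k)"
          proof (rule R.mode_bound[OF i k, of t t])
            show "t \<in> {0..t}" using t by simp
            fix s assume s: "s \<in> {0..t}"
            show "\<bar>u s\<bar> \<le> C * J * exp (- \<delta> * s)" using dec s by (simp add: J_def)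
            show "\<bar>R.v s\<bar> \<le> Kabs * (C * J) * exp (- \<delta> * s)"
              using R.v_bound[of s "C * J * exp (- \<delta> * s)"] dec s by (simp add: J_def mult.assoc)
          qed
          then have "\<omega> k * \<bar>R.w i k t\<bar> \<le> \<omega> k * (E * (\<bar>R.w i k 0\<bar> + (\<bar>alpha N a i k\<bar> * (C * J) + \<bar>beta N a i k\<bar> * (Kabs * (C * J))) / gap i k))"
            unfolding E_def using \<omega>k by (intro mult_left_mono)
          also have "\<dots> = E * (\<bar>\<omega> k * R.w i k 0\<bar> + (\<bar>alpha N a i k\<bar> * (C * J) + \<bar>beta N a i k\<bar> * (Kabs * (C * J))) * (\<omega> k / gap i k))"
          proof -
            have "\<omega> k * (E * (p + S / g)) = E * (\<omega> k * p + S * (\<omega> k / g))" for p S g :: real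
              by (simp add: algebra_simps)
            then show ?thesis by (simp only: abs_mult abs_of_nonneg[OF \<omega>k(1)])
          qed
          also have "\<dots> \<le> E * (\<bar>\<omega> k * R.w i k 0\<bar> + (\<bar>alpha N a i k\<bar> * (C * J) + \<bar>beta N a i k\<bar> * (Kabs * (C * J))) * G)"
          proof -
            have "\<omega> k / gap i k \<le> (real k + 1) / gap i k" using \<omega>k gap_pos[OF i k] by (intro divide_right_mono) auto
            then have "\<omega> k / gap i k \<le> G" using G(2)[OF i k] by linarith
            then show ?thesis using E src by (intro mult_left_mono add_left_mono) auto
          qed
          also have "\<dots> \<le> f k"
            unfolding f_def using E head_nn[of k] by (intro mult_left_mono) (auto simp: mult_ac distrib_left)
          finally show ?thesis .
        qed
        then show "\<bar>\<omega> k * coef N a i k (lifted (y t) (u t))\<bar> \<le> \<bar>f k\<bar>"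
          using \<omega>k by (simp add: abs_mult W[symmetric])
      qed (simp add: E_def J_def)
    qed
  qed
qed

text \<open>The inverse bounds of the Riesz basis turn the decay of the modes into decay of \<open>y\<close> minus \<open>u\<close> times the
  lifting, and \<open>u\<close> is already known to decay.\<close>

theorem closed_loop_decay:
  "\<exists>M. \<forall>n. (\<forall>i\<in>{1..N}. n0 i \<le> n i \<and> M \<le> n i) \<longrightarrow>
    (\<exists>C>0. \<forall>y u Xh xh. closed_loop n y u Xh xh \<longrightarrow>
       (\<forall>t\<ge>0. norm_H0 N (y t) + controller_norm N n0 n (u t) (Xh t) (xh t)
          \<le> C * exp (- \<delta> * t)
              * (norm_H0 N (y 0) + controller_norm N n0 n (u 0) (Xh 0) (xh 0)))) \<and>
    (\<exists>C>0. \<forall>y u Xh xh. closed_loop n y u Xh xh \<longrightarrow>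
       cascade_dom N (y 0) (u 0) \<longrightarrow>
       (\<forall>t\<ge>0. (\<forall>j\<in>{1..N}. y t j \<in> H1) \<and>
          norm_H1 N (y t) + controller_norm N n0 n (u t) (Xh t) (xh t)
          \<le> C * exp (- \<delta> * t)
              * (norm_H1 N (y 0) + controller_norm N n0 n (u 0) (Xh 0) (xh 0))))"
  (is "\<exists>M. \<forall>n. ?large M n \<longrightarrow> ?mean_square n \<and> ?energy n")
proof -
  obtain B0 where B0: "0 \<le> B0" "\<And>i y u. i \<in> {1..N} \<Longrightarrow>
      l2b (\<lambda>k. coef N a i k (lifted y u)) (B0 * (norm_H0 N y + \<bar>u\<bar>))"
    using initial_coefficients by auto
  obtain B1 where B1: "0 \<le> B1" "\<And>i y u. i \<in> {1..N} \<Longrightarrow> (\<forall>j\<in>{1..N}. y j \<in> H1) \<Longrightarrow>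
      l2b (\<lambda>k. real k * coef N a i k (lifted y u)) (B1 * (norm_H1 N y + \<bar>u\<bar>))"
    using initial_coefficients_H1 by auto
  obtain D0 where D0: "0 \<le> D0" "\<And>f R j. (\<forall>i\<in>{1..N}. l2b (\<lambda>k. coef N a i k f) R) \<Longrightarrow> j \<in> {1..N} \<Longrightarrow> norm (f j) \<le> D0 * R"
    using riesz_lower by auto
  obtain D1 where D1: "0 \<le> D1" "\<And>f R j. (\<forall>i\<in>{1..N}. l2b (\<lambda>k. coef N a i k f) R \<and> l2b (\<lambda>k. real k * coef N a i k f) R) \<Longrightarrow>
      j \<in> {1..N} \<Longrightarrow> f j \<in> H1 \<and> norm (f j) + norm (weak_deriv (f j)) \<le> D1 * R"
    using riesz_lower_H1 by auto
  define \<Sigma>L where "\<Sigma>L = (\<Sum>j=1..N. norm (Lift j) + norm (weak_deriv (Lift j)))"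
  have \<Sigma>L: "0 \<le> \<Sigma>L" unfolding \<Sigma>L_def by (intro sum_nonneg) auto
  obtain M where M: "\<And>n. (\<forall>i\<in>{1..N}. n0 i \<le> n i \<and> M \<le> n i) \<Longrightarrow>
    \<exists>C\<ge>0. \<forall>y u Xh xh. closed_loop n y u Xh xh \<longrightarrow> (\<forall>t\<ge>0. controller_estimate n C y u Xh xh t)"
    using controller_decay by blast
  show ?thesis
  proof (intro exI[of _ M] allI impI)
    fix n assume n: "\<forall>i\<in>{1..N}. n0 i \<le> n i \<and> M \<le> n i"
    obtain C where C: "0 \<le> C" and est: "\<And>y u Xh xh t. closed_loop n y u Xh xh \<Longrightarrow> 0 \<le> t \<Longrightarrow> controller_estimate n C y u Xh xh t"
      using M[OF n] by blast
    note dec = est[unfolded controller_estimate_def]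
    have n': "\<forall>i\<in>{1..N}. n0 i \<le> n i" using n by blast
    obtain K where K: "0 \<le> K" "\<And>y u Xh xh t \<omega> R0 i.
      closed_loop n y u Xh xh \<Longrightarrow> 0 \<le> t \<Longrightarrow> (\<forall>k. 0 \<le> \<omega> k \<and> \<omega> k \<le> real k + 1) \<Longrightarrow>
      (\<forall>i\<in>{1..N}. l2b (\<lambda>k. \<omega> k * coef N a i k (lifted (y 0) (u 0))) R0) \<Longrightarrow> i \<in> {1..N} \<Longrightarrow>
      l2b (\<lambda>k. \<omega> k * coef N a i k (lifted (y t) (u t))) (exp (- \<delta> * t) * (R0 + K * size0 n y u Xh xh))"
    proof -
      obtain K where K: "0 \<le> K" and KK: "\<And>n y u Xh xh. (\<forall>i\<in>{1..N}. n0 i \<le> n i) \<Longrightarrow>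
          closed_loop n y u Xh xh \<Longrightarrow> \<forall>s\<ge>0. controller_estimate n C y u Xh xh s \<Longrightarrow>
          modes_estimate n K y u Xh xh"
        using weighted_modes_decay[OF C] by blast
      have "modes_estimate n K y u Xh xh" if "closed_loop n y u Xh xh" for y u Xh xh
        using KK[OF n' that] est[OF that] by blast
      then show ?thesis by (intro that[OF K]) (simp add: modes_estimate_def)
    qed
    have modes: "l2b (\<lambda>k. coef N a i k (lifted (y t) (u t))) (exp (- \<delta> * t) * ((B0 + K) * size0 n y u Xh xh))"
      if sol: "closed_loop n y u Xh xh" and t: "0 \<le> t" and i: "i \<in> {1..N}" for y u Xh xh t i
    proof -
      have "\<forall>i\<in>{1..N}. l2b (\<lambda>k. 1 * coef N a i k (lifted (y 0) (u 0))) (B0 * size0 n y u Xh xh)"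
        using size0_nonneg(2)[OF sol] B0 by (auto intro!: l2b_mono[OF B0(2)] mult_left_mono)
      from K(2)[OF sol t _ this i] show ?thesis by (simp add: distrib_right)
    qed
    define Cc where "Cc = C + (\<Sum>p<d. C) + obs_tail N n0 n (\<lambda>i k. C + (B0 + K))"
    have Cc: "0 \<le> Cc" unfolding Cc_def obs_tail_def using C B0 K by (intro add_nonneg_nonneg sum_nonneg) auto
    have ctrl: "controller_norm N n0 n (u t) (Xh t) (xh t) \<le> Cc * size0 n y u Xh xh * exp (- \<delta> * t)"
      if sol: "closed_loop n y u Xh xh" and t: "0 \<le> t" for y u Xh xh t
    proof -
      define F where "F = size0 n y u Xh xh * exp (- \<delta> * t)"
      have X: "Xh t \<in> carrier_vec d" using sol t by (auto simp: closed_loop_solution_def Let_def)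
      note b = dec[OF sol t]
      have "\<bar>xh t i k\<bar> \<le> (C + (B0 + K)) * F" if "i \<in> {1..N}" "k \<in> {n0 i..n i}" for i k
      proof -
        have "\<bar>coef N a i k (lifted (y t) (u t))\<bar> \<le> exp (- \<delta> * t) * ((B0 + K) * size0 n y u Xh xh)"
          by (rule l2b_member[OF modes[OF sol t that(1)]])
        moreover have "\<bar>xh t i k - coef N a i k (lifted (y t) (u t))\<bar> \<le> C * size0 n y u Xh xh * exp (- \<delta> * t)"
          using b that by blast
        ultimately have "\<bar>xh t i k\<bar> \<le> C * size0 n y u Xh xh * exp (- \<delta> * t) + exp (- \<delta> * t) * ((B0 + K) * size0 n y u Xh xh)"
          by linarith
        then show ?thesis by (simp add: F_def algebra_simps)
      qed
      then have "obs_tail N n0 n (\<lambda>i k. \<bar>xh t i k\<bar>) \<le> obs_tail N n0 n (\<lambda>i k. (C + (B0 + K)) * F)"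
        by (intro obs_tail_mono)
      also have "\<dots> = obs_tail N n0 n (\<lambda>i k. C + (B0 + K)) * F"
        by (simp only: obs_tail_def sum_distrib_right)
      finally have 1: "obs_tail N n0 n (\<lambda>i k. \<bar>xh t i k\<bar>) \<le> obs_tail N n0 n (\<lambda>i k. C + (B0 + K)) * F" .
      have 2: "(\<Sum>p<d. \<bar>Xh t $ p\<bar>) \<le> (\<Sum>p<d. C) * F"
        unfolding sum_distrib_right using b by (intro sum_mono) (auto simp: F_def mult.assoc)
      have 3: "\<bar>u t\<bar> \<le> C * F" using b by (simp add: F_def mult.assoc)
      have "controller_norm N n0 n (u t) (Xh t) (xh t) \<le> C * F + (\<Sum>p<d. C) * F + obs_tail N n0 n (\<lambda>i k. C + (B0 + K)) * F"
        using controller_norm_bounds(4)[OF X, of n "u t" "xh t"] 1 2 3 by linarith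
      also have "\<dots> = Cc * F" by (simp only: Cc_def distrib_right)
      finally show ?thesis by (simp add: F_def mult.assoc)
    qed
    define S0 where "S0 = real N * (D0 * (B0 + K) + C * \<Sigma>L)"
    have S0: "0 \<le> S0" unfolding S0_def using D0 B0 K C \<Sigma>L by (intro mult_nonneg_nonneg add_nonneg_nonneg) auto
    have state0: "norm_H0 N (y t) \<le> S0 * size0 n y u Xh xh * exp (- \<delta> * t)"
      if sol: "closed_loop n y u Xh xh" and t: "0 \<le> t" for y u Xh xh t
    proof -
      define F where "F = size0 n y u Xh xh * exp (- \<delta> * t)"
      have "norm (y t j) \<le> (D0 * (B0 + K) + C * \<Sigma>L) * F" if j: "j \<in> {1..N}" for j
      proof -
        have "norm (y t j - u t *\<^sub>R Lift j) \<le> D0 * (exp (- \<delta> * t) * ((B0 + K) * size0 n y u Xh xh))"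
          using D0(2)[of "lifted (y t) (u t)", OF _ j] modes[OF sol t] by blast
        moreover have "\<bar>u t\<bar> * norm (Lift j) \<le> (C * F) * \<Sigma>L"
        proof (rule mult_mono)
          show "\<bar>u t\<bar> \<le> C * F" using dec[OF sol t] by (simp add: F_def mult.assoc)
          have "norm (Lift j) \<le> norm (Lift j) + norm (weak_deriv (Lift j))" by simp
          also have "\<dots> \<le> \<Sigma>L" unfolding \<Sigma>L_def using j
            by (intro member_le_sum[of j "{1..N}" "\<lambda>j. norm (Lift j) + norm (weak_deriv (Lift j))"]) auto
          finally show "norm (Lift j) \<le> \<Sigma>L" .
          show "0 \<le> C * F" using C size0_nonneg[OF sol] by (simp add: F_def)
        qed simp
        moreover have "norm (y t j) \<le> norm (y t j - u t *\<^sub>R Lift j) + \<bar>u t\<bar> * norm (Lift j)"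
          using norm_triangle_ineq[of "y t j - u t *\<^sub>R Lift j" "u t *\<^sub>R Lift j"] by simp
        ultimately have "norm (y t j) \<le> D0 * (exp (- \<delta> * t) * ((B0 + K) * size0 n y u Xh xh)) + (C * F) * \<Sigma>L"
          by linarith
        then show ?thesis by (simp add: F_def algebra_simps)
      qed
      then have "(\<Sum>j=1..N. norm (y t j)) \<le> (\<Sum>j=1..N. (D0 * (B0 + K) + C * \<Sigma>L) * F)" by (intro sum_mono)
      then show ?thesis using norm_H0_bounds(2)[of N "y t"] by (simp add: S0_def F_def mult.assoc)
    qed
    define S1 where "S1 = real N * (D1 * (B0 + B1 + K) + C * \<Sigma>L)"
    have S1: "0 \<le> S1" unfolding S1_def using D1 B0 B1 K C \<Sigma>L by (intro mult_nonneg_nonneg add_nonneg_nonneg) auto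
    have state1: "(\<forall>j\<in>{1..N}. y t j \<in> H1) \<and>
        norm_H1 N (y t) \<le> S1 * (norm_H1 N (y 0) + controller_norm N n0 n (u 0) (Xh 0) (xh 0)) * exp (- \<delta> * t)"
      if sol: "closed_loop n y u Xh xh" and dom: "cascade_dom N (y 0) (u 0)" and t: "0 \<le> t" for y u Xh xh t
    proof -
      define J1 where "J1 = norm_H1 N (y 0) + controller_norm N n0 n (u 0) (Xh 0) (xh 0)"
      define F where "F = J1 * exp (- \<delta> * t)"
      have X0: "Xh 0 \<in> carrier_vec d" using sol by (auto simp: closed_loop_solution_def Let_def)
      have J: "size0 n y u Xh xh \<le> J1" using norm_H1_bounds(3)[of N "y 0"] by (simp add: size0_def J1_def)
      have u0: "norm_H1 N (y 0) + \<bar>u 0\<bar> \<le> J1"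
        using controller_norm_bounds(1)[OF X0, of "u 0" n "xh 0"] by (simp add: J1_def)
      have F: "0 \<le> F" using J size0_nonneg(1)[OF sol] by (simp add: F_def)
      have y0: "\<forall>j\<in>{1..N}. y 0 j \<in> H1" using dom by (auto simp: cascade_dom_def H2_def)
      have w10: "\<forall>i\<in>{1..N}. l2b (\<lambda>k. real k * coef N a i k (lifted (y 0) (u 0))) (B1 * J1)"
        using u0 B1(1) by (auto intro!: l2b_mono[OF B1(2)[OF _ y0, of _ "u 0"]] mult_left_mono)
      have w1: "l2b (\<lambda>k. real k * coef N a i k (lifted (y t) (u t))) (exp (- \<delta> * t) * (B1 * J1 + K * size0 n y u Xh xh))"
        if "i \<in> {1..N}" for i
        by (rule K(2)[where \<omega> = real, OF sol t _ w10 that]) simp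
      have le: "exp (- \<delta> * t) * (B1 * J1 + K * size0 n y u Xh xh) \<le> (B0 + B1 + K) * F"
        "exp (- \<delta> * t) * ((B0 + K) * size0 n y u Xh xh) \<le> (B0 + B1 + K) * F"
      proof -
        have J1: "0 \<le> J1" using J size0_nonneg(1)[OF sol] by linarith
        have "B1 * J1 + K * size0 n y u Xh xh \<le> B1 * J1 + K * J1" "(B0 + K) * size0 n y u Xh xh \<le> (B0 + K) * J1"
          using J K(1) B0(1) by (auto intro!: mult_left_mono)
        moreover have "0 \<le> B0 * J1" "0 \<le> B1 * J1" using B0(1) B1(1) J1 by auto
        ultimately have "B1 * J1 + K * size0 n y u Xh xh \<le> (B0 + B1 + K) * J1" "(B0 + K) * size0 n y u Xh xh \<le> (B0 + B1 + K) * J1"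
          unfolding distrib_right by linarith+
        from this[THEN mult_left_mono[of _ _ "exp (- \<delta> * t)"]]
        show "exp (- \<delta> * t) * (B1 * J1 + K * size0 n y u Xh xh) \<le> (B0 + B1 + K) * F"
          "exp (- \<delta> * t) * ((B0 + K) * size0 n y u Xh xh) \<le> (B0 + B1 + K) * F"
          by (simp_all add: F_def mult_ac)
      qed
      have W: "y t j - u t *\<^sub>R Lift j \<in> H1 \<and> norm (y t j - u t *\<^sub>R Lift j) + norm (weak_deriv (y t j - u t *\<^sub>R Lift j)) \<le> D1 * ((B0 + B1 + K) * F)"
        if j: "j \<in> {1..N}" for j
      proof (rule D1(2)[of "lifted (y t) (u t)", OF _ j], intro ballI conjI)
        fix i assume i: "i \<in> {1..N}"
        show "l2b (\<lambda>k. coef N a i k (lifted (y t) (u t))) ((B0 + B1 + K) * F)"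
          by (rule l2b_mono[OF modes[OF sol t i] _ le(2)]) simp
        show "l2b (\<lambda>k. real k * coef N a i k (lifted (y t) (u t))) ((B0 + B1 + K) * F)"
          by (rule l2b_mono[OF w1[OF i] _ le(1)]) simp
      qed
      have y_eq: "y t j = (y t j - u t *\<^sub>R Lift j) + u t *\<^sub>R Lift j" for j by simp
      have H1: "y t j \<in> H1" if j: "j \<in> {1..N}" for j
        by (subst y_eq) (intro H1_add H1_scale Lift_H1 j conjunct1[OF W])
      have "norm (y t j) + norm (weak_deriv (y t j)) \<le> (D1 * (B0 + B1 + K) + C * \<Sigma>L) * F" if j: "j \<in> {1..N}" for j
      proof -
        have wd: "weak_deriv (y t j) = weak_deriv (y t j - u t *\<^sub>R Lift j) + u t *\<^sub>R weak_deriv (Lift j)"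
          by (subst (1) y_eq) (simp only: weak_deriv_add weak_deriv_scale H1_scale Lift_H1[OF j] conjunct1[OF W[OF j]])
        have "\<bar>u t\<bar> * (norm (Lift j) + norm (weak_deriv (Lift j))) \<le> (C * F) * \<Sigma>L"
        proof (rule mult_mono)
          have "\<bar>u t\<bar> \<le> C * (size0 n y u Xh xh * exp (- \<delta> * t))" using dec[OF sol t] by (simp add: mult.assoc)
          also have "\<dots> \<le> C * F" unfolding F_def using C J by (intro mult_left_mono mult_right_mono) auto
          finally show "\<bar>u t\<bar> \<le> C * F" .
          show "norm (Lift j) + norm (weak_deriv (Lift j)) \<le> \<Sigma>L" unfolding \<Sigma>L_def using j
            by (intro member_le_sum[of j "{1..N}" "\<lambda>j. norm (Lift j) + norm (weak_deriv (Lift j))"]) auto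
          show "0 \<le> C * F" using C F by simp
        qed simp
        moreover have "norm (y t j) \<le> norm (y t j - u t *\<^sub>R Lift j) + \<bar>u t\<bar> * norm (Lift j)"
          using norm_triangle_ineq[of "y t j - u t *\<^sub>R Lift j" "u t *\<^sub>R Lift j"] by simp
        moreover have "norm (weak_deriv (y t j)) \<le> norm (weak_deriv (y t j - u t *\<^sub>R Lift j)) + \<bar>u t\<bar> * norm (weak_deriv (Lift j))"
          unfolding wd using norm_triangle_ineq[of "weak_deriv (y t j - u t *\<^sub>R Lift j)" "u t *\<^sub>R weak_deriv (Lift j)"] by simp
        ultimately have "norm (y t j) + norm (weak_deriv (y t j)) \<le> D1 * ((B0 + B1 + K) * F) + (C * F) * \<Sigma>L"
          using conjunct2[OF W[OF j]] unfolding distrib_left by linarith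
        then show ?thesis by (simp add: algebra_simps)
      qed
      then have "(\<Sum>j=1..N. norm (y t j) + norm (weak_deriv (y t j))) \<le> (\<Sum>j=1..N. (D1 * (B0 + B1 + K) + C * \<Sigma>L) * F)"
        by (intro sum_mono)
      then have "norm_H1 N (y t) \<le> S1 * F"
        using norm_H1_bounds(2)[of N "y t"] by (simp add: S1_def mult.assoc)
      then show ?thesis using H1 by (simp add: F_def J1_def mult.assoc)
    qed
    show "?mean_square n \<and> ?energy n"
    proof (rule conjI; intro exI conjI allI impI)
      show "0 < S0 + Cc + 1" "0 < S1 + Cc + 1" using S0 S1 Cc by simp_all
    next
      fix y u Xh xh and t :: real
      assume sol: "closed_loop n y u Xh xh" and t: "0 \<le> t"
      define F where "F = size0 n y u Xh xh * exp (- \<delta> * t)"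
      have "0 \<le> F" using size0_nonneg(1)[OF sol] by (simp add: F_def)
      moreover have "norm_H0 N (y t) + controller_norm N n0 n (u t) (Xh t) (xh t) \<le> S0 * F + Cc * F"
        using state0[OF sol t] ctrl[OF sol t] by (simp add: F_def mult.assoc)
      ultimately have "norm_H0 N (y t) + controller_norm N n0 n (u t) (Xh t) (xh t) \<le> (S0 + Cc + 1) * F"
        unfolding distrib_right by linarith
      then show "norm_H0 N (y t) + controller_norm N n0 n (u t) (Xh t) (xh t)
          \<le> (S0 + Cc + 1) * exp (- \<delta> * t) * (norm_H0 N (y 0) + controller_norm N n0 n (u 0) (Xh 0) (xh 0))"
        by (simp add: F_def size0_def mult_ac)
    next
      fix y u Xh xh and t :: real
      assume sol: "closed_loop n y u Xh xh" and dom: "cascade_dom N (y 0) (u 0)" and t: "0 \<le> t"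
      show "\<forall>j\<in>{1..N}. y t j \<in> H1" using state1[OF sol dom t] by blast
      define F where "F = (norm_H1 N (y 0) + controller_norm N n0 n (u 0) (Xh 0) (xh 0)) * exp (- \<delta> * t)"
      have le: "size0 n y u Xh xh * exp (- \<delta> * t) \<le> F"
        unfolding F_def using norm_H1_bounds(3)[of N "y 0"] by (intro mult_right_mono) (auto simp: size0_def)
      have F0: "0 \<le> F" by (rule order_trans[OF _ le]) (use size0_nonneg(1)[OF sol] in simp)
      have "controller_norm N n0 n (u t) (Xh t) (xh t) \<le> Cc * F"
        using ctrl[OF sol t] mult_left_mono[OF le Cc] by (simp add: mult.assoc)
      then have "norm_H1 N (y t) + controller_norm N n0 n (u t) (Xh t) (xh t) \<le> (S1 + Cc + 1) * F"
        using state1[OF sol dom t] F0 unfolding distrib_right by (simp add: F_def mult.assoc)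
      then show "norm_H1 N (y t) + controller_norm N n0 n (u t) (Xh t) (xh t)
          \<le> (S1 + Cc + 1) * exp (- \<delta> * t) * (norm_H1 N (y 0) + controller_norm N n0 n (u 0) (Xh 0) (xh 0))"
        by (simp add: F_def mult_ac)
    qed
  qed
qed

end

theorem theorem1:
  fixes N :: nat and a :: "nat \<Rightarrow> real" and c :: "real \<Rightarrow> real" and \<delta> :: real
    and n0 :: "nat \<Rightarrow> nat" and Kx :: "real vec" and ku :: real and L :: "real vec"
  assumes "1 \<le> N"
    and "disjoint_family_on (\<lambda>i. {a i - (real k)\<^sup>2 * pi\<^sup>2 | k :: nat. True}) {1..N}"
    and "square_integrable c"
    and "N = 1 \<longrightarrow> (LINT x|unit_leb. c x * lifting x) = 0"
    and "\<delta> > 0"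
    and "\<forall>i\<in>{1..N}. lam a i (n0 i) < - \<delta>"
    and "\<forall>k<n0 1. (LINT x|unit_leb. c x * cos (real k * pi * x)) \<noteq> 0"
    and "\<forall>i\<in>{2..N}. \<forall>k<n0 i.
           (LINT x|unit_leb. complex_of_real (c x) * cosh (rt a i k 1 * complex_of_real (1 - x))) \<noteq> 0"
    and "Kx \<in> carrier_vec (dim0 N n0)"
    and "L \<in> carrier_vec (dim0 N n0)"
    and "spectral_abscissa (A1a N a n0 - B1a N a n0 * gain_row Kx ku) < ereal (- \<delta>)"
    and "spectral_abscissa (A1 N a n0 - mat_of_col L * mat_of_row (C1 N a c n0)) < ereal (- \<delta>)"
  shows "\<exists>M. \<forall>n. (\<forall>i\<in>{1..N}. n0 i \<le> n i \<and> M \<le> n i) \<longrightarrow>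
    (\<exists>C>0. \<forall>y u Xh xh. closed_loop_solution N a c n0 n Kx ku L y u Xh xh \<longrightarrow>
       (\<forall>t\<ge>0. norm_H0 N (y t) + controller_norm N n0 n (u t) (Xh t) (xh t)
          \<le> C * exp (- \<delta> * t)
              * (norm_H0 N (y 0) + controller_norm N n0 n (u 0) (Xh 0) (xh 0)))) \<and>
    (\<exists>C>0. \<forall>y u Xh xh. closed_loop_solution N a c n0 n Kx ku L y u Xh xh \<longrightarrow>
       cascade_dom N (y 0) (u 0) \<longrightarrow>
       (\<forall>t\<ge>0. (\<forall>j\<in>{1..N}. y t j \<in> H1) \<and>
          norm_H1 N (y t) + controller_norm N n0 n (u t) (Xh t) (xh t)
          \<le> C * exp (- \<delta> * t)
              * (norm_H1 N (y 0) + controller_norm N n0 n (u 0) (Xh 0) (xh 0))))"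
proof -
  have "lam a i k \<noteq> lam a j m" if "i \<in> {1..N}" "j \<in> {1..N}" "i \<noteq> j" for i j k m
    using disjoint_family_onD[OF assms(2) that] by (auto simp: lam_def)
  then interpret controlled_cascade N a c \<delta> n0 Kx ku L
    by unfold_locales (use assms in auto)
  show ?thesis by (rule closed_loop_decay)
qed

end
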